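(* The BBM equation $i\partial_t u=\varphi(D_x)u+\tfrac12\mathcal N(u)$ on $\mathbb T$ is almost surely globally well-posed in $H^{-\varepsilon}(\mathbb T)$, for any $0<\varepsilon\ll1$, with respect to the random initial data $$u_0^\omega=\sum_{n\in\mathbb Z}\frac{g_n(\omega)}{\langle n\rangle^{1/2}}e^{inx}.$$ More precisely, for $s<1$ sufficiently close to $1$ and for almost every $\omega\in\Omega$, there exists a unique solution $u$ with $u|_{t=0}=u_0^\omega$ in the class $$e^{-it\varphi(D_x)}u_0^\omega+C(\mathbb R;H^s(\mathbb T))\subset C(\mathbb R;H^{-\varepsilon}(\mathbb T)).$$
   Context: $\mathbb T=\mathbb R/(2\pi\mathbb Z)$, $\langle n\rangle=(1+n^2)^{1/2}$, $D_x=-i\partial_x$, and $\varphi(D_x)$ is the Fourier multiplier with symbol $\varphi(n)=\frac{n}{1+n^2}$; $S(t)=e^{-it\varphi(D_x)}$. $\{g_n\}_{n\in\mathbb Z}$ are standard complex-valued Gaussian random variables ($\mathbb E[g_n]=0$, $\mathbb E|g_n|^2=1$) on a probability space $(\Omega,\mathcal F,\mathbb P)$, with $g_{-n}=\overline{g_n}$, $g_0$ real, and $\{g_n\}_{n\ge0}$ independent. The nonlinearity is $$\mathcal N(u)=\sum_{n\ne0}\varphi(n)e^{inx}\sum_{n_1+n_2=n}\widehat u(n_1)\widehat u(n_2)$$ (it equals $\varphi(D_x)(u^2)$ if $u\in L^2(\mathbb T)$). A solution is a function satisfying the Duhamel formula $u(t)=S(t)u_0-\frac i2\int_0^tS(t-t')\mathcal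 N(u(t'))\,dt'$. With $z=z^\omega=S(t)u_0^\omega$ and $u=z+v$, $v$ continuous in time with values in $H^s(\mathbb T)$, the nonlinearity means $\mathcal N(u)=\varphi(D_x)(v^2+2zv)+\mathcal N(z)$, where in $\mathcal N(z)$ the inner sum for each $n\neq0$ is the limit in $L^2(\Omega)$ as $M\to\infty$ of the sums restricted to $|n_1|,|n_2|\le M$ (equivalently, $\mathcal N(z)$ is the limit of $\mathcal N$ applied to mollifications of $z$). Uniqueness means uniqueness among functions of the form $u=z^\omega+v$ with $v\in C(\mathbb R;H^s(\mathbb T))$. *)

theory Defs
  imports "HOL-Probability.Probability"
begin

text \<open>
  A distribution on the torus R/(2 pi Z) is represented by its sequence of Fourier coefficients
  \<open>a :: int \<Rightarrow> complex\<close>, i.e. it is the sum of \<open>a n * exp (i n x)\<close> over all integers \<open>n\<close>.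
\<close>

definition jbracket :: "int \<Rightarrow> real" where
  "jbracket n = sqrt (1 + (real_of_int n)\<^sup>2)"

definition phi :: "int \<Rightarrow> real" where
  "phi n = real_of_int n / (1 + (real_of_int n)\<^sup>2)"

definition phi_D :: "(int \<Rightarrow> complex) \<Rightarrow> int \<Rightarrow> complex" where
  "phi_D a = (\<lambda>n. complex_of_real (phi n) * a n)"

definition S_prop :: "real \<Rightarrow> (int \<Rightarrow> complex) \<Rightarrow> int \<Rightarrow> complex" where
  "S_prop t a = (\<lambda>n. exp (- (\<i> * complex_of_real t * complex_of_real (phi n))) * a n)"

definition sobolev :: "real \<Rightarrow> (int \<Rightarrow> complex) set" where
  "sobolev s = {a. (\<lambda>n. (jbracket n powr s * cmod (a n))\<^sup>2) summable_on UNIV}"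

definition sobolev_norm :: "real \<Rightarrow> (int \<Rightarrow> complex) \<Rightarrow> real" where
  "sobolev_norm s a = sqrt (\<Sum>\<^sub>\<infinity>n. (jbracket n powr s * cmod (a n))\<^sup>2)"

definition C_sobolev :: "real \<Rightarrow> (real \<Rightarrow> int \<Rightarrow> complex) set" where
  "C_sobolev s = {v. (\<forall>t. v t \<in> sobolev s) \<and>
     (\<forall>t. ((\<lambda>t'. sobolev_norm s (\<lambda>n. v t' n - v t n)) \<longlongrightarrow> 0) (at t))}"

text \<open>
  The product of two distributions on the Fourier side. The sum converges absolutely when the
  factors lie in \<open>sobolev s\<close> and \<open>sobolev (-s)\<close>; it is used only in that situation.
\<close>

definition fprod :: "(int \<Rightarrow> complex) \<Rightarrow> (int \<Rightarrow> complex) \<Rightarrow> int \<Rightarrow> complex" where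
  "fprod a b = (\<lambda>n. \<Sum>\<^sub>\<infinity>k. a k * b (n - k))"

definition trunc_square :: "nat \<Rightarrow> (int \<Rightarrow> complex) \<Rightarrow> int \<Rightarrow> complex" where
  "trunc_square N a = (\<lambda>n. \<Sum>k | \<bar>k\<bar> \<le> int N \<and> \<bar>n - k\<bar> \<le> int N. a k * a (n - k))"

text \<open>
  The normalisation of a standard complex Gaussian is the circularly symmetric one: real and
  imaginary part are independent and centred with variance 1/2 each, so that the second absolute
  moment is 1.
\<close>

definition std_complex_gaussian :: "'a measure \<Rightarrow> ('a \<Rightarrow> complex) \<Rightarrow> bool" where
  "std_complex_gaussian M X \<longleftrightarrow>
     distributed M lborel (\<lambda>\<omega>. Re (X \<omega>)) (normal_density 0 (sqrt (1 / 2))) \<and>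
     distributed M lborel (\<lambda>\<omega>. Im (X \<omega>)) (normal_density 0 (sqrt (1 / 2))) \<and>
     prob_space.indep_var M borel (\<lambda>\<omega>. Re (X \<omega>)) borel (\<lambda>\<omega>. Im (X \<omega>))"

definition std_real_gaussian :: "'a measure \<Rightarrow> ('a \<Rightarrow> complex) \<Rightarrow> bool" where
  "std_real_gaussian M X \<longleftrightarrow>
     (\<forall>\<omega>\<in>space M. Im (X \<omega>) = 0) \<and>
     distributed M lborel (\<lambda>\<omega>. Re (X \<omega>)) (normal_density 0 1)"

definition random_data :: "(int \<Rightarrow> 'a \<Rightarrow> complex) \<Rightarrow> 'a \<Rightarrow> int \<Rightarrow> complex" where
  "random_data g \<omega> = (\<lambda>n. g n \<omega> / complex_of_real (jbracket n powr (1 / 2)))"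

definition free_evol :: "(int \<Rightarrow> 'a \<Rightarrow> complex) \<Rightarrow> 'a \<Rightarrow> real \<Rightarrow> int \<Rightarrow> complex" where
  "free_evol g \<omega> t = S_prop t (random_data g \<omega>)"

definition L2_limit ::
  "'a measure \<Rightarrow> (nat \<Rightarrow> 'a \<Rightarrow> complex) \<Rightarrow> ('a \<Rightarrow> complex) \<Rightarrow> bool" where
  "L2_limit M X Y \<longleftrightarrow> Y \<in> borel_measurable M \<and>
     (\<forall>N. integrable M (\<lambda>\<omega>. (cmod (X N \<omega>))\<^sup>2)) \<and> integrable M (\<lambda>\<omega>. (cmod (Y \<omega>))\<^sup>2) \<and>
     (\<lambda>N. \<integral>\<omega>. (cmod (X N \<omega> - Y \<omega>))\<^sup>2 \<partial>M) \<longlonglongrightarrow> 0"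

text \<open>
  A limit in the space of square integrable random variables is determined, for each time and
  frequency, only up to a null set, whereas the Duhamel formula integrates it in time for a fixed
  sample point. Hence a representative that is jointly measurable in time and sample point is
  needed; by Fubini, two such representatives agree for almost every sample point at almost every
  time. The zero mode plays no role, as \<open>phi 0 = 0\<close>.
\<close>

definition square_version ::
  "'a measure \<Rightarrow> (int \<Rightarrow> 'a \<Rightarrow> complex) \<Rightarrow> ('a \<Rightarrow> real \<Rightarrow> int \<Rightarrow> complex) \<Rightarrow> bool" where
  "square_version M g Q \<longleftrightarrow>
     (\<forall>n. n \<noteq> 0 \<longrightarrow>
        (\<lambda>(t, \<omega>). Q \<omega> t n) \<in> borel_measurable (borel \<Otimes>\<^sub>M M) \<and>
        (\<forall>t. L2_limit M (\<lambda>N \<omega>. trunc_square N (free_evol g \<omega> t) n) (\<lambda>\<omega>. Q \<omega> t n)))"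

text \<open>
  The nonlinearity at one time, for a function with random part \<open>z\<close> and remainder \<open>v\<close>, where \<open>q\<close>
  is the limit square of \<open>z\<close>.
\<close>

definition bbm_nonlin ::
  "(int \<Rightarrow> complex) \<Rightarrow> (int \<Rightarrow> complex) \<Rightarrow> (int \<Rightarrow> complex) \<Rightarrow> int \<Rightarrow> complex" where
  "bbm_nonlin z q v = (\<lambda>n. phi_D (\<lambda>m. fprod v v m + 2 * fprod z v m) n + phi_D q n)"

definition affine_class ::
  "(real \<Rightarrow> int \<Rightarrow> complex) \<Rightarrow> real \<Rightarrow> (real \<Rightarrow> int \<Rightarrow> complex) set" where
  "affine_class z s = {u. \<exists>v \<in> C_sobolev s. u = (\<lambda>t n. z t n + v t n)}"

text \<open>The Duhamel formula, tested against each Fourier mode.\<close>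

definition bbm_solution ::
  "(real \<Rightarrow> int \<Rightarrow> complex) \<Rightarrow> (real \<Rightarrow> int \<Rightarrow> complex) \<Rightarrow> (int \<Rightarrow> complex) \<Rightarrow>
   (real \<Rightarrow> int \<Rightarrow> complex) \<Rightarrow> bool" where
  "bbm_solution z q u0 u \<longleftrightarrow>
     (\<forall>t n.
        let F = (\<lambda>t'. S_prop (t - t') (bbm_nonlin (z t') (q t') (\<lambda>m. u t' m - z t' m)) n) in
        interval_lebesgue_integrable lborel 0 (ereal t) F \<and>
        u t n = S_prop t u0 n - \<i> / 2 * (LBINT t'=0..ereal t. F t'))"

end

theory Submission
  imports Defs "HOL-Real_Asymp.Real_Asymp"
begin

text \<open>
  Write \<open>u = z + v\<close>, where \<open>z\<close> is the free evolution of the data and \<open>v\<close> starts from zero. Then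
  \<open>v\<close> solves \<open>i v' = phi(D) (v + (v\<^sup>2 + 2 z v + q) / 2)\<close>, where \<open>q\<close> is the limit square of \<open>z\<close>.

  Local theory. Almost surely \<open>z\<close> and \<open>q\<close> lie in \<open>H\<^sup>-\<^sup>e\<close> for every positive \<open>e\<close>. Multiplication by an
  element of \<open>H\<^sup>s\<close>, with \<open>s > 1 / 2 + e\<close>, preserves this space (\<open>fprod_sobolev\<close>), and \<open>phi(D)\<close> gains
  one derivative (\<open>phi_smoothing\<close>). So for \<open>s\<close> slightly below 1 the equation for \<open>v\<close> is an ordinary
  differential equation in the Banach space \<open>H\<^sup>s\<close> with a locally Lipschitz vector field, and
  uniqueness is Gronwall's inequality.

  Global existence. The quantity that the equation conserves for smooth data is the \<open>H\<^sup>1\<close> norm, and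
  \<open>v\<close> only has regularity just below 1. The solution is therefore cut sharply at a frequency \<open>N\<close>. The energy of the low
  part \<open>w\<close> is not changed by the interaction of \<open>w\<close> with itself (\<open>energy_cancellation\<close>). The high
  part is as small as a negative power of \<open>N\<close>, because \<open>phi(D)\<close> gains strictly more than what is
  needed to land in \<open>H\<^sup>s\<close> (\<open>high_field_bound\<close>). The interaction of \<open>w\<close> with the data makes the energy
  grow at an exponential rate proportional to the \<open>L\<^sup>2\<close> norm of the data up to frequency \<open>2 N\<close>. The
  expected square of that norm is like the sum of \<open>1 / n\<close>, so the norm is of smaller order than
  \<open>ln N\<close>; hence on a fixed time interval the growth factor is less than any power of \<open>N\<close>, and for
  large \<open>N\<close> the estimates for the two parts close (\<open>a_priori_bound\<close>). To avoid a continuation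
  argument, the equation is first solved globally with the argument of the nonlinearity truncated by
  a scalar; the a priori bound holds for these solutions with the same constant, and shows that a
  suitable truncation is never active.

  Randomness. Apart from the size of the data (\<open>AE_log_mass\<close>), only \<open>q\<close> requires independence. For a
  nonzero frequency \<open>n\<close>, the products \<open>g k * g (n - k)\<close> are orthogonal up to the symmetry
  \<open>k \<mapsto> n - k\<close> (\<open>pair_orthogonal\<close>), so the truncated squares converge in mean square, and along
  a fast subsequence almost surely. The time derivative of the square is given by an absolutely
  convergent sum, because the oscillation frequencies \<open>phi k + phi (n - k)\<close> decay in \<open>k\<close>
  (\<open>trunc_time_difference\<close>). This gives a version of \<open>q\<close> that is almost surely Lipschitz in time
  with values in \<open>H\<^sup>-\<^sup>e\<close>. Any other version agrees with it for almost every sample point at almost every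
  time (\<open>AE_version_eq_limit_square\<close>), which the Duhamel formula does not see.
\<close>

section \<open>Japanese brackets\<close>

lemma jbracket_ge_1: "1 \<le> jbracket n"
  by (simp add: jbracket_def)

lemma jbracket_pos [simp]: "0 < jbracket n"
  using jbracket_ge_1[of n] by linarith

lemma jbracket_nonzero [simp]: "jbracket n \<noteq> 0"
  using jbracket_pos[of n] by linarith

lemma jbracket_minus [simp]: "jbracket (- n) = jbracket n"
  by (simp add: jbracket_def)

lemma abs_le_jbracket: "\<bar>real_of_int n\<bar> \<le> jbracket n"
  by (simp add: jbracket_def real_le_rsqrt)

lemma jbracket_le: "jbracket n \<le> 1 + \<bar>real_of_int n\<bar>"
  unfolding jbracket_def by (rule real_le_lsqrt) (auto simp: power2_eq_square algebra_simps)

lemma jbracket_add: "jbracket (m + n) \<le> jbracket m + jbracket n"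
proof -
  have "norm (Complex 1 (real_of_int m) + Complex 0 (real_of_int n))
      \<le> norm (Complex 1 (real_of_int m)) + norm (Complex 0 (real_of_int n))"
    by (rule norm_triangle_ineq)
  then show ?thesis
    using abs_le_jbracket[of n] by (simp add: jbracket_def cmod_def)
qed

lemma jbracket_peetre: "jbracket n \<le> 2 * (jbracket k * jbracket (n - k))"
proof -
  have "jbracket n \<le> jbracket k + jbracket (n - k)"
    using jbracket_add[of k "n - k"] by simp
  moreover have "jbracket k \<le> jbracket k * jbracket (n - k)"
    using mult_left_mono[OF jbracket_ge_1[of "n - k"], of "jbracket k"] less_imp_le[OF jbracket_pos[of k]] by simp
  moreover have "jbracket (n - k) \<le> jbracket k * jbracket (n - k)"
    using mult_right_mono[OF jbracket_ge_1[of k], of "jbracket (n - k)"] less_imp_le[OF jbracket_pos[of "n - k"]] by simp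
  ultimately show ?thesis by linarith
qed

lemma phi_zero [simp]: "phi 0 = 0"
  by (simp add: phi_def)

lemma phi_minus [simp]: "phi (- n) = - phi n"
  by (simp add: phi_def)

lemma phi_jbracket: "phi n * (jbracket n)\<^sup>2 = real_of_int n"
  by (simp add: phi_def jbracket_def add_nonneg_eq_0_iff)

lemma abs_phi_le: "\<bar>phi n\<bar> \<le> 1 / jbracket n"
proof -
  have "\<bar>phi n\<bar> * (jbracket n)\<^sup>2 = \<bar>real_of_int n\<bar>"
    using phi_jbracket[of n] by (metis abs_mult abs_power2)
  also have "\<dots> \<le> jbracket n" by (rule abs_le_jbracket)
  finally have "(\<bar>phi n\<bar> * jbracket n) * jbracket n \<le> 1 * jbracket n"
    by (simp add: power2_eq_square mult.assoc)
  then have "\<bar>phi n\<bar> * jbracket n \<le> 1"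
    by (rule mult_right_le_imp_le) simp
  then show ?thesis by (simp add: field_simps)
qed

lemma abs_phi_le_1: "\<bar>phi n\<bar> \<le> 1"
proof -
  have "1 / jbracket n \<le> 1" using jbracket_ge_1[of n] by simp
  with abs_phi_le[of n] show ?thesis by linarith
qed

lemma summable_on_int_from_nat:
  fixes f :: "int \<Rightarrow> real" and h :: "nat \<Rightarrow> real"
  assumes h: "summable h" and f0: "\<And>n. 0 \<le> f n"
    and fh: "\<And>n. \<bar>n\<bar> \<ge> 1 \<Longrightarrow> f n \<le> h (nat \<bar>n\<bar>)" and h0: "\<And>k. 0 \<le> h k"
  shows "f summable_on UNIV"
proof (rule nonneg_bdd_above_summable_on)
  show "bdd_above (sum f ` {F. F \<subseteq> UNIV \<and> finite F})"
  proof (rule bdd_aboveI2)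
    fix F :: "int set" assume "F \<in> {F. F \<subseteq> UNIV \<and> finite F}"
    then have F: "finite F" by simp
    define N where "N = Max (insert 0 ((\<lambda>n. nat \<bar>n\<bar>) ` F))"
    have N: "\<bar>n\<bar> \<le> int N" if "n \<in> F" for n
      using Max_ge[of "insert 0 ((\<lambda>n. nat \<bar>n\<bar>) ` F)" "nat \<bar>n\<bar>"] that F
      unfolding N_def by (simp add: nat_le_iff)
    have "sum f F \<le> sum f {-int N..int N}"
      by (rule sum_mono2) (use N f0 in \<open>force+\<close>)
    also have "{-int N..int N} = {0} \<union> (int ` {1..N}) \<union> ((\<lambda>k. - int k) ` {1..N})"
    proof (intro equalityI subsetI)
      fix x assume x: "x \<in> {-int N..int N}"
      consider "x = 0" | "x > 0" | "x < 0" by linarith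
      then show "x \<in> {0} \<union> (int ` {1..N}) \<union> ((\<lambda>k. - int k) ` {1..N})"
      proof cases
        case 2
        then have "x = int (nat x)" "nat x \<in> {1..N}" using x by auto
        then show ?thesis by blast
      next
        case 3
        then have "x = - int (nat (-x))" "nat (-x) \<in> {1..N}" using x by auto
        then show ?thesis by blast
      qed simp
    qed auto
    also have "sum f \<dots> = f 0 + sum f (int ` {1..N}) + sum f ((\<lambda>k. - int k) ` {1..N})"
      by (subst sum.union_disjoint, force, force, force)+ simp
    also have "sum f (int ` {1..N}) = (\<Sum>k=1..N. f (int k))"
      by (subst sum.reindex) (auto simp: inj_on_def)
    also have "sum f ((\<lambda>k. - int k) ` {1..N}) = (\<Sum>k=1..N. f (- int k))"
      by (subst sum.reindex) (auto simp: inj_on_def)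
    also have "(\<Sum>k=1..N. f (int k)) \<le> (\<Sum>k=1..N. h k)"
      by (rule sum_mono) (use fh[of "int _"] in auto)
    also have "(\<Sum>k=1..N. f (- int k)) \<le> (\<Sum>k=1..N. h k)"
      by (rule sum_mono) (use fh[of "- int _"] in auto)
    also have "(\<Sum>k=1..N. h k) \<le> suminf h"
      by (rule sum_le_suminf) (use h h0 in auto)
    finally show "sum f F \<le> f 0 + suminf h + suminf h" by simp
  qed
qed (use f0 in auto)

lemma summable_jbracket_powr:
  assumes "p > 1"
  shows "(\<lambda>n. jbracket n powr (- p)) summable_on UNIV"
proof (rule summable_on_int_from_nat)
  show "summable (\<lambda>k. real k powr (- p))"
    using assms by (simp add: summable_real_powr_iff)
  fix n :: int assume "\<bar>n\<bar> \<ge> 1"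
  then show "jbracket n powr (- p) \<le> real (nat \<bar>n\<bar>) powr (- p)"
    using abs_le_jbracket[of n] assms by (intro powr_mono2') auto
qed auto

text \<open>Any exponent strictly between 1 and 2 would do. Above 1 the weights are summable, so that the
  random data almost surely have finite mass with the corresponding logarithmic weight; below 2 the
  square root of their mass up to frequency \<open>N\<close> then grows sublinearly in \<open>ln N\<close>, which is what
  the global bound consumes.\<close>

lemma summable_jbracket_ln:
  "(\<lambda>n. 1 / (jbracket n * (1 + ln (jbracket n)) powr (3 / 2))) summable_on UNIV"
proof (rule summable_on_int_from_nat)
  let ?h = "\<lambda>k::nat. if k = 0 then (1::real) else 1 / (real k * (1 + ln (real k)) powr (3 / 2))"
  have mono: "real k * (1 + ln (real k)) powr (3 / 2) \<le> real m * (1 + ln (real m)) powr (3 / 2)"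
    if "1 \<le> k" "k \<le> m" for k m :: nat
    using that by (intro mult_mono powr_mono2) auto
  show "summable ?h"
  proof (subst condensation_test)
    fix m :: nat assume "0 < m"
    moreover have "0 \<le> ln (real m)" using \<open>0 < m\<close> by (intro ln_ge_zero) auto
    then have "1 + ln (real m) \<noteq> 0" by linarith
    then have "0 < real m * (1 + ln (real m)) powr (3 / 2)"
      using \<open>0 < m\<close> by simp
    ultimately show "?h (Suc m) \<le> ?h m"
      using mono[of m "Suc m"] by (auto intro!: divide_left_mono simp del: of_nat_Suc)
  next
    have "summable (\<lambda>n. (1 / ln 2) powr (3 / 2) * real n powr (- (3 / 2)))"
      by (intro summable_mult) (simp add: summable_real_powr_iff)
    then show "summable (\<lambda>n. 2 ^ n * ?h (2 ^ n))"
    proof (rule summable_comparison_test_ev[rotated])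
      show "\<forall>\<^sub>F n in sequentially. norm (2 ^ n * ?h (2 ^ n)) \<le> (1 / ln 2) powr (3 / 2) * real n powr (- (3 / 2))"
      proof (rule eventually_sequentiallyI[of 1])
        fix n :: nat assume n: "1 \<le> n"
        have "2 ^ n * ?h (2 ^ n) = 1 / (1 + real n * ln 2) powr (3 / 2)"
          by (simp add: ln_realpow)
        also have "\<dots> \<le> 1 / (real n * ln 2) powr (3 / 2)"
          using n add_pos_nonneg[of 1 "real n * ln 2"] by (intro divide_left_mono powr_mono2 mult_pos_pos) (auto simp: add_nonneg_eq_0_iff)
        also have "\<dots> = (1 / ln 2) powr (3 / 2) * real n powr (- (3 / 2))"
          using n by (simp add: powr_mult powr_divide powr_minus divide_simps)
        finally show "norm (2 ^ n * ?h (2 ^ n)) \<le> (1 / ln 2) powr (3 / 2) * real n powr (- (3 / 2))"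
          by simp
      qed
    qed
  qed auto
  show "0 \<le> ?h k" for k by auto
  fix n :: int 
  show "0 \<le> 1 / (jbracket n * (1 + ln (jbracket n)) powr (3 / 2))"
    by (simp add: less_imp_le)
  assume n: "\<bar>n\<bar> \<ge> 1"
  let ?k = "real (nat \<bar>n\<bar>)"
  have k: "1 \<le> ?k" "?k \<le> jbracket n" using n abs_le_jbracket[of n] by auto
  then have "?k * (1 + ln ?k) powr (3 / 2) \<le> jbracket n * (1 + ln (jbracket n)) powr (3 / 2)"
    by (intro mult_mono powr_mono2) auto
  moreover have "0 < ?k * (1 + ln ?k) powr (3 / 2)"
  proof -
    have "0 \<le> ln ?k" using k(1) by (rule ln_ge_zero)
    then have "1 + ln ?k \<noteq> 0" by linarith
    then have "0 < (1 + ln ?k) powr (3 / 2)" by (rule powr_gt_zero[THEN iffD2])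
    moreover have "0 < ?k" using k(1) by linarith
    ultimately show ?thesis by (intro mult_pos_pos)
  qed
  moreover have "nat \<bar>n\<bar> \<noteq> 0" using n by simp
  ultimately show "1 / (jbracket n * (1 + ln (jbracket n)) powr (3 / 2)) \<le> ?h (nat \<bar>n\<bar>)"
    by (simp only: if_False) (rule frac_le, simp_all)
qed

section \<open>Square summable sequences\<close>

lemma L2_set_le_sqrt_infsum:
  fixes f :: "'i \<Rightarrow> real"
  assumes "(\<lambda>n. (f n)\<^sup>2) summable_on UNIV" "finite F"
  shows "L2_set f F \<le> sqrt (\<Sum>\<^sub>\<infinity>n. (f n)\<^sup>2)"
  unfolding L2_set_def
  using assms by (intro real_sqrt_le_mono finite_sum_le_infsum) auto

lemma sq_summable_if_L2_set_bounded:
  fixes f :: "'i \<Rightarrow> real"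
  assumes B: "\<And>F. finite F \<Longrightarrow> L2_set f F \<le> B"
  shows "(\<lambda>n. (f n)\<^sup>2) summable_on UNIV" and "sqrt (\<Sum>\<^sub>\<infinity>n. (f n)\<^sup>2) \<le> B"
proof -
  have B0: "0 \<le> B" using B[of "{}"] by simp
  have le: "(\<Sum>n\<in>F. (f n)\<^sup>2) \<le> B\<^sup>2" if "finite F" for F
    using B[OF that] B0 unfolding L2_set_def by (meson real_sqrt_le_iff real_le_lsqrt sqrt_le_D)
  show s: "(\<lambda>n. (f n)\<^sup>2) summable_on UNIV"
    by (rule nonneg_bdd_above_summable_on) (auto intro!: bdd_aboveI2[where M = "B\<^sup>2"] le)
  have "(\<Sum>\<^sub>\<infinity>n. (f n)\<^sup>2) \<le> B\<^sup>2"
    by (rule infsum_le_finite_sums[OF s]) (use le in auto)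
  then show "sqrt (\<Sum>\<^sub>\<infinity>n. (f n)\<^sup>2) \<le> B"
    using B0 by (meson real_le_lsqrt infsum_nonneg zero_le_power2)
qed

lemma L2_set_mono': 
  "(\<And>i. i \<in> K \<Longrightarrow> \<bar>f i\<bar> \<le> g i) \<Longrightarrow> L2_set f K \<le> L2_set g K"
  using L2_set_mono[of K "\<lambda>i. \<bar>f i\<bar>" g] by (simp add: L2_set_def)

text \<open>Every Sobolev space is isometric to this space by a change of weight, so a single instance of the
  class of Banach spaces serves for all regularities.\<close>

typedef ell2 = "{a :: int \<Rightarrow> complex. (\<lambda>n. (cmod (a n))\<^sup>2) summable_on UNIV}"
  morphisms coeff Abs_ell2
  by (rule exI[of _ "\<lambda>_. 0"]) simp

lemma coeff_sq_summable: "(\<lambda>n. (cmod (coeff a n))\<^sup>2) summable_on UNIV"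
  using coeff[of a] by simp

lemma ell2_eqI: "(\<And>n. coeff a n = coeff b n) \<Longrightarrow> a = b"
  by (simp add: coeff_inject[symmetric] fun_eq_iff)

lemma sq_summable_triangle:
  fixes a b c :: "int \<Rightarrow> complex"
  assumes "(\<lambda>n. (cmod (a n))\<^sup>2) summable_on UNIV" "(\<lambda>n. (cmod (b n))\<^sup>2) summable_on UNIV"
    and c: "\<And>n. cmod (c n) \<le> cmod (a n) + cmod (b n)"
  shows "(\<lambda>n. (cmod (c n))\<^sup>2) summable_on UNIV"
    and "sqrt (\<Sum>\<^sub>\<infinity>n. (cmod (c n))\<^sup>2) 
       \<le> sqrt (\<Sum>\<^sub>\<infinity>n. (cmod (a n))\<^sup>2) + sqrt (\<Sum>\<^sub>\<infinity>n. (cmod (b n))\<^sup>2)"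
proof -
  have "L2_set (\<lambda>n. cmod (c n)) F \<le> sqrt (\<Sum>\<^sub>\<infinity>n. (cmod (a n))\<^sup>2) + sqrt (\<Sum>\<^sub>\<infinity>n. (cmod (b n))\<^sup>2)"
    if F: "finite F" for F
  proof -
    have "L2_set (\<lambda>n. cmod (c n)) F \<le> L2_set (\<lambda>n. cmod (a n) + cmod (b n)) F"
      by (rule L2_set_mono') (simp add: c)
    also have "\<dots> \<le> L2_set (\<lambda>n. cmod (a n)) F + L2_set (\<lambda>n. cmod (b n)) F"
      by (rule L2_set_triangle_ineq)
    also have "\<dots> \<le> sqrt (\<Sum>\<^sub>\<infinity>n. (cmod (a n))\<^sup>2) + sqrt (\<Sum>\<^sub>\<infinity>n. (cmod (b n))\<^sup>2)"
      by (intro add_mono L2_set_le_sqrt_infsum assms F)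
    finally show ?thesis .
  qed
  then show "(\<lambda>n. (cmod (c n))\<^sup>2) summable_on UNIV"
    and "sqrt (\<Sum>\<^sub>\<infinity>n. (cmod (c n))\<^sup>2) 
       \<le> sqrt (\<Sum>\<^sub>\<infinity>n. (cmod (a n))\<^sup>2) + sqrt (\<Sum>\<^sub>\<infinity>n. (cmod (b n))\<^sup>2)"
    using sq_summable_if_L2_set_bounded[of "\<lambda>n. cmod (c n)"] by blast+
qed

instantiation ell2 :: real_normed_vector
begin

definition "0 = Abs_ell2 (\<lambda>_. 0)"
definition "a + b = Abs_ell2 (\<lambda>n. coeff a n + coeff b n)"
definition "- a = Abs_ell2 (\<lambda>n. - coeff a n)" for a :: ell2
definition "a - b = Abs_ell2 (\<lambda>n. coeff a n - coeff b n)"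
definition "r *\<^sub>R a = Abs_ell2 (\<lambda>n. r *\<^sub>R coeff a n)"
definition "norm a = sqrt (\<Sum>\<^sub>\<infinity>n. (cmod (coeff a n))\<^sup>2)"
definition "sgn a = (inverse (norm a)) *\<^sub>R (a :: ell2)"
definition "dist a b = norm (a - b)" for a :: ell2
definition "uniformity = (INF e\<in>{0<..}. principal {(a, b :: ell2). dist a b < e})"
definition "open U = (\<forall>a\<in>U. eventually (\<lambda>(a', b). a' = a \<longrightarrow> b \<in> U) uniformity)" for U :: "ell2 set"

lemma coeff_0: "coeff 0 n = 0"
  unfolding zero_ell2_def by (subst Abs_ell2_inverse) auto

lemma coeff_add: "coeff (a + b) n = coeff a n + coeff b n"
  unfolding plus_ell2_def
  by (subst Abs_ell2_inverse)
    (auto intro!: sq_summable_triangle(1)[OF coeff_sq_summable coeff_sq_summable] norm_triangle_ineq)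

lemma coeff_uminus: "coeff (- a) n = - coeff a n"
  unfolding uminus_ell2_def by (subst Abs_ell2_inverse) (auto simp: coeff_sq_summable)

lemma coeff_diff: "coeff (a - b) n = coeff a n - coeff b n"
  unfolding minus_ell2_def
  by (subst Abs_ell2_inverse)
    (auto intro!: sq_summable_triangle(1)[OF coeff_sq_summable coeff_sq_summable] norm_triangle_ineq4)

lemma coeff_scaleR: "coeff (r *\<^sub>R a) n = r *\<^sub>R coeff a n"
  unfolding scaleR_ell2_def
  by (subst Abs_ell2_inverse)
    (auto simp: power_mult_distrib intro!: summable_on_cmult_right coeff_sq_summable)

instance
proof
  fix a b :: ell2 and r r' :: real
  show "(norm a = 0) = (a = 0)"
  proof
    assume "norm a = 0"
    then have "(\<Sum>\<^sub>\<infinity>n. (cmod (coeff a n))\<^sup>2) = 0" by (simp add: norm_ell2_def)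
    then have "(cmod (coeff a n))\<^sup>2 = 0" for n
      using nonneg_infsum_le_0D[OF _ coeff_sq_summable, of a n] by simp
    then show "a = 0" by (auto intro!: ell2_eqI simp: coeff_0)
  qed (simp add: norm_ell2_def coeff_0)
  show "norm (a + b) \<le> norm a + norm b"
    unfolding norm_ell2_def
    by (rule sq_summable_triangle(2)[OF coeff_sq_summable coeff_sq_summable])
      (auto simp: coeff_add norm_triangle_ineq)
  show "norm (r *\<^sub>R a) = \<bar>r\<bar> * norm a"
    by (simp add: norm_ell2_def coeff_scaleR power_mult_distrib infsum_cmult_right' real_sqrt_mult)
qed (auto intro!: ell2_eqI simp: coeff_0 coeff_add coeff_uminus coeff_diff coeff_scaleR 
      sgn_ell2_def dist_ell2_def uniformity_ell2_def open_ell2_def algebra_simps)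

end

lemmas coeff_simps [simp] = coeff_0 coeff_add coeff_uminus coeff_diff coeff_scaleR

lemma L2_set_coeff_le_norm: "finite F \<Longrightarrow> L2_set (\<lambda>n. cmod (coeff a n)) F \<le> norm a"
  unfolding norm_ell2_def by (rule L2_set_le_sqrt_infsum[OF coeff_sq_summable])

lemma cmod_coeff_le_norm: "cmod (coeff a n) \<le> norm a"
  using L2_set_coeff_le_norm[of "{n}" a] by simp

lemma norm_ell2_le:
  "(\<And>F. finite F \<Longrightarrow> L2_set (\<lambda>n. cmod (coeff a n)) F \<le> B) \<Longrightarrow> norm a \<le> B"
  unfolding norm_ell2_def by (rule sq_summable_if_L2_set_bounded(2))

lemma bounded_linear_coeff: "bounded_linear (\<lambda>a. coeff a n)"
  by (rule bounded_linear_intro[where K = 1]) (auto simp: cmod_coeff_le_norm)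

instance ell2 :: banach
proof
  fix X :: "nat \<Rightarrow> ell2" assume X: "Cauchy X"
  have "Cauchy (\<lambda>j. coeff (X j) n)" for n
    by (rule bounded_linear.Cauchy[OF bounded_linear_coeff X])
  then have "\<forall>n. \<exists>l. (\<lambda>j. coeff (X j) n) \<longlonglongrightarrow> l"
    by (metis Cauchy_convergent_iff convergent_def)
  then obtain l where l: "\<And>n. (\<lambda>j. coeff (X j) n) \<longlonglongrightarrow> l n" by metis
  have close: "\<exists>M. \<forall>j\<ge>M. \<forall>F. finite F \<longrightarrow> L2_set (\<lambda>n. cmod (coeff (X j) n - l n)) F \<le> e" 
    if e: "e > 0" for e
  proof -
    obtain M where M: "\<And>i j. i \<ge> M \<Longrightarrow> j \<ge> M \<Longrightarrow> norm (X i - X j) < e"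
      using CauchyD[OF X e] by blast
    have "L2_set (\<lambda>n. cmod (coeff (X j) n - l n)) F \<le> e" if j: "j \<ge> M" and F: "finite F" for j F
    proof (rule tendsto_upperbound)
      show "((\<lambda>i. L2_set (\<lambda>n. cmod (coeff (X j) n - coeff (X i) n)) F) 
          \<longlongrightarrow> L2_set (\<lambda>n. cmod (coeff (X j) n - l n)) F) sequentially"
        unfolding L2_set_def by (intro tendsto_intros l)
      show "\<forall>\<^sub>F i in sequentially. L2_set (\<lambda>n. cmod (coeff (X j) n - coeff (X i) n)) F \<le> e"
        using L2_set_coeff_le_norm[OF F, of "X j - X _"] M[OF j]
        by (intro eventually_sequentiallyI[of M]) (force intro: order.trans less_imp_le)
    qed simp
    then show ?thesis by blast
  qed
  obtain j where j: "\<And>F. finite F \<Longrightarrow> L2_set (\<lambda>n. cmod (coeff (X j) n - l n)) F \<le> 1"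
    using close[of 1] by (meson order_refl zero_less_one)
  have "(\<lambda>n. (cmod (l n))\<^sup>2) summable_on UNIV"
    by (rule sq_summable_triangle(1)[OF coeff_sq_summable[of "X j"] sq_summable_if_L2_set_bounded(1)[OF j]])
      (auto, metis norm_triangle_sub norm_minus_commute)
  then have cl: "coeff (Abs_ell2 l) = l" by (simp add: Abs_ell2_inverse)
  have "X \<longlonglongrightarrow> Abs_ell2 l"
  proof (rule LIMSEQ_I)
    fix r :: real assume r: "0 < r"
    obtain M where M: "\<forall>j\<ge>M. \<forall>F. finite F \<longrightarrow> L2_set (\<lambda>n. cmod (coeff (X j) n - l n)) F \<le> r / 2"
      using close[of "r / 2"] r by auto
    have "norm (X i - Abs_ell2 l) < r" if "i \<ge> M" for i
      using norm_ell2_le[of "X i - Abs_ell2 l" "r / 2"] M that r by (auto simp: cl)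
    then show "\<exists>M. \<forall>i\<ge>M. norm (X i - Abs_ell2 l) < r" by blast
  qed
  then show "convergent X" by (auto simp: convergent_def)
qed

section \<open>Sobolev spaces on the Fourier side\<close>

lemma sobolev_iff: "a \<in> sobolev s \<longleftrightarrow> (\<lambda>n. (jbracket n powr s * cmod (a n))\<^sup>2) summable_on UNIV"
  by (simp add: sobolev_def)

lemma sobolevI:
  assumes "\<And>F. finite F \<Longrightarrow> L2_set (\<lambda>n. jbracket n powr s * cmod (a n)) F \<le> B"
  shows "a \<in> sobolev s" "sobolev_norm s a \<le> B"
  using sq_summable_if_L2_set_bounded[of "\<lambda>n. jbracket n powr s * cmod (a n)" B] assms
  by (auto simp: sobolev_iff sobolev_norm_def)

lemma L2_set_le_sobolev_norm:
  "a \<in> sobolev s \<Longrightarrow> finite F \<Longrightarrow> L2_set (\<lambda>n. jbracket n powr s * cmod (a n)) F \<le> sobolev_norm s a"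
  unfolding sobolev_norm_def by (rule L2_set_le_sqrt_infsum) (simp add: sobolev_iff)

lemma sobolev_coeff_le: "a \<in> sobolev s \<Longrightarrow> jbracket n powr s * cmod (a n) \<le> sobolev_norm s a"
  using L2_set_le_sobolev_norm[of a s "{n}"] by simp

lemma sobolev_norm_nonneg [simp]: "0 \<le> sobolev_norm s a"
  by (simp add: sobolev_norm_def infsum_nonneg)

lemma sobolev_dominated:
  assumes a: "a \<in> sobolev r" and c: "0 \<le> c"
    and le: "\<And>n. jbracket n powr s * cmod (b n) \<le> c * (jbracket n powr r * cmod (a n))"
  shows "b \<in> sobolev s" "sobolev_norm s b \<le> c * sobolev_norm r a"
proof -
  have "L2_set (\<lambda>n. jbracket n powr s * cmod (b n)) F \<le> c * sobolev_norm r a" if F: "finite F" for F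
  proof -
    have "L2_set (\<lambda>n. jbracket n powr s * cmod (b n)) F
        \<le> L2_set (\<lambda>n. c * (jbracket n powr r * cmod (a n))) F"
      by (rule L2_set_mono) (auto simp: le)
    also have "\<dots> = c * L2_set (\<lambda>n. jbracket n powr r * cmod (a n)) F"
      by (rule L2_set_right_distrib[OF c, symmetric])
    also have "\<dots> \<le> c * sobolev_norm r a"
      by (intro mult_left_mono L2_set_le_sobolev_norm a F c)
    finally show ?thesis .
  qed
  then show "b \<in> sobolev s" "sobolev_norm s b \<le> c * sobolev_norm r a"
    using sobolevI[where a = b and s = s and B = "c * sobolev_norm r a"] by blast+
qed

lemma sobolev_mono:
  assumes "a \<in> sobolev r" "s \<le> r"
  shows "a \<in> sobolev s" "sobolev_norm s a \<le> sobolev_norm r a"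
proof -
  have "jbracket n powr s * cmod (a n) \<le> 1 * (jbracket n powr r * cmod (a n))" for n
    using assms(2) jbracket_ge_1[of n] by (simp add: mult_right_mono powr_mono)
  from sobolev_dominated[OF assms(1) _ this] show "a \<in> sobolev s" "sobolev_norm s a \<le> sobolev_norm r a"
    by simp_all
qed

text \<open>The isometries with \<open>ell2\<close>, through which sums and limits in \<open>sobolev s\<close> are formed.\<close>

definition emb :: "real \<Rightarrow> (int \<Rightarrow> complex) \<Rightarrow> ell2" where
  "emb s a = Abs_ell2 (\<lambda>n. of_real (jbracket n powr s) * a n)"

definition unemb :: "real \<Rightarrow> ell2 \<Rightarrow> int \<Rightarrow> complex" where
  "unemb s y = (\<lambda>n. of_real (jbracket n powr (- s)) * coeff y n)"

lemma coeff_emb: "a \<in> sobolev s \<Longrightarrow> coeff (emb s a) n = of_real (jbracket n powr s) * a n"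
  unfolding emb_def by (subst Abs_ell2_inverse) (auto simp: sobolev_iff norm_mult)

lemma norm_emb: "a \<in> sobolev s \<Longrightarrow> norm (emb s a) = sobolev_norm s a"
  by (simp add: norm_ell2_def sobolev_norm_def coeff_emb norm_mult)

lemma unemb_sobolev [simp]: "unemb s y \<in> sobolev s"
  using coeff_sq_summable[of y]
  by (simp add: unemb_def sobolev_iff norm_mult mult.assoc[symmetric] powr_add[symmetric])

lemma emb_unemb [simp]: "emb s (unemb s y) = y"
  by (rule ell2_eqI, subst coeff_emb)
    (simp_all add: mult.assoc[symmetric] powr_add[symmetric] flip: of_real_mult, 
      simp add: unemb_def mult.assoc[symmetric] powr_add[symmetric] flip: of_real_mult)

lemma unemb_emb: "a \<in> sobolev s \<Longrightarrow> unemb s (emb s a) = a"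
  by (rule ext) (simp add: coeff_emb unemb_def mult.assoc[symmetric] powr_add[symmetric]
      flip: of_real_mult)

lemma sobolev_norm_unemb [simp]: "sobolev_norm s (unemb s y) = norm y"
  using norm_emb[of "unemb s y" s] by simp

lemma unemb_add: "unemb s (x + y) n = unemb s x n + unemb s y n"
  and unemb_diff: "unemb s (x - y) n = unemb s x n - unemb s y n"
  and unemb_scaleR: "unemb s (r *\<^sub>R x) n = of_real r * unemb s x n"
  and unemb_0: "unemb s 0 n = 0"
  by (simp_all add: unemb_def algebra_simps scaleR_conv_of_real)

lemma sobolev_add:
  assumes "a \<in> sobolev s" "b \<in> sobolev s"
  shows "(\<lambda>n. a n + b n) \<in> sobolev s"
    and "emb s (\<lambda>n. a n + b n) = emb s a + emb s b"
    and "sobolev_norm s (\<lambda>n. a n + b n) \<le> sobolev_norm s a + sobolev_norm s b"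
proof -
  have eq: "(\<lambda>n. a n + b n) = unemb s (emb s a + emb s b)"
    using assms by (auto simp: unemb_add unemb_emb)
  then show "(\<lambda>n. a n + b n) \<in> sobolev s" "emb s (\<lambda>n. a n + b n) = emb s a + emb s b"
    by simp_all
  show "sobolev_norm s (\<lambda>n. a n + b n) \<le> sobolev_norm s a + sobolev_norm s b"
    unfolding eq using norm_triangle_ineq[of "emb s a" "emb s b"] assms by (simp add: norm_emb)
qed

lemma sobolev_diff:
  assumes "a \<in> sobolev s" "b \<in> sobolev s"
  shows "(\<lambda>n. a n - b n) \<in> sobolev s"
    and "emb s (\<lambda>n. a n - b n) = emb s a - emb s b"
    and "sobolev_norm s (\<lambda>n. a n - b n) \<le> sobolev_norm s a + sobolev_norm s b"
proof -
  have eq: "(\<lambda>n. a n - b n) = unemb s (emb s a - emb s b)"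
    using assms by (auto simp: unemb_diff unemb_emb)
  then show "(\<lambda>n. a n - b n) \<in> sobolev s" "emb s (\<lambda>n. a n - b n) = emb s a - emb s b"
    by simp_all
  show "sobolev_norm s (\<lambda>n. a n - b n) \<le> sobolev_norm s a + sobolev_norm s b"
    unfolding eq using norm_triangle_ineq4[of "emb s a" "emb s b"] assms by (simp add: norm_emb)
qed

lemma sobolev_cmult:
  assumes "a \<in> sobolev s"
  shows "(\<lambda>n. c * a n) \<in> sobolev s"
    and "sobolev_norm s (\<lambda>n. c * a n) \<le> cmod c * sobolev_norm s a"
  by (rule sobolev_dominated[OF assms, of "cmod c"], simp_all add: norm_mult)+

lemma norm_cis_diff_le: "cmod (exp (\<i> * of_real x) - exp (\<i> * of_real y)) \<le> \<bar>x - y\<bar>"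
proof -
  have "exp (\<i> * of_real x) - exp (\<i> * of_real y) = exp (\<i> * of_real y) * (exp (\<i> * of_real (x - y)) - 1)"
    by (simp add: algebra_simps flip: exp_add)
  then have "cmod (exp (\<i> * of_real x) - exp (\<i> * of_real y)) = 2 * \<bar>sin ((x - y) / 2)\<bar>"
    using dist_exp_i_1[of "x - y"] by (simp add: norm_mult)
  also have "\<dots> \<le> \<bar>x - y\<bar>"
    using abs_sin_x_le_abs_x[of "(x - y) / 2"] by simp
  finally show ?thesis .
qed

text \<open>The symbol \<open>phi\<close> is bounded, so the free evolution is Lipschitz in time without any loss
  of regularity.\<close>

lemma S_prop_sobolev:
  assumes "a \<in> sobolev s"
  shows "S_prop t a \<in> sobolev s" and "sobolev_norm s (S_prop t a) \<le> sobolev_norm s a"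
    and "sobolev_norm s (\<lambda>n. S_prop t a n - S_prop t' a n) \<le> \<bar>t - t'\<bar> * sobolev_norm s a"
proof -
  have c: "cmod (S_prop t a n) = cmod (a n)" for n
    using norm_exp_i_times[of "- (t * phi n)"]
    by (simp add: S_prop_def norm_mult mult.assoc)
  show "S_prop t a \<in> sobolev s" "sobolev_norm s (S_prop t a) \<le> sobolev_norm s a"
    using sobolev_dominated[OF assms, of 1 s "S_prop t a"] by (simp_all add: c)
  have "cmod (S_prop t a n - S_prop t' a n) \<le> \<bar>t - t'\<bar> * cmod (a n)" for n
  proof -
    have "cmod (exp (\<i> * of_real (- (t * phi n))) - exp (\<i> * of_real (- (t' * phi n))))
        \<le> \<bar>- (t * phi n) - - (t' * phi n)\<bar>"
      by (rule norm_cis_diff_le)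
    also have "\<dots> = \<bar>t - t'\<bar> * \<bar>phi n\<bar>"
      by (simp flip: abs_mult add: algebra_simps abs_minus_commute)
    also have "\<dots> \<le> \<bar>t - t'\<bar> * 1"
      by (intro mult_left_mono abs_phi_le_1) auto
    finally show ?thesis
      by (simp add: S_prop_def norm_mult mult.assoc mult_right_mono flip: left_diff_distrib)
  qed
  then show "sobolev_norm s (\<lambda>n. S_prop t a n - S_prop t' a n) \<le> \<bar>t - t'\<bar> * sobolev_norm s a"
    by (intro sobolev_dominated(2)[OF assms])
      (auto simp: mult_left_mono mult.left_commute)
qed

lemma C_sobolev_iff:
  "v \<in> C_sobolev r \<longleftrightarrow> (\<forall>t. v t \<in> sobolev r) \<and> continuous_on UNIV (\<lambda>t. emb r (v t))"
proof -
  have "((\<lambda>t'. sobolev_norm r (\<lambda>n. v t' n - v t n)) \<longlongrightarrow> 0) (at t)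
      \<longleftrightarrow> ((\<lambda>t'. emb r (v t')) \<longlongrightarrow> emb r (v t)) (at t)" if "\<forall>t. v t \<in> sobolev r" for t
  proof -
    have "sobolev_norm r (\<lambda>n. v t' n - v t n) = norm (emb r (v t') - emb r (v t))" for t'
      using norm_emb[OF sobolev_diff(1), of "v t'" r "v t"] sobolev_diff(2)[of "v t'" r "v t"] that by simp
    then show ?thesis by (simp add: LIM_zero_iff tendsto_norm_zero_iff)
  qed
  then show ?thesis by (auto simp: C_sobolev_def continuous_on_def)
qed

section \<open>Products\<close>

lemma bij_minus_int: "bij_betw (\<lambda>k. n - k) UNIV (UNIV :: int set)"
  by (rule bij_betwI[where g = "\<lambda>k. n - k"]) auto

lemma summable_on_int_reflect:
  fixes f :: "int \<Rightarrow> 'b :: {comm_monoid_add, topological_space}"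
  shows "(\<lambda>k. f (n - k)) summable_on UNIV \<longleftrightarrow> f summable_on UNIV"
  using summable_on_reindex_bij_betw[OF bij_minus_int[of n], of f] .

lemma infsum_int_reflect:
  fixes f :: "int \<Rightarrow> 'b :: {comm_monoid_add, t2_space}"
  shows "(\<Sum>\<^sub>\<infinity>k. f (n - k)) = (\<Sum>\<^sub>\<infinity>k. f k)"
  using infsum_reindex_bij_betw[OF bij_minus_int[of n], of f] .

lemma fprod_commute: "fprod a b = fprod b a"
proof
  fix n
  show "fprod a b n = fprod b a n"
    unfolding fprod_def
    using infsum_int_reflect[of "\<lambda>k. a k * b (n - k)" n] by (simp add: mult.commute)
qed

text \<open>Young's inequality for the convolution of a square summable with a summable sequence. Peetre's
  inequality moves the negative weight from the output frequency to the two factors; the convolution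
  is then a superposition of translates of the first factor, which all have the same norm.\<close>

lemma young_weighted:
  assumes s: "0 \<le> r" and a: "a \<in> sobolev (- r)"
    and b: "(\<lambda>k. jbracket k powr r * cmod (b k)) summable_on UNIV"
  shows "(\<lambda>k. cmod (a k * b (n - k))) summable_on UNIV"
    and "fprod a b \<in> sobolev (- r)"
    and "sobolev_norm (- r) (fprod a b)
       \<le> 2 powr r * sobolev_norm (- r) a * (\<Sum>\<^sub>\<infinity>k. jbracket k powr r * cmod (b k))"
proof -
  define \<alpha> where "\<alpha> k = jbracket k powr (- r) * cmod (a k)" for k
  define \<beta> where "\<beta> k = jbracket k powr r * cmod (b k)" for k
  have \<beta>0: "0 \<le> \<beta> k" and \<alpha>0: "0 \<le> \<alpha> k" for k by (auto simp: \<beta>_def \<alpha>_def)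
  have \<alpha>A: "\<alpha> k \<le> sobolev_norm (- r) a" for k
    unfolding \<alpha>_def by (rule sobolev_coeff_le[OF a])
  have \<beta>s: "\<beta> summable_on UNIV" using b unfolding \<beta>_def .
  have w: "jbracket n powr (- r) * cmod (a k * b (n - k)) \<le> 2 powr r * (\<alpha> k * \<beta> (n - k))" for n k
  proof -
    have "jbracket k \<le> 2 * (jbracket n * jbracket (n - k))"
      using jbracket_peetre[of k n] jbracket_minus[of "n - k"] by simp
    then have "jbracket k powr r \<le> (2 * (jbracket n * jbracket (n - k))) powr r"
      using s by (intro powr_mono2) (auto simp: less_imp_le)
    also have "\<dots> = 2 powr r * (jbracket n powr r * jbracket (n - k) powr r)"
      by (simp add: powr_mult)
    finally have "jbracket n powr (- r) * jbracket k powr r * jbracket k powr (- r)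
       \<le> jbracket n powr (- r) * (2 powr r * (jbracket n powr r * jbracket (n - k) powr r)) * jbracket k powr (- r)"
      by (intro mult_right_mono mult_left_mono) auto
    then have "jbracket n powr (- r) \<le> 2 powr r * (jbracket k powr (- r) * jbracket (n - k) powr r)"
      by (simp add: powr_minus field_simps)
    then have "jbracket n powr (- r) * (cmod (a k) * cmod (b (n - k)))
        \<le> 2 powr r * (jbracket k powr (- r) * jbracket (n - k) powr r) * (cmod (a k) * cmod (b (n - k)))"
      by (rule mult_right_mono) auto
    then show ?thesis by (simp add: \<alpha>_def \<beta>_def norm_mult mult_ac)
  qed
  have sum1: "(\<lambda>k. \<alpha> k * \<beta> (n - k)) summable_on UNIV" for n
  proof (rule summable_on_comparison_test)
    show "(\<lambda>k. sobolev_norm (- r) a * \<beta> (n - k)) summable_on UNIV"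
      by (intro summable_on_cmult_right) (simp add: summable_on_int_reflect \<beta>s)
  qed (use \<alpha>A \<beta>0 \<alpha>0 in \<open>auto intro!: mult_right_mono\<close>)
  show abs: "(\<lambda>k. cmod (a k * b (n - k))) summable_on UNIV" for n
  proof (rule summable_on_comparison_test)
    show "(\<lambda>k. jbracket n powr r * (2 powr r * (\<alpha> k * \<beta> (n - k)))) summable_on UNIV"
      by (intro summable_on_cmult_right sum1)
    fix k
    have "jbracket n powr r * (jbracket n powr (- r) * cmod (a k * b (n - k)))
        \<le> jbracket n powr r * (2 powr r * (\<alpha> k * \<beta> (n - k)))"
      by (intro mult_left_mono w) auto
    then show "cmod (a k * b (n - k)) \<le> jbracket n powr r * (2 powr r * (\<alpha> k * \<beta> (n - k)))"
      by (simp add: mult.assoc[symmetric] powr_add[symmetric])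
  qed auto
  have pt: "jbracket n powr (- r) * cmod (fprod a b n) \<le> 2 powr r * (\<Sum>\<^sub>\<infinity>k. \<alpha> (n - k) * \<beta> k)" for n
  proof -
    have "jbracket n powr (- r) * cmod (fprod a b n)
        \<le> jbracket n powr (- r) * (\<Sum>\<^sub>\<infinity>k. cmod (a k * b (n - k)))"
      unfolding fprod_def by (intro mult_left_mono norm_infsum_bound abs) auto
    also have "\<dots> = (\<Sum>\<^sub>\<infinity>k. jbracket n powr (- r) * cmod (a k * b (n - k)))"
      by (simp add: infsum_cmult_right')
    also have "\<dots> \<le> (\<Sum>\<^sub>\<infinity>k. 2 powr r * (\<alpha> k * \<beta> (n - k)))"
      by (intro infsum_mono summable_on_cmult_right abs sum1 w)
    also have "\<dots> = 2 powr r * (\<Sum>\<^sub>\<infinity>k. \<alpha> (n - k) * \<beta> k)"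
      using infsum_int_reflect[of "\<lambda>k. \<alpha> k * \<beta> (n - k)" n] by (simp add: infsum_cmult_right')
    finally show ?thesis .
  qed
  have mink: "L2_set (\<lambda>n. \<Sum>k\<in>K. \<alpha> (n - k) * \<beta> k) F \<le> sobolev_norm (- r) a * (\<Sum>k\<in>K. \<beta> k)"
    if K: "finite K" and F: "finite F" for K F
    using K
  proof induction
    case empty
    show ?case by (simp add: L2_set_def)
  next
    case (insert j K)
    have "L2_set (\<lambda>n. \<alpha> (n - j) * \<beta> j) F = L2_set (\<lambda>n. \<alpha> (n - j)) F * \<beta> j"
      by (rule L2_set_left_distrib[OF \<beta>0, symmetric])
    also have "L2_set (\<lambda>n. \<alpha> (n - j)) F = L2_set \<alpha> ((\<lambda>n. n - j) ` F)"
      unfolding L2_set_def by (subst sum.reindex) (auto simp: inj_on_def)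
    also have "\<dots> \<le> sobolev_norm (- r) a"
      unfolding \<alpha>_def by (intro L2_set_le_sobolev_norm a) (simp add: F)
    finally have 1: "L2_set (\<lambda>n. \<alpha> (n - j) * \<beta> j) F \<le> sobolev_norm (- r) a * \<beta> j"
      using \<beta>0 by (simp add: mult_right_mono)
    have "L2_set (\<lambda>n. \<Sum>k\<in>insert j K. \<alpha> (n - k) * \<beta> k) F
       = L2_set (\<lambda>n. \<alpha> (n - j) * \<beta> j + (\<Sum>k\<in>K. \<alpha> (n - k) * \<beta> k)) F"
      using insert by simp
    also have "\<dots> \<le> L2_set (\<lambda>n. \<alpha> (n - j) * \<beta> j) F + L2_set (\<lambda>n. \<Sum>k\<in>K. \<alpha> (n - k) * \<beta> k) F"
      by (rule L2_set_triangle_ineq)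
    also have "\<dots> \<le> sobolev_norm (- r) a * \<beta> j + sobolev_norm (- r) a * (\<Sum>k\<in>K. \<beta> k)"
      by (intro add_mono 1 insert.IH)
    finally show ?case using insert by (simp add: algebra_simps)
  qed
  have sum2: "(\<lambda>k. \<alpha> (n - k) * \<beta> k) summable_on UNIV" for n
    using sum1[of n] summable_on_int_reflect[of "\<lambda>k. \<alpha> k * \<beta> (n - k)" n] by simp
  have B: "L2_set (\<lambda>n. jbracket n powr (- r) * cmod (fprod a b n)) F
     \<le> 2 powr r * sobolev_norm (- r) a * infsum \<beta> UNIV" if F: "finite F" for F
  proof -
    have "L2_set (\<lambda>n. jbracket n powr (- r) * cmod (fprod a b n)) F
        \<le> L2_set (\<lambda>n. 2 powr r * (\<Sum>\<^sub>\<infinity>k. \<alpha> (n - k) * \<beta> k)) F"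
      by (rule L2_set_mono) (auto simp: pt)
    also have "\<dots> = 2 powr r * L2_set (\<lambda>n. \<Sum>\<^sub>\<infinity>k. \<alpha> (n - k) * \<beta> k) F"
      by (rule L2_set_right_distrib[symmetric]) simp
    also have "L2_set (\<lambda>n. \<Sum>\<^sub>\<infinity>k. \<alpha> (n - k) * \<beta> k) F \<le> sobolev_norm (- r) a * infsum \<beta> UNIV"
    proof (rule tendsto_upperbound)
      show "((\<lambda>K. L2_set (\<lambda>n. \<Sum>k\<in>K. \<alpha> (n - k) * \<beta> k) F)
          \<longlongrightarrow> L2_set (\<lambda>n. \<Sum>\<^sub>\<infinity>k. \<alpha> (n - k) * \<beta> k) F) (finite_subsets_at_top UNIV)"
        unfolding L2_set_def
        using has_sum_infsum[OF sum2] unfolding has_sum_def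
        by (intro tendsto_intros) auto
      show "\<forall>\<^sub>F K in finite_subsets_at_top UNIV. 
          L2_set (\<lambda>n. \<Sum>k\<in>K. \<alpha> (n - k) * \<beta> k) F \<le> sobolev_norm (- r) a * infsum \<beta> UNIV"
      proof (rule eventually_finite_subsets_at_top_weakI)
        fix K :: "int set" assume K: "finite K"
        have "sum \<beta> K \<le> infsum \<beta> UNIV"
          by (rule finite_sum_le_infsum[OF \<beta>s K]) (auto simp: \<beta>0)
        then show "L2_set (\<lambda>n. \<Sum>k\<in>K. \<alpha> (n - k) * \<beta> k) F \<le> sobolev_norm (- r) a * infsum \<beta> UNIV"
          using mink[OF K F] by (meson mult_left_mono order.trans sobolev_norm_nonneg)
      qed
    qed simp
    finally show ?thesis by (simp add: mult.assoc)
  qed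
  show "fprod a b \<in> sobolev (- r)"
    and "sobolev_norm (- r) (fprod a b)
       \<le> 2 powr r * sobolev_norm (- r) a * (\<Sum>\<^sub>\<infinity>k. jbracket k powr r * cmod (b k))"
    using sobolevI[OF B] unfolding \<beta>_def by blast+
qed

text \<open>Cauchy-Schwarz: above regularity 1/2 the Fourier coefficients are summable.\<close>

lemma sobolev_weighted_sum:
  assumes b: "b \<in> sobolev s" and rs: "s - r > 1 / 2"
  shows "(\<lambda>k. jbracket k powr r * cmod (b k)) summable_on UNIV"
    and "(\<Sum>\<^sub>\<infinity>k. jbracket k powr r * cmod (b k))
       \<le> sqrt (\<Sum>\<^sub>\<infinity>k. (jbracket k powr (r - s))\<^sup>2) * sobolev_norm s b"
proof -
  let ?W = "sqrt (\<Sum>\<^sub>\<infinity>k. (jbracket k powr (r - s))\<^sup>2)"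
  have W: "(\<lambda>k. (jbracket k powr (r - s))\<^sup>2) summable_on UNIV"
    using summable_jbracket_powr[of "2 * (s - r)"] rs
    by (simp add: power2_eq_square powr_add[symmetric] algebra_simps)
  have le: "(\<Sum>k\<in>F. jbracket k powr r * cmod (b k)) \<le> ?W * sobolev_norm s b" if F: "finite F" for F
  proof -
    have "(\<Sum>k\<in>F. jbracket k powr r * cmod (b k))
        = (\<Sum>k\<in>F. \<bar>jbracket k powr (r - s)\<bar> * \<bar>jbracket k powr s * cmod (b k)\<bar>)"
      by (rule sum.cong) (auto simp: abs_mult mult.assoc[symmetric] powr_add[symmetric])
    also have "\<dots> \<le> L2_set (\<lambda>k. jbracket k powr (r - s)) F * L2_set (\<lambda>k. jbracket k powr s * cmod (b k)) F"
      by (rule L2_set_mult_ineq)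
    also have "\<dots> \<le> ?W * sobolev_norm s b"
      by (intro mult_mono L2_set_le_sqrt_infsum W L2_set_le_sobolev_norm b F)
        (auto simp: infsum_nonneg)
    finally show ?thesis .
  qed
  show 1: "(\<lambda>k. jbracket k powr r * cmod (b k)) summable_on UNIV"
    by (rule nonneg_bdd_above_summable_on) (auto intro!: bdd_aboveI2 le)
  show "(\<Sum>\<^sub>\<infinity>k. jbracket k powr r * cmod (b k)) \<le> ?W * sobolev_norm s b"
    by (rule infsum_le_finite_sums[OF 1]) (simp add: le)
qed

definition prod_const :: "real \<Rightarrow> real \<Rightarrow> real" where
  "prod_const r s = 2 powr r * sqrt (\<Sum>\<^sub>\<infinity>k. (jbracket k powr (r - s))\<^sup>2)"

lemma prod_const_nonneg [simp]: "0 \<le> prod_const r s"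
  by (simp add: prod_const_def infsum_nonneg)

text \<open>The only product estimate of the whole argument. Rough data can be multiplied by a remainder of
  regularity above \<open>r + 1 / 2\<close>, and the product is no worse than the data.\<close>

lemma fprod_sobolev:
  assumes r: "0 \<le> r" and rs: "s - r > 1 / 2" and a: "a \<in> sobolev (- r)" and b: "b \<in> sobolev s"
  shows "(\<lambda>k. cmod (a k * b (n - k))) summable_on UNIV"
    and "fprod a b \<in> sobolev (- r)"
    and "sobolev_norm (- r) (fprod a b) \<le> prod_const r s * sobolev_norm (- r) a * sobolev_norm s b"
proof -
  note w = sobolev_weighted_sum[OF b rs]
  show "(\<lambda>k. cmod (a k * b (n - k))) summable_on UNIV" "fprod a b \<in> sobolev (- r)"
    using young_weighted[OF r a w(1)] by blast+
  have "sobolev_norm (- r) (fprod a b)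
       \<le> 2 powr r * sobolev_norm (- r) a * (\<Sum>\<^sub>\<infinity>k. jbracket k powr r * cmod (b k))"
    by (rule young_weighted[OF r a w(1)])
  also have "\<dots> \<le> 2 powr r * sobolev_norm (- r) a * 
     (sqrt (\<Sum>\<^sub>\<infinity>k. (jbracket k powr (r - s))\<^sup>2) * sobolev_norm s b)"
    by (intro mult_left_mono w(2)) auto
  finally show "sobolev_norm (- r) (fprod a b) \<le> prod_const r s * sobolev_norm (- r) a * sobolev_norm s b"
    by (simp add: prod_const_def mult_ac)
qed

lemma fprod_cmult: "fprod (\<lambda>n. c * a n) b n = c * fprod a b n" "fprod a (\<lambda>n. c * b n) n = c * fprod a b n"
  by (simp_all add: fprod_def infsum_cmult_right' mult.assoc mult.left_commute flip: infsum_cmult_right')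

lemma fprod_diff:
  assumes "\<And>n. (\<lambda>k. cmod (a k * b (n - k))) summable_on UNIV" "\<And>n. (\<lambda>k. cmod (a' k * b (n - k))) summable_on UNIV"
  shows "fprod (\<lambda>n. a n - a' n) b n = fprod a b n - fprod a' b n"
proof -
  have s: "(\<lambda>k. a k * b (n - k)) summable_on UNIV" "(\<lambda>k. a' k * b (n - k)) summable_on UNIV"
    by (rule Infinite_Sum.abs_summable_summable, rule assms)+
  show "fprod (\<lambda>n. a n - a' n) b n = fprod a b n - fprod a' b n"
    using infsum_add[OF s(1) summable_on_uminus[THEN iffD2, OF s(2)]] 
    by (simp add: fprod_def left_diff_distrib infsum_uminus)
qed

section \<open>Differential equations in Banach spaces\<close>

lemma has_vector_derivative_reflect:
  assumes "(f has_vector_derivative d) (at (- t))"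
  shows "((\<lambda>t. f (- t)) has_vector_derivative - d) (at (t :: real))"
proof -
  have "((\<lambda>t. f (- t)) has_vector_derivative (- 1) *\<^sub>R d) (at t)"
    by (rule vector_diff_chain_at[unfolded o_def, of "\<lambda>t. - t" "-1" t f])
      (auto intro!: derivative_eq_intros assms)
  then show ?thesis by simp
qed

lemma antiderivative_exists:
  fixes f :: "real \<Rightarrow> 'b :: banach"
  assumes f: "continuous_on UNIV f"
  shows "\<exists>F. F 0 = 0 \<and> (\<forall>t. (F has_vector_derivative f t) (at t))"
proof (rule exI[of _ "\<lambda>t. integral {0..t} f - integral {t..0} f"], intro conjI allI)
  let ?F = "\<lambda>t. integral {0..t} f - integral {t..0} f"
  show "?F 0 = 0" by simp
  fix t :: real
  define a b where "a = min 0 t - 1" and "b = max 0 t + 1"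
  have ab: "a < t" "t < b" "a < 0" "0 < b" by (auto simp: a_def b_def)
  have fab: "continuous_on {a..b} f" using f by (rule continuous_on_subset) simp
  have int: "f integrable_on {c..d}" for c d
    by (rule integrable_continuous_interval) (use f continuous_on_subset in blast)
  have "((\<lambda>u. integral {a..u} f) has_vector_derivative f t) (at t within {a..b})"
    by (rule integral_has_vector_derivative[OF fab]) (use ab in auto)
  then have "((\<lambda>u. integral {a..u} f) has_vector_derivative f t) (at t)"
    using ab by (simp add: at_within_Icc_at)
  then have d: "((\<lambda>u. integral {a..u} f - integral {a..0} f) has_vector_derivative f t) (at t)"
    by (auto intro!: derivative_eq_intros)
  show "(?F has_vector_derivative f t) (at t)"
  proof (rule has_vector_derivative_transform_within_open[OF d, where S = "{a<..<b}"])
    fix u assume u: "u \<in> {a<..<b}"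
    show "integral {a..u} f - integral {a..0} f = ?F u"
    proof (cases "0 \<le> u")
      case True
      have "integral {a..0} f + integral {0..u} f = integral {a..u} f"
        using True ab u int by (intro Henstock_Kurzweil_Integration.integral_combine) auto
      then show ?thesis using True by (cases "u = 0") (auto simp: algebra_simps)
    next
      case False
      have "integral {a..u} f + integral {u..0} f = integral {a..0} f"
        using False ab u int by (intro Henstock_Kurzweil_Integration.integral_combine) auto
      then show ?thesis using False by (auto simp: algebra_simps)
    qed
  qed (use ab in auto)
qed

lemma norm_le_exp_if_derivative:
  fixes F :: "real \<Rightarrow> 'b :: real_normed_vector"
  assumes F: "\<And>t. (F has_vector_derivative f t) (at t)" and F0: "F 0 = 0"
    and l: "l > 0" and B: "\<And>t. norm (f t) \<le> B * exp (l * \<bar>t\<bar>)"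
  shows "norm (F t) \<le> B / l * exp (l * \<bar>t\<bar>)"
proof -
  have B0: "0 \<le> B" using B[of 0] norm_ge_zero[of "f 0"] by (simp del: norm_ge_zero)
  have pos: "norm (G t) \<le> B / l * exp (l * t)"
    if G: "\<And>t. (G has_vector_derivative g t) (at t)" and G0: "G 0 = 0" and t: "0 \<le> t"
      and Bg: "\<And>t. norm (g t) \<le> B * exp (l * \<bar>t\<bar>)"
    for G :: "real \<Rightarrow> 'b" and g t
  proof (cases "t = 0")
    case True
    then show ?thesis using B0 l G0 by simp
  next
    case False
    have "norm (G t - G 0) \<le> B / l * exp (l * t) - B / l * exp (l * 0)"
    proof (rule differentiable_bound_general)
      show "0 < t" using False t by simp
      show "continuous_on {0..t} G"
        using G has_vector_derivative_continuous by (blast intro: continuous_at_imp_continuous_on)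
      show "continuous_on {0..t} (\<lambda>t. B / l * exp (l * t))" by (intro continuous_intros)
      show "(G has_vector_derivative g x) (at x)" for x by (rule G)
      show "((\<lambda>t. B / l * exp (l * t)) has_vector_derivative B * exp (l * x)) (at x)" for x
        using l by (auto intro!: derivative_eq_intros simp flip: has_real_derivative_iff_has_vector_derivative)
      show "norm (g x) \<le> B * exp (l * x)" if "0 < x" for x using Bg[of x] that by simp
    qed
    moreover have "0 \<le> B / l" using B0 l by simp
    ultimately show ?thesis by (simp add: G0)
  qed
  show ?thesis
  proof (cases "0 \<le> t")
    case True
    then show ?thesis using pos[OF F F0 True B] by simp
  next
    case False
    have "norm (- F (- (- t))) \<le> B / l * exp (l * (- t))"
    proof (rule pos[of "\<lambda>t. - F (- t)" "\<lambda>t. f (- t)"])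
      show "((\<lambda>t. - F (- t)) has_vector_derivative f (- x)) (at x)" for x
        using has_vector_derivative_minus[OF has_vector_derivative_reflect[OF F[of "- x"]]] by simp
      show "norm (f (- x)) \<le> B * exp (l * \<bar>x\<bar>)" for x using B[of "- x"] by simp
    qed (use F0 False in auto)
    then show ?thesis using False by simp
  qed
qed

text \<open>The Picard map is a contraction of the space of functions that grow at most like
  \<open>exp (l * \<bar>t\<bar>)\<close>, for \<open>l\<close> larger than the Lipschitz constant. This gives the solution on
  the whole line in one step.\<close>

lemma ode_exists:
  fixes G :: "real \<Rightarrow> 'b \<Rightarrow> 'b :: banach"
  assumes L: "\<And>t t' x x'. norm (G t x - G t' x') \<le> L * (\<bar>t - t'\<bar> + norm (x - x'))"
  shows "\<exists>y. y 0 = 0 \<and> (\<forall>t. (y has_vector_derivative G t (y t)) (at t))"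
proof -
  have L0: "0 \<le> L" using L[of 1 0 0 0] norm_ge_zero[of "G 1 0 - G 0 0"] by (simp del: norm_ge_zero)
  define l where "l = 2 * L + 1"
  have l: "l \<ge> 1" "l > 0" "l \<noteq> 0" using L0 by (auto simp: l_def)
  define f where "f u s = G s (exp (l * \<bar>s\<bar>) *\<^sub>R apply_bcontfun u s)" for u :: "real \<Rightarrow>\<^sub>C 'b" and s
  have Gcont: "continuous_on UNIV (\<lambda>s. G s (x s))" if x: "continuous_on UNIV x" for x
  proof -
    have "((\<lambda>s. G s (x s)) \<longlongrightarrow> G t (x t)) (at t)" for t
    proof (rule LIM_zero_cancel, rule Lim_null_comparison)
      show "\<forall>\<^sub>F s in at t. norm (G s (x s) - G t (x t)) \<le> L * (\<bar>s - t\<bar> + norm (x s - x t))"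
        using L by simp
      have "(x \<longlongrightarrow> x t) (at t)" using x by (simp add: continuous_on_def)
      then have "((\<lambda>s. L * (\<bar>s - t\<bar> + norm (x s - x t))) \<longlongrightarrow> L * (\<bar>t - t\<bar> + norm (x t - x t))) (at t)"
        by (intro tendsto_intros)
      then show "((\<lambda>s. L * (\<bar>s - t\<bar> + norm (x s - x t))) \<longlongrightarrow> 0) (at t)" by simp
    qed
    then show ?thesis by (simp add: continuous_on_def)
  qed
  have fcont: "continuous_on UNIV (f u)" for u
    unfolding f_def by (intro Gcont continuous_intros) auto
  define F where "F u = (SOME F. F 0 = 0 \<and> (\<forall>t. (F has_vector_derivative f u t) (at t)))" for u
  have F: "F u 0 = 0" "(F u has_vector_derivative f u t) (at t)" for u t
    using someI_ex[OF antiderivative_exists[OF fcont[of u]]] unfolding F_def by auto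
  have fbound: "norm (f u s) \<le> (norm (G 0 0) + L + L * norm u) * exp (l * \<bar>s\<bar>)" for u s
  proof -
    have "norm (f u s) \<le> norm (G 0 0) + norm (f u s - G 0 0)"
      by (metis add.commute norm_triangle_sub)
    also have "norm (f u s - G 0 0) \<le> L * (\<bar>s\<bar> + norm (exp (l * \<bar>s\<bar>) *\<^sub>R apply_bcontfun u s))"
      unfolding f_def using L[of s "exp (l * \<bar>s\<bar>) *\<^sub>R apply_bcontfun u s" 0 0] by simp
    also have "\<dots> \<le> L * (exp (l * \<bar>s\<bar>) + exp (l * \<bar>s\<bar>) * norm u)"
    proof (intro mult_left_mono add_mono L0)
      have "\<bar>s\<bar> \<le> l * \<bar>s\<bar>" using mult_right_mono[OF l(1), of "\<bar>s\<bar>"] by simp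
      also have "\<dots> \<le> exp (l * \<bar>s\<bar>)" using exp_ge_add_one_self[of "l * \<bar>s\<bar>"] by linarith
      finally show "\<bar>s\<bar> \<le> exp (l * \<bar>s\<bar>)" .
      show "norm (exp (l * \<bar>s\<bar>) *\<^sub>R apply_bcontfun u s) \<le> exp (l * \<bar>s\<bar>) * norm u"
        by (simp add: norm_bounded)
    qed
    finally have "norm (f u s) \<le> norm (G 0 0) * 1 + L * (exp (l * \<bar>s\<bar>) + exp (l * \<bar>s\<bar>) * norm u)"
      by simp
    also have "norm (G 0 0) * 1 \<le> norm (G 0 0) * exp (l * \<bar>s\<bar>)"
      using l by (intro mult_left_mono) auto
    finally show ?thesis by (simp add: algebra_simps)
  qed
  define T where "T u = Bcontfun (\<lambda>t. exp (- (l * \<bar>t\<bar>)) *\<^sub>R F u t)" for u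
  have T: "apply_bcontfun (T u) t = exp (- (l * \<bar>t\<bar>)) *\<^sub>R F u t" for u t
  proof -
    have "continuous_on UNIV (F u)"
      using F(2) has_vector_derivative_continuous by (blast intro: continuous_at_imp_continuous_on)
    then have "continuous_on UNIV (\<lambda>t. exp (- (l * \<bar>t\<bar>)) *\<^sub>R F u t)"
      by (intro continuous_intros)
    moreover have "norm (exp (- (l * \<bar>t\<bar>)) *\<^sub>R F u t) \<le> (norm (G 0 0) + L + L * norm u) / l" for t
    proof -
      have "norm (F u t) \<le> (norm (G 0 0) + L + L * norm u) / l * exp (l * \<bar>t\<bar>)"
        by (rule norm_le_exp_if_derivative[OF F(2) F(1) l(2) fbound])
      then have "exp (- (l * \<bar>t\<bar>)) * norm (F u t) 
          \<le> exp (- (l * \<bar>t\<bar>)) * ((norm (G 0 0) + L + L * norm u) / l * exp (l * \<bar>t\<bar>))"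
        by (intro mult_left_mono) auto
      then show ?thesis by (simp add: mult.left_commute[of "exp (- (l * \<bar>t\<bar>))"] flip: exp_add)
    qed
    ultimately have "(\<lambda>t. exp (- (l * \<bar>t\<bar>)) *\<^sub>R F u t) \<in> bcontfun"
      by (auto simp: bcontfun_def intro!: boundedI)
    then show ?thesis unfolding T_def by (simp add: Bcontfun_inverse)
  qed
  have contr: "dist (T u) (T w) \<le> 1 / 2 * dist u w" for u w
  proof (rule dist_bound)
    fix t
    have "norm (F u t - F w t) \<le> (L * dist u w) / l * exp (l * \<bar>t\<bar>)"
    proof (rule norm_le_exp_if_derivative[where f = "\<lambda>t. f u t - f w t"])
      show "((\<lambda>t. F u t - F w t) has_vector_derivative f u s - f w s) (at s)" for s
        by (intro has_vector_derivative_diff F)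
      fix s
      have "norm (f u s - f w s) \<le> L * norm (exp (l * \<bar>s\<bar>) *\<^sub>R (apply_bcontfun u s - apply_bcontfun w s))"
        unfolding f_def using L[of s _ s _] by (simp add: scaleR_diff_right)
      also have "\<dots> \<le> L * (exp (l * \<bar>s\<bar>) * dist u w)"
        using dist_bounded[of u s w] by (intro mult_left_mono L0) (simp add: dist_norm)
      finally show "norm (f u s - f w s) \<le> L * dist u w * exp (l * \<bar>s\<bar>)" by (simp add: mult_ac)
    qed (use F l in auto)
    then have "exp (- (l * \<bar>t\<bar>)) * norm (F u t - F w t) 
        \<le> exp (- (l * \<bar>t\<bar>)) * ((L * dist u w) / l * exp (l * \<bar>t\<bar>))"
      by (intro mult_left_mono) auto
    also have "\<dots> = L / l * dist u w" by (simp add: exp_minus field_simps)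
    also have "\<dots> \<le> 1 / 2 * dist u w"
      using l L0 by (intro mult_right_mono) (auto simp: l_def field_simps)
    finally show "dist (apply_bcontfun (T u) t) (apply_bcontfun (T w) t) \<le> 1 / 2 * dist u w"
      by (simp add: T dist_norm flip: scaleR_diff_right)
  qed
  obtain u where u: "T u = u"
    using banach_fix_type[of "1 / 2" T] contr by auto
  have "exp (l * \<bar>t\<bar>) *\<^sub>R apply_bcontfun u t = F u t" for t
    using T[of u t] u by (simp flip: exp_add)
  then have "f u t = G t (F u t)" for t by (simp add: f_def)
  then show ?thesis using F[of u] by (intro exI[of _ "F u"]) auto
qed



lemma zero_if_derivative_le:
  fixes D :: "real \<Rightarrow> 'b :: real_normed_vector"
  assumes D: "\<And>t. 0 \<le> t \<Longrightarrow> t < T \<Longrightarrow> (D has_vector_derivative D' t) (at t)"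
    and le: "\<And>t. 0 \<le> t \<Longrightarrow> t < T \<Longrightarrow> norm (D' t) \<le> L * norm (D t)"
    and D0: "D 0 = 0" and t: "0 \<le> t" "t < T"
  shows "D t = 0"
proof (cases "t = 0")
  case False
  define l where "l = 2 * \<bar>L\<bar> + 1"
  have l: "l > 0" by (simp add: l_def)
  have Dc: "continuous_on {0..t} D"
    using D has_vector_derivative_continuous t by (intro continuous_at_imp_continuous_on) force
  \<comment> \<open>With the weight \<open>exp (- l * t)\<close> the Picard map at least halves the maximum, so the maximum vanishes.\<close>
  have "\<exists>m\<in>{0..t}. \<forall>s\<in>{0..t}. exp (- l * s) * norm (D s) \<le> exp (- l * m) * norm (D m)"
    by (rule continuous_attains_sup) (use t in \<open>auto intro!: continuous_intros Dc\<close>)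
  then obtain m where m: "m \<in> {0..t}" 
    and mx: "\<And>s. s \<in> {0..t} \<Longrightarrow> exp (- l * s) * norm (D s) \<le> exp (- l * m) * norm (D m)" by blast
  define K where "K = exp (- l * m) * norm (D m)"
  have K0: "0 \<le> K" by (simp add: K_def)
  have K: "norm (D s) \<le> K * exp (l * s)" if "s \<in> {0..t}" for s
    using mx[OF that] by (simp add: K_def exp_minus field_simps)
  have "norm (D m) \<le> (K / 2) * exp (l * m)"
  proof (cases "m = 0")
    case True
    then show ?thesis using D0 K0 by simp
  next
    case m0: False
    have "norm (D m - D 0) \<le> K / 2 * exp (l * m) - K / 2 * exp (l * 0)"
    proof (rule differentiable_bound_general[where f' = D'])
      show "0 < m" using m m0 by auto
      show "continuous_on {0..m} D" using Dc by (rule continuous_on_subset) (use m in auto)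
      show "continuous_on {0..m} (\<lambda>t. K / 2 * exp (l * t))" by (intro continuous_intros)
      fix x assume x: "0 < x" "x < m"
      then have xt: "0 \<le> x" "x < T" "x \<in> {0..t}" using m t by auto
      show "(D has_vector_derivative D' x) (at x)" using D xt by blast
      show "((\<lambda>t. K / 2 * exp (l * t)) has_vector_derivative K / 2 * (l * exp (l * x))) (at x)"
        by (auto intro!: derivative_eq_intros simp flip: has_real_derivative_iff_has_vector_derivative)
      have "norm (D' x) \<le> L * norm (D x)" using le xt by blast
      also have "\<dots> \<le> \<bar>L\<bar> * norm (D x)" by (intro mult_right_mono) auto
      also have "\<dots> \<le> \<bar>L\<bar> * (K * exp (l * x))" by (intro mult_left_mono K xt) auto
      also have "\<dots> \<le> l / 2 * (K * exp (l * x))"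
        using K0 by (intro mult_right_mono) (auto simp: l_def)
      finally show "norm (D' x) \<le> K / 2 * (l * exp (l * x))" by (simp add: mult_ac)
    qed
    then show ?thesis using K0 D0 by simp
  qed
  then have "exp (- l * m) * norm (D m) \<le> exp (- l * m) * ((K / 2) * exp (l * m))"
    by (intro mult_left_mono) auto
  then have "K \<le> K / 2" by (simp add: K_def exp_minus field_simps)
  then have "K = 0" using K0 by simp
  then show ?thesis using K[of t] t by simp
qed (use D0 in simp)

lemma ode_unique:
  fixes x y :: "real \<Rightarrow> 'b :: real_normed_vector"
  assumes x: "\<And>t. \<bar>t\<bar> < T \<Longrightarrow> (x has_vector_derivative x' t) (at t)"
    and y: "\<And>t. \<bar>t\<bar> < T \<Longrightarrow> (y has_vector_derivative y' t) (at t)"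
    and le: "\<And>t. \<bar>t\<bar> < T \<Longrightarrow> norm (x' t - y' t) \<le> L * norm (x t - y t)"
    and 0: "x 0 = y 0" and t: "\<bar>t\<bar> < T"
  shows "x t = y t"
proof (cases "0 \<le> t")
  case True
  have "x t - y t = 0"
    by (rule zero_if_derivative_le[where D = "\<lambda>t. x t - y t" and D' = "\<lambda>t. x' t - y' t" and T = T and L = L])
      (use True t 0 le in \<open>auto intro!: has_vector_derivative_diff x y\<close>)
  then show ?thesis by simp
next
  case False
  have "x (- (- t)) - y (- (- t)) = 0"
  proof (rule zero_if_derivative_le[where D = "\<lambda>t. x (- t) - y (- t)" 
        and D' = "\<lambda>t. - x' (- t) - - y' (- t)" and T = T and L = L])
    fix s assume s: "0 \<le> s" "s < T"
    show "((\<lambda>t. x (- t) - y (- t)) has_vector_derivative - x' (- s) - - y' (- s)) (at s)"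
      by (intro has_vector_derivative_diff has_vector_derivative_reflect x y) (use s in auto)
    have "norm (- x' (- s) - - y' (- s)) = norm (x' (- s) - y' (- s))"
      by (metis minus_diff_eq minus_diff_minus norm_minus_commute)
    then show "norm (- x' (- s) - - y' (- s)) \<le> L * norm (x (- s) - y (- s))"
      using le[of "- s"] s by simp
  qed (use False t 0 in auto)
  then show ?thesis by simp
qed

text \<open>At the first time at which \<open>f\<close> reaches \<open>c\<close>, the weak bound holds up to that time, and the
  improved bound contradicts the choice of that time.\<close>

lemma continuity_bootstrap:
  fixes f :: "real \<Rightarrow> real"
  assumes f: "continuous_on {0..T} f" and f0: "f 0 \<le> c"
    and step: "\<And>t. t \<in> {0..T} \<Longrightarrow> (\<And>s. s \<in> {0..t} \<Longrightarrow> f s \<le> c) \<Longrightarrow> f t < c"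
    and t: "t \<in> {0..T}"
  shows "f t < c"
proof (rule ccontr)
  assume "\<not> f t < c"
  define S where "S = {s \<in> {0..T}. c \<le> f s}"
  have "S \<noteq> {}" using t \<open>\<not> f t < c\<close> by (auto simp: S_def)
  have "closed S" unfolding S_def
    by (rule continuous_closed_preimage[OF f closed_real_atLeastAtMost closed_atLeast[of c], 
          unfolded vimage_def, THEN back_subst[of closed]]) auto
  then have "compact S" by (auto simp: S_def compact_eq_bounded_closed intro: bounded_subset[OF bounded_closed_interval])
  then obtain m where m: "m \<in> S" and min: "\<And>s. s \<in> S \<Longrightarrow> m \<le> s"
    using compact_attains_inf[OF _ \<open>S \<noteq> {}\<close>] by blast
  have mT: "0 \<le> m" "m \<le> T" "c \<le> f m" using m by (auto simp: S_def)
  have below: "f s < c" if "0 \<le> s" "s < m" for s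
    using min[of s] that mT by (force simp: S_def)
  have "f m \<le> c"
  proof (rule ccontr)
    assume "\<not> f m \<le> c"
    then have "\<exists>s\<ge>0. s \<le> m \<and> f s = c"
      by (intro IVT') (use f0 mT in \<open>auto intro: continuous_on_subset[OF f]\<close>)
    then show False using below \<open>\<not> f m \<le> c\<close> by (metis less_eq_real_def less_irrefl)
  qed
  then have "f s \<le> c" if "s \<in> {0..m}" for s
    using below[of s] that by (cases "s = m") auto
  with step[of m] mT show False by force
qed

lemma gronwall_linear:
  fixes E :: "real \<Rightarrow> real"
  assumes E: "\<And>s. 0 \<le> s \<Longrightarrow> s \<le> t \<Longrightarrow> (E has_real_derivative E' s) (at s)"
    and le: "\<And>s. 0 \<le> s \<Longrightarrow> s \<le> t \<Longrightarrow> E' s \<le> a * E s + B"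
    and E0: "E 0 = 0" and a: "0 \<le> a" and B: "0 \<le> B" and t: "0 \<le> t"
  shows "E t \<le> B * t * exp (a * t)"
proof -
  define g where "g s = exp (- (a * s)) * E s - B * s" for s
  have "g t \<le> g 0"
  proof (rule DERIV_nonpos_imp_nonincreasing[OF t])
    fix s assume s: "0 \<le> s" "s \<le> t"
    have "(g has_real_derivative exp (- (a * s)) * (E' s - a * E s) - B) (at s)"
      unfolding g_def by (auto intro!: derivative_eq_intros E s simp: algebra_simps)
    moreover have "exp (- (a * s)) * (E' s - a * E s) \<le> 1 * B"
    proof (cases "0 \<le> E' s - a * E s")
      case True
      then show ?thesis using le[OF s] a s by (intro mult_mono) auto
    next
      case False
      then have "exp (- (a * s)) * (E' s - a * E s) \<le> 0" by (intro mult_nonneg_nonpos) auto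
      then show ?thesis using B by simp
    qed
    ultimately show "\<exists>y. (g has_real_derivative y) (at s) \<and> y \<le> 0" by force
  qed
  then have "exp (- (a * t)) * E t \<le> B * t" by (simp add: g_def E0)
  then have "exp (a * t) * (exp (- (a * t)) * E t) \<le> exp (a * t) * (B * t)"
    by (intro mult_left_mono) auto
  then show ?thesis by (simp add: mult_ac flip: exp_add)
qed

text \<open>Differentiability of each coordinate does not give differentiability in norm, but it does when the
  candidate derivative is continuous in norm: a primitive of it exists in \<open>ell2\<close> and has the same
  coordinates up to constants.\<close>

lemma has_vector_derivative_ell2_coordinatewise:
  fixes y f :: "real \<Rightarrow> ell2"
  assumes f: "continuous_on UNIV f"
    and d: "\<And>n t. ((\<lambda>t. coeff (y t) n) has_vector_derivative coeff (f t) n) (at t)"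
  shows "(y has_vector_derivative f t) (at t)"
proof -
  obtain F where F: "F 0 = 0" "\<And>t. (F has_vector_derivative f t) (at t)"
    using antiderivative_exists[OF f] by blast
  have "y t = F t + y 0" for t
  proof (rule ell2_eqI)
    fix n
    have "((\<lambda>t. coeff (y t) n - coeff (F t) n) has_vector_derivative 0) (at t)" for t
      using has_vector_derivative_diff[OF d[of n t] bounded_linear.has_vector_derivative[OF bounded_linear_coeff[of n] F(2)[of t]]] 
      by simp
    then obtain c where "\<And>t. t \<in> UNIV \<Longrightarrow> coeff (y t) n - coeff (F t) n = c"
      by (rule has_vector_derivative_zero_constant[OF convex_UNIV]) simp
    from this[of t] this[of 0] show "coeff (y t) n = coeff (F t + y 0) n"
      by (simp add: F(1) algebra_simps)
  qed
  then have "y = (\<lambda>t. F t + y 0)" by blast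
  moreover have "((\<lambda>t. F t + y 0) has_vector_derivative f t) (at t)"
    by (auto intro!: derivative_eq_intros F)
  ultimately show ?thesis by metis
qed

text \<open>For one Fourier mode, the integrating factor \<open>exp (i t p)\<close> turns the Duhamel formula into the
  fundamental theorem of calculus.\<close>

lemma duhamel_iff_ode:
  fixes y N :: "real \<Rightarrow> complex" and p :: real
  assumes N: "continuous_on UNIV N" 
  shows "(\<forall>t. y t = - \<i> / 2 * (LBINT s=0..ereal t. exp (- (\<i> * of_real (t - s) * of_real p)) * N s))
    \<longleftrightarrow> y 0 = 0 \<and> (\<forall>t. (y has_vector_derivative (- \<i> * of_real p * y t - \<i> / 2 * N t)) (at t))"
    (is "?duhamel y \<longleftrightarrow> ?ode y")
proof -
  have forward: "?duhamel x" if x: "?ode x" for x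
  proof
    fix t
    let ?N = "\<lambda>s. exp (\<i> * of_real s * of_real p) * N s"
    have "(LBINT s=ereal 0..ereal t. - \<i> / 2 * ?N s) = exp (\<i> * of_real t * of_real p) * x t - exp (\<i> * of_real 0 * of_real p) * x 0"
    proof (rule interval_integral_FTC_finite)
      show "continuous_on {min 0 t..max 0 t} (\<lambda>s. - \<i> / 2 * ?N s)"
        by (intro continuous_intros continuous_on_subset[OF N]) auto
      fix s
      have "((\<lambda>s. exp (\<i> * of_real s * of_real p)) has_vector_derivative 
          (\<i> * of_real p * exp (\<i> * of_real s * of_real p))) (at s)"
        by (rule has_vector_derivative_real_field) (auto intro!: derivative_eq_intros)
      from has_vector_derivative_mult[OF this x[THEN conjunct2, THEN spec, of s]]
      show "((\<lambda>s. exp (\<i> * of_real s * of_real p) * x s) has_vector_derivative - \<i> / 2 * ?N s)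
          (at s within {min 0 t..max 0 t})"
        by (simp add: algebra_simps has_vector_derivative_at_within)
    qed
    then have "exp (\<i> * of_real t * of_real p) * x t = (LBINT s=ereal 0..ereal t. - \<i> / 2 * ?N s)"
      using x by simp
    also have "\<dots> = - \<i> / 2 * (LBINT s=ereal 0..ereal t. ?N s)"
      by (rule interval_lebesgue_integral_mult_right)
    finally have "exp (\<i> * of_real t * of_real p) * x t = - \<i> / 2 * (LBINT s=0..t. ?N s)"
      by (simp only: zero_ereal_def)
    then have "exp (- (\<i> * of_real t * of_real p)) * (exp (\<i> * of_real t * of_real p) * x t) 
        = - \<i> / 2 * (exp (- (\<i> * of_real t * of_real p)) * (LBINT s=0..t. ?N s))"
      by (simp only: mult.left_commute)
    also have "exp (- (\<i> * of_real t * of_real p)) * (LBINT s=0..t. ?N s) 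
        = (LBINT s=0..t. exp (- (\<i> * of_real t * of_real p)) * ?N s)"
      by (rule interval_lebesgue_integral_mult_right[symmetric])
    also have "(\<lambda>s. exp (- (\<i> * of_real t * of_real p)) * ?N s) 
        = (\<lambda>s. exp (- (\<i> * of_real (t - s) * of_real p)) * N s)"
    proof
      fix s
      have "exp (- (\<i> * of_real t * of_real p)) * exp (\<i> * of_real s * of_real p) 
          = exp (- (\<i> * of_real (t - s) * of_real p))"
        unfolding exp_add[symmetric] by (simp add: algebra_simps)
      then show "exp (- (\<i> * of_real t * of_real p)) * ?N s = exp (- (\<i> * of_real (t - s) * of_real p)) * N s"
        by (simp only: mult.assoc[symmetric])
    qed
    finally show "x t = - \<i> / 2 * (LBINT s=0..ereal t. exp (- (\<i> * of_real (t - s) * of_real p)) * N s)"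
      by (simp add: zero_ereal_def mult.assoc[symmetric] flip: exp_add)
  qed
  show ?thesis
  proof
    assume y: "?duhamel y"
    let ?N = "\<lambda>s. - \<i> / 2 * (exp (\<i> * of_real s * of_real p) * N s)"
    have "continuous_on UNIV ?N" by (intro continuous_intros N)
    then obtain J where J: "J 0 = 0" "\<And>t. (J has_vector_derivative ?N t) (at t)"
      using antiderivative_exists by blast
    define x where "x t = exp (- (\<i> * of_real t * of_real p)) * J t" for t
    have "?ode x"
    proof (intro conjI allI)
      fix s
      have "((\<lambda>s. exp (- (\<i> * of_real s * of_real p))) has_vector_derivative 
          (- \<i> * of_real p * exp (- (\<i> * of_real s * of_real p)))) (at s)"
        by (rule has_vector_derivative_real_field) (auto intro!: derivative_eq_intros)
      from has_vector_derivative_mult[OF this J(2)]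
      have "(x has_vector_derivative exp (- (\<i> * of_real s * of_real p)) * ?N s 
          + - \<i> * of_real p * exp (- (\<i> * of_real s * of_real p)) * J s) (at s)"
        unfolding x_def by simp
      moreover have "exp (- (\<i> * of_real s * of_real p)) * ?N s = - \<i> / 2 * N s"
        by (simp add: exp_minus)
      ultimately have "(x has_vector_derivative - \<i> / 2 * N s 
          + - \<i> * of_real p * exp (- (\<i> * of_real s * of_real p)) * J s) (at s)"
        by (simp only:)
      then show "(x has_vector_derivative (- \<i> * of_real p * x s - \<i> / 2 * N s)) (at s)"
        by (rule back_subst[of "\<lambda>d. (x has_vector_derivative d) (at s)"]) (simp add: x_def mult_ac)
    qed (simp add: x_def J)
    moreover from forward[OF this] y have "x = y" by (metis ext)
    ultimately show "?ode y" by simp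
  qed (rule forward)
qed

section \<open>Radial truncation and reflection\<close>

text \<open>Truncation by a scalar between 0 and 1, which makes a quadratic vector field globally Lipschitz.
  Since the scalar can be pulled out of every product, the truncated nonlinearity keeps the algebraic
  cancellations of the original one, and a priori bounds do not depend on \<open>R\<close>.\<close>

definition clip :: "real \<Rightarrow> ell2 \<Rightarrow> ell2" where
  "clip R y = (if norm y \<le> R then y else (R / norm y) *\<^sub>R y)"

lemma clip_eq_scaleR: 
  assumes "0 \<le> R" shows "\<exists>\<theta>. 0 \<le> \<theta> \<and> \<theta> \<le> 1 \<and> clip R y = \<theta> *\<^sub>R y"
proof (cases "norm y \<le> R")
  case True
  then show ?thesis by (intro exI[of _ 1]) (simp add: clip_def)
next
  case False
  then have "0 < norm y" using assms by linarith
  then have "R / norm y \<le> 1" using False by (subst divide_le_eq_1_pos) auto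
  moreover have "0 \<le> R / norm y" "clip R y = (R / norm y) *\<^sub>R y" using False assms by (simp_all add: clip_def)
  ultimately show ?thesis by blast
qed

lemma norm_clip_le: "0 \<le> R \<Longrightarrow> norm (clip R y) \<le> R"
  by (auto simp: clip_def)

lemma clip_lipschitz:
  assumes R: "0 \<le> R"
  shows "norm (clip R x - clip R y) \<le> 2 * norm (x - y)"
proof -
  have *: "norm (clip R x - clip R y) \<le> 2 * norm (x - y)" if le: "norm x \<le> norm y" for x y
  proof (cases "norm y \<le> R")
    case True
    then show ?thesis using le by (simp add: clip_def)
  next
    case yR: False
    \<comment> \<open>Both points are compared with the multiple \<open>?c *\<^sub>R x\<close>, where \<open>?c\<close> is the factor that truncates
      the longer of the two.\<close>
    let ?c = "R / norm y"
    have y0: "0 < norm y" using R yR by linarith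
    then have "?c \<le> 1" using yR by (subst divide_le_eq_1_pos) auto
    with y0 have c: "0 \<le> ?c" "?c \<le> 1" "?c * norm y = R" using R by auto
    have eq: "clip R y = ?c *\<^sub>R y" using yR by (simp add: clip_def)
    have "norm (clip R x - ?c *\<^sub>R x) \<le> norm y - norm x"
    proof (cases "norm x \<le> R")
      case True
      then have "norm (clip R x - ?c *\<^sub>R x) = (1 - ?c) * norm x"
        using c by (simp add: clip_def flip: scaleR_left_diff_distrib[of 1 _ x, simplified])
      also have "\<dots> \<le> (1 - ?c) * R" using True c by (intro mult_left_mono) auto
      also have "\<dots> \<le> (1 - ?c) * norm y" using yR c by (intro mult_left_mono) auto
      also have "\<dots> = norm y - R" using c(3) by (simp add: left_diff_distrib)
      finally show ?thesis using True by linarith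
    next
      case xR: False
      then have x0: "0 < norm x" using R by linarith
      have "norm (clip R x - ?c *\<^sub>R x) = \<bar>R / norm x - ?c\<bar> * norm x"
        using xR by (simp add: clip_def flip: scaleR_left_diff_distrib)
      also have "\<dots> = R - ?c * norm x"
        using x0 R le yR by (subst abs_of_nonneg) (auto simp: left_diff_distrib intro!: divide_left_mono mult_pos_pos)
      also have "\<dots> = ?c * (norm y - norm x)" using c(3) by (simp add: right_diff_distrib)
      also have "\<dots> \<le> 1 * (norm y - norm x)" using c le by (intro mult_right_mono) auto
      finally show ?thesis by simp
    qed
    moreover have "norm y - norm x \<le> norm (x - y)" by (metis norm_minus_commute norm_triangle_ineq2)
    moreover have "norm (?c *\<^sub>R x - ?c *\<^sub>R y) \<le> 1 * norm (x - y)"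
      unfolding scaleR_diff_right[symmetric] norm_scaleR using c by (intro mult_right_mono) auto
    moreover have "norm (clip R x - clip R y) \<le> norm (clip R x - ?c *\<^sub>R x) + norm (?c *\<^sub>R x - ?c *\<^sub>R y)"
      unfolding eq using norm_triangle_ineq[of "clip R x - ?c *\<^sub>R x" "?c *\<^sub>R x - ?c *\<^sub>R y"] by simp
    ultimately show ?thesis by linarith
  qed
  show ?thesis
    using *[of x y] *[of y x] by (cases "norm x \<le> norm y") (auto simp: norm_minus_commute)
qed

text \<open>On the Fourier side this is complex conjugation of the function.\<close>

definition conj_reflect :: "(int \<Rightarrow> complex) \<Rightarrow> int \<Rightarrow> complex" where
  "conj_reflect a = (\<lambda>n. cnj (a (- n)))"

definition hermitian :: "(int \<Rightarrow> complex) \<Rightarrow> bool" where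
  "hermitian a \<longleftrightarrow> (\<forall>n. a (- n) = cnj (a n))"

lemma hermitian_iff: "hermitian a \<longleftrightarrow> conj_reflect a = a"
  unfolding hermitian_def conj_reflect_def fun_eq_iff
  by (metis complex_cnj_cnj)

lemma bij_uminus_int: "bij_betw uminus UNIV (UNIV :: int set)"
  by (rule bij_betwI[where g = uminus]) auto

lemma infsum_int_uminus: 
  fixes f :: "int \<Rightarrow> 'b :: {comm_monoid_add, t2_space}"
  shows "(\<Sum>\<^sub>\<infinity>k. f (- k)) = (\<Sum>\<^sub>\<infinity>k. f k)"
  using infsum_reindex_bij_betw[OF bij_uminus_int, of f] .

lemma conj_reflect_fprod: "conj_reflect (fprod a b) = fprod (conj_reflect a) (conj_reflect b)"
proof
  fix n
  have "conj_reflect (fprod a b) n = (\<Sum>\<^sub>\<infinity>k. cnj (a k * b (- n - k)))"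
    by (simp only: conj_reflect_def fprod_def infsum_cnj)
  also have "\<dots> = (\<Sum>\<^sub>\<infinity>k. cnj (a (- k) * b (- n - - k)))"
    by (rule infsum_int_uminus[symmetric])
  also have "\<dots> = fprod (conj_reflect a) (conj_reflect b) n"
    by (simp add: conj_reflect_def fprod_def algebra_simps)
  finally show "conj_reflect (fprod a b) n = fprod (conj_reflect a) (conj_reflect b) n" .
qed

definition reflect :: "ell2 \<Rightarrow> ell2" where
  "reflect y = Abs_ell2 (conj_reflect (coeff y))"

lemma coeff_reflect: "coeff (reflect y) = conj_reflect (coeff y)"
proof -
  have "(\<lambda>n. (cmod (coeff y (- n)))\<^sup>2) summable_on UNIV"
    using summable_on_reindex_bij_betw[OF bij_uminus_int, of "\<lambda>n. (cmod (coeff y n))\<^sup>2"] coeff_sq_summable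
    by blast
  then show ?thesis unfolding reflect_def by (subst Abs_ell2_inverse) (auto simp: conj_reflect_def)
qed

lemma norm_reflect [simp]: "norm (reflect y) = norm y"
  unfolding norm_ell2_def coeff_reflect conj_reflect_def
  using infsum_int_uminus[of "\<lambda>n. (cmod (coeff y n))\<^sup>2"] by simp

lemma bounded_linear_reflect: "bounded_linear reflect"
proof (rule bounded_linear_intro[where K = 1])
  show "reflect (x + y) = reflect x + reflect y" for x y
    by (rule ell2_eqI) (simp add: coeff_reflect conj_reflect_def)
  show "reflect (r *\<^sub>R x) = r *\<^sub>R reflect x" for r x
    by (rule ell2_eqI) (simp add: coeff_reflect conj_reflect_def)
qed simp

lemma reflect_clip: "reflect (clip R y) = clip R (reflect y)"
  by (simp add: clip_def linear_cmul[OF bounded_linear.linear[OF bounded_linear_reflect]])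

lemma unemb_reflect: "unemb s (reflect y) = conj_reflect (unemb s y)"
  by (simp add: unemb_def coeff_reflect conj_reflect_def)

section \<open>The equation for the remainder\<close>

text \<open>The data \<open>z\<close> and the limit square \<open>q\<close> of its free evolution enter the deterministic problem
  only through the properties collected here. The small parameter \<open>e\<close> measures
  the roughness of the data; the remainder is sought at regularity \<open>1 - 8 * e\<close>, and the factor 8
  leaves room for the powers of \<open>N\<close> that are lost in the global bound. By \<open>z_log\<close>, the \<open>L\<^sup>2\<close> norm of
  the data truncated to frequencies up to \<open>N\<close> grows more slowly than \<open>ln N\<close>, so that Gronwall's inequality
  with this norm as rate loses less than any power of \<open>N\<close>.\<close>

locale bbm_data =
  fixes e D :: real and z :: "int \<Rightarrow> complex" and q :: "real \<Rightarrow> int \<Rightarrow> complex"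
  assumes e_pos: "0 < e" and e_le: "e \<le> 1 / 32"
    and z: "z \<in> sobolev (- e)" and z_herm: "hermitian z"
    and z_log: "\<And>\<eta>. 0 < \<eta> \<Longrightarrow> 
      \<forall>\<^sub>F N in sequentially. L2_set (\<lambda>n. cmod (z n)) {- int N..int N} \<le> \<eta> * ln (real N)"
    and q: "\<And>t. q t \<in> sobolev (- e)" and q_herm: "\<And>t. hermitian (q t)"
    and q_lipschitz: "\<And>t t'. sobolev_norm (- e) (\<lambda>n. q t n - q t' n) \<le> D * \<bar>t - t'\<bar>"
begin

definition s :: real where "s = 1 - 8 * e"
definition zt :: "real \<Rightarrow> int \<Rightarrow> complex" where "zt t = S_prop t z"
definition Z :: real where "Z = sobolev_norm (- e) z"
definition C :: real where "C = prod_const e s"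

lemma s_bounds: "3 / 4 \<le> s" "s < 1" "s - e > 1 / 2"
  using e_pos e_le by (auto simp: s_def)

lemma Z_nonneg [simp]: "0 \<le> Z" and C_nonneg [simp]: "0 \<le> C"
  by (simp_all add: Z_def C_def)

lemma D_nonneg: "0 \<le> D"
  using q_lipschitz[of 1 0] sobolev_norm_nonneg[of "- e" "\<lambda>n. q 1 n - q 0 n"] by (simp del: sobolev_norm_nonneg)

lemma zt: "zt t \<in> sobolev (- e)" "sobolev_norm (- e) (zt t) \<le> Z"
  "sobolev_norm (- e) (\<lambda>n. zt t n - zt t' n) \<le> \<bar>t - t'\<bar> * Z"
  using S_prop_sobolev[OF z] by (auto simp: zt_def Z_def)

lemma zt_herm: "conj_reflect (zt t) = zt t"
  using z_herm by (auto simp: conj_reflect_def zt_def S_prop_def hermitian_def exp_cnj)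

lemma sobolev_s_subset: 
  assumes "a \<in> sobolev s"
  shows "a \<in> sobolev (- e)" "sobolev_norm (- e) a \<le> sobolev_norm s a"
  using sobolev_mono[OF assms, of "- e"] s_bounds e_pos by auto

lemma fprod_s:
  assumes "a \<in> sobolev (- e)" "b \<in> sobolev s"
  shows "(\<lambda>k. cmod (a k * b (n - k))) summable_on UNIV"
    and "fprod a b \<in> sobolev (- e)"
    and "sobolev_norm (- e) (fprod a b) \<le> C * sobolev_norm (- e) a * sobolev_norm s b"
  unfolding C_def using fprod_sobolev[of e s a b] assms s_bounds e_pos by auto

lemma fprod_diff_left:
  assumes "a \<in> sobolev (- e)" "a' \<in> sobolev (- e)" "b \<in> sobolev s"
  shows "fprod (\<lambda>n. a n - a' n) b n = fprod a b n - fprod a' b n"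
  using fprod_diff[of a b a'] fprod_s[OF assms(1,3)] fprod_s[OF assms(2,3)] by blast

lemma fprod_diff_right:
  assumes "a \<in> sobolev (- e)" "b \<in> sobolev s" "b' \<in> sobolev s"
  shows "fprod a (\<lambda>n. b n - b' n) n = fprod a b n - fprod a b' n"
proof -
  have "fprod (\<lambda>n. b n - b' n) a n = fprod b a n - fprod b' a n"
  proof (rule fprod_diff)
    show "(\<lambda>k. cmod (b k * a (n - k))) summable_on UNIV" for n
      using fprod_s(1)[OF assms(1,2), of n] 
        summable_on_int_reflect[of "\<lambda>k. cmod (a k * b (n - k))" n] by (simp add: mult.commute)
    show "(\<lambda>k. cmod (b' k * a (n - k))) summable_on UNIV" for n
      using fprod_s(1)[OF assms(1,3), of n] 
        summable_on_int_reflect[of "\<lambda>k. cmod (a k * b' (n - k))" n] by (simp add: mult.commute)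
  qed
  then show ?thesis by (simp add: fprod_commute[of a])
qed

text \<open>The quantity to which \<open>phi_D\<close> is applied in the nonlinearity. It is only as regular as the
  data.\<close>

definition inner :: "real \<Rightarrow> (int \<Rightarrow> complex) \<Rightarrow> int \<Rightarrow> complex" where
  "inner t k = (\<lambda>n. fprod k k n + 2 * fprod (zt t) k n + q t n)"

lemma bbm_nonlin_inner: "bbm_nonlin (S_prop t z) (q t) k n = of_real (phi n) * inner t k n"
  by (simp add: bbm_nonlin_def phi_D_def inner_def zt_def algebra_simps)

lemma inner_sobolev:
  assumes "k \<in> sobolev s" shows "inner t k \<in> sobolev (- e)"
  unfolding inner_def
  by (intro sobolev_add sobolev_cmult fprod_s sobolev_s_subset zt q assms)

lemma inner_lipschitz:
  assumes k: "k \<in> sobolev s" and k': "k' \<in> sobolev s"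
  shows "sobolev_norm (- e) (\<lambda>n. inner t k n - inner t' k' n)
    \<le> C * (sobolev_norm s k + sobolev_norm s k' + 2 * Z) * sobolev_norm s (\<lambda>n. k n - k' n)
      + (2 * C * Z * sobolev_norm s k' + D) * \<bar>t - t'\<bar>"
proof -
  define d where "d = (\<lambda>n. k n - k' n)"
  define w where "w = (\<lambda>n. zt t n - zt t' n)"
  have d: "d \<in> sobolev s" "d \<in> sobolev (- e)" "sobolev_norm (- e) d \<le> sobolev_norm s d"
    unfolding d_def using sobolev_diff(1)[OF k k'] sobolev_s_subset by blast+
  have w: "w \<in> sobolev (- e)" "sobolev_norm (- e) w \<le> \<bar>t - t'\<bar> * Z"
    unfolding w_def using sobolev_diff(1)[OF zt(1) zt(1)] zt(3) by blast+
  note ks = sobolev_s_subset[OF k] sobolev_s_subset[OF k']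
  have eq: "inner t k n - inner t' k' n 
     = ((fprod d k n + fprod d k' n) + (2 * fprod (zt t) d n + 2 * fprod w k' n)) + (q t n - q t' n)" for n
    unfolding inner_def d_def w_def
    by (simp add: fprod_diff_left[OF ks(1) ks(3) k] fprod_diff_left[OF ks(1) ks(3) k']
        fprod_diff_right[OF zt(1) k k'] fprod_diff_left[OF zt(1) zt(1) k'] fprod_commute[of k k'] algebra_simps)
  have b1: "sobolev_norm (- e) (fprod d k) \<le> C * sobolev_norm s d * sobolev_norm s k"
    using fprod_s(3)[OF d(2) k] mult_right_mono[OF mult_left_mono[OF d(3), of C], of "sobolev_norm s k"] by simp
  have b2: "sobolev_norm (- e) (fprod d k') \<le> C * sobolev_norm s d * sobolev_norm s k'"
    using fprod_s(3)[OF d(2) k'] mult_right_mono[OF mult_left_mono[OF d(3), of C], of "sobolev_norm s k'"] by simp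
  have b3: "sobolev_norm (- e) (fprod (zt t) d) \<le> C * Z * sobolev_norm s d"
    using fprod_s(3)[OF zt(1) d(1), of t] mult_right_mono[OF mult_left_mono[OF zt(2)[of t], of C], of "sobolev_norm s d"] by simp
  have b4: "sobolev_norm (- e) (fprod w k') \<le> C * (\<bar>t - t'\<bar> * Z) * sobolev_norm s k'"
    using fprod_s(3)[OF w(1) k'] mult_right_mono[OF mult_left_mono[OF w(2), of C], of "sobolev_norm s k'"] by simp
  note m = fprod_s(2)[OF d(2) k] fprod_s(2)[OF d(2) k'] sobolev_cmult[OF fprod_s(2)[OF zt(1)[of t] d(1)], of 2]
    sobolev_cmult[OF fprod_s(2)[OF w(1) k'], of 2] sobolev_diff[OF q[of t] q[of t']]
  have "sobolev_norm (- e) (\<lambda>n. inner t k n - inner t' k' n)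
     \<le> ((sobolev_norm (- e) (fprod d k) + sobolev_norm (- e) (fprod d k')) 
      + (sobolev_norm (- e) (\<lambda>n. 2 * fprod (zt t) d n) + sobolev_norm (- e) (\<lambda>n. 2 * fprod w k' n)))
      + sobolev_norm (- e) (\<lambda>n. q t n - q t' n)"
    unfolding eq
    by (intro order.trans[OF sobolev_add(3)] add_mono sobolev_add(1) order.refl m)
  also have "\<dots> \<le> ((C * sobolev_norm s d * sobolev_norm s k + C * sobolev_norm s d * sobolev_norm s k') 
      + (2 * (C * Z * sobolev_norm s d) + 2 * (C * (\<bar>t - t'\<bar> * Z) * sobolev_norm s k')))
      + D * \<bar>t - t'\<bar>"
    using m(4) m(6) b3 b4 by (intro add_mono b1 b2 q_lipschitz) (auto elim!: order.trans)
  finally show ?thesis by (simp add: d_def algebra_simps)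
qed

text \<open>The derivative gained by \<open>phi\<close> compensates the negative regularity of the data; thus the
  equation for the remainder is an ordinary differential equation in \<open>sobolev s\<close>.\<close>

lemma phi_smoothing:
  assumes a: "a \<in> sobolev (- e)"
  shows "(\<lambda>n. - \<i> * of_real (phi n) * a n) \<in> sobolev s"
    and "sobolev_norm s (\<lambda>n. - \<i> * of_real (phi n) * a n) \<le> sobolev_norm (- e) a"
proof -
  have "jbracket n powr s * cmod (- \<i> * of_real (phi n) * a n) \<le> 1 * (jbracket n powr (- e) * cmod (a n))" for n
  proof -
    have "jbracket n powr s * \<bar>phi n\<bar> \<le> jbracket n powr s * jbracket n powr (- 1)"
      using abs_phi_le[of n] less_imp_le[OF jbracket_pos[of n]]
      by (intro mult_left_mono) (auto simp: powr_minus divide_inverse)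
    also have "\<dots> \<le> jbracket n powr (- e)"
      unfolding powr_add[symmetric] using jbracket_ge_1[of n] e_pos by (intro powr_mono) (auto simp: s_def)
    finally have "jbracket n powr s * \<bar>phi n\<bar> * cmod (a n) \<le> jbracket n powr (- e) * cmod (a n)"
      by (rule mult_right_mono) simp
    then show ?thesis by (simp add: norm_mult mult.assoc)
  qed
  from sobolev_dominated[OF a _ this] 
  show "(\<lambda>n. - \<i> * of_real (phi n) * a n) \<in> sobolev s"
    and "sobolev_norm s (\<lambda>n. - \<i> * of_real (phi n) * a n) \<le> sobolev_norm (- e) a" by auto
qed

text \<open>The right-hand side of the equation, with the argument of the nonlinearity kept separate from
  that of the linear part, because only the former is truncated.\<close>

definition field_seq :: "real \<Rightarrow> ell2 \<Rightarrow> ell2 \<Rightarrow> int \<Rightarrow> complex" where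
  "field_seq t y k = (\<lambda>n. - \<i> * of_real (phi n) * (unemb s y n + 1 / 2 * inner t (unemb s k) n))"

definition bbm_field :: "real \<Rightarrow> ell2 \<Rightarrow> ell2 \<Rightarrow> ell2" where
  "bbm_field t y k = emb s (field_seq t y k)"

lemma field_arg_sobolev: "(\<lambda>n. unemb s y n + 1 / 2 * inner t (unemb s k) n) \<in> sobolev (- e)"
  by (intro sobolev_add sobolev_cmult inner_sobolev sobolev_s_subset unemb_sobolev)

lemma field_seq_sobolev: "field_seq t y k \<in> sobolev s"
  unfolding field_seq_def by (rule phi_smoothing(1)[OF field_arg_sobolev])

lemma unemb_bbm_field: "unemb s (bbm_field t y k) = field_seq t y k"
  unfolding bbm_field_def by (rule unemb_emb[OF field_seq_sobolev])

lemma bbm_field_lipschitz: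
  "norm (bbm_field t y k - bbm_field t' y' k') 
    \<le> norm (y - y') + C * (norm k + norm k' + 2 * Z) * norm (k - k') + (2 * C * Z * norm k' + D) * \<bar>t - t'\<bar>"
proof -
  define a where "a = (\<lambda>n. unemb s (y - y') n + 1 / 2 * (inner t (unemb s k) n - inner t' (unemb s k') n))"
  have i: "(\<lambda>n. inner t (unemb s k) n - inner t' (unemb s k') n) \<in> sobolev (- e)"
    by (intro sobolev_diff inner_sobolev unemb_sobolev)
  have a: "a \<in> sobolev (- e)" unfolding a_def
    by (intro sobolev_add sobolev_cmult i sobolev_s_subset unemb_sobolev)
  have "bbm_field t y k - bbm_field t' y' k' = emb s (\<lambda>n. field_seq t y k n - field_seq t' y' k' n)"
    unfolding bbm_field_def by (rule sobolev_diff(2)[symmetric, OF field_seq_sobolev field_seq_sobolev])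
  also have "(\<lambda>n. field_seq t y k n - field_seq t' y' k' n) = (\<lambda>n. - \<i> * of_real (phi n) * a n)"
    by (auto simp: field_seq_def a_def unemb_diff algebra_simps)
  finally have "norm (bbm_field t y k - bbm_field t' y' k') = sobolev_norm s (\<lambda>n. - \<i> * of_real (phi n) * a n)"
    using norm_emb[OF phi_smoothing(1)[OF a]] by simp
  also have "\<dots> \<le> sobolev_norm (- e) a" by (rule phi_smoothing(2)[OF a])
  also have "\<dots> \<le> sobolev_norm (- e) (unemb s (y - y')) 
      + sobolev_norm (- e) (\<lambda>n. 1 / 2 * (inner t (unemb s k) n - inner t' (unemb s k') n))"
    unfolding a_def by (intro sobolev_add(3) sobolev_cmult i sobolev_s_subset unemb_sobolev)
  also have "\<dots> \<le> norm (y - y') + 1 / 2 * sobolev_norm (- e) (\<lambda>n. inner t (unemb s k) n - inner t' (unemb s k') n)"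
    using sobolev_s_subset(2)[OF unemb_sobolev, of "y - y'"] sobolev_cmult(2)[OF i, of "1/2"] by simp
  also have "\<dots> \<le> norm (y - y') + sobolev_norm (- e) (\<lambda>n. inner t (unemb s k) n - inner t' (unemb s k') n)"
    by simp
  also have "sobolev_norm (- e) (\<lambda>n. inner t (unemb s k) n - inner t' (unemb s k') n)
     \<le> C * (norm k + norm k' + 2 * Z) * norm (k - k') + (2 * C * Z * norm k' + D) * \<bar>t - t'\<bar>"
    using inner_lipschitz[OF unemb_sobolev[of s k] unemb_sobolev[of s k'], of t t'] 
    by (simp flip: unemb_diff)
  finally show ?thesis by simp
qed

lemma bbm_field_continuous:
  assumes y: "continuous_on UNIV y"
  shows "continuous_on UNIV (\<lambda>t. bbm_field t (y t) (y t))"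
proof -
  have "((\<lambda>t. bbm_field t (y t) (y t)) \<longlongrightarrow> bbm_field t0 (y t0) (y t0)) (at t0)" for t0
  proof (rule LIM_zero_cancel, rule Lim_null_comparison)
    let ?h = "\<lambda>t. norm (y t - y t0) + C * (norm (y t) + norm (y t0) + 2 * Z) * norm (y t - y t0) 
      + (2 * C * Z * norm (y t0) + D) * \<bar>t - t0\<bar>"
    show "\<forall>\<^sub>F t in at t0. norm (bbm_field t (y t) (y t) - bbm_field t0 (y t0) (y t0)) \<le> ?h t"
      using bbm_field_lipschitz by simp
    have "(y \<longlongrightarrow> y t0) (at t0)" using y by (simp add: continuous_on_def)
    then have "(?h \<longlongrightarrow> ?h t0) (at t0)" by (intro tendsto_intros)
    then show "(?h \<longlongrightarrow> 0) (at t0)" by simp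
  qed
  then show ?thesis by (simp add: continuous_on_def)
qed

lemma reflect_bbm_field: "reflect (bbm_field t y k) = bbm_field t (reflect y) (reflect k)"
proof -
  have "conj_reflect (inner t a) = inner t (conj_reflect a)" for a
    using fun_cong[OF conj_reflect_fprod[of a a]] fun_cong[OF conj_reflect_fprod[of "zt t" a]] 
      zt_herm[of t] q_herm[of t]
    by (auto simp: inner_def conj_reflect_def hermitian_def fun_eq_iff)
  then have "conj_reflect (field_seq t y k) = field_seq t (reflect y) (reflect k)"
    by (simp add: field_seq_def unemb_reflect fun_eq_iff conj_reflect_def)
  then have "unemb s (reflect (bbm_field t y k)) = unemb s (bbm_field t (reflect y) (reflect k))"
    by (simp add: unemb_reflect unemb_bbm_field)
  then show ?thesis by (metis emb_unemb)
qed

definition clipped_solution :: "real \<Rightarrow> (real \<Rightarrow> ell2) \<Rightarrow> bool" where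
  "clipped_solution R y \<longleftrightarrow> y 0 = 0 \<and> 
    (\<forall>t. (y has_vector_derivative bbm_field t (y t) (clip R (y t))) (at t))"

lemma clipped_field_lipschitz:
  assumes R: "0 \<le> R"
  shows "norm (bbm_field t y (clip R y) - bbm_field t' y' (clip R y'))
    \<le> (1 + 2 * C * (2 * R + 2 * Z) + (2 * C * Z * R + D)) * (\<bar>t - t'\<bar> + norm (y - y'))"
proof -
  let ?k = "clip R y" and ?k' = "clip R y'"
  define P Q where "P = 1 + 2 * C * (2 * R + 2 * Z)" and "Q = 2 * C * Z * R + D"
  have "norm (bbm_field t y ?k - bbm_field t' y' ?k') 
     \<le> norm (y - y') + C * (norm ?k + norm ?k' + 2 * Z) * norm (?k - ?k') + (2 * C * Z * norm ?k' + D) * \<bar>t - t'\<bar>"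
    by (rule bbm_field_lipschitz)
  also have "\<dots> \<le> norm (y - y') + C * (R + R + 2 * Z) * (2 * norm (y - y')) + (2 * C * Z * R + D) * \<bar>t - t'\<bar>"
    using norm_clip_le[OF R] D_nonneg R
    by (intro add_mono mult_mono clip_lipschitz R order.refl add_nonneg_nonneg mult_nonneg_nonneg) auto
  also have "\<dots> = P * norm (y - y') + Q * \<bar>t - t'\<bar>"
    by (simp add: P_def Q_def algebra_simps)
  also have "\<dots> \<le> (P + Q) * (\<bar>t - t'\<bar> + norm (y - y'))"
  proof -
    have "0 \<le> P" "0 \<le> Q" using R D_nonneg by (auto simp: P_def Q_def)
    then have "0 \<le> P * \<bar>t - t'\<bar>" "0 \<le> Q * norm (y - y')" by auto
    then show ?thesis by (simp add: distrib_left distrib_right)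
  qed
  finally show ?thesis by (simp add: P_def Q_def)
qed

lemma clipped_solution_exists: "0 \<le> R \<Longrightarrow> \<exists>y. clipped_solution R y"
  unfolding clipped_solution_def by (rule ode_exists) (rule clipped_field_lipschitz)

text \<open>The reflection maps solutions to solutions, so uniqueness forces the solution to be
  real-valued in physical space; the cancellation in the energy estimate depends on this.\<close>

lemma clipped_solution_hermitian:
  assumes R: "0 \<le> R" and y: "clipped_solution R y"
  shows "hermitian (unemb s (y t))"
proof -
  have d: "(y has_vector_derivative bbm_field t (y t) (clip R (y t))) (at t)" for t
    using y by (simp add: clipped_solution_def)
  have "reflect (y t) = y t"
  proof (rule ode_unique[where T = "\<bar>t\<bar> + 1" and x = "\<lambda>t. reflect (y t)"])
    show "((\<lambda>t. reflect (y t)) has_vector_derivative 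
        bbm_field t (reflect (y t)) (clip R (reflect (y t)))) (at t)" for t
      using bounded_linear.has_vector_derivative[OF bounded_linear_reflect d[of t]]
      by (simp add: reflect_bbm_field reflect_clip)
    show "reflect (y 0) = y 0"
      using y linear_0[OF bounded_linear.linear[OF bounded_linear_reflect]] by (simp add: clipped_solution_def)
    show "norm (bbm_field t (reflect (y t)) (clip R (reflect (y t))) - bbm_field t (y t) (clip R (y t)))
       \<le> (1 + 2 * C * (2 * R + 2 * Z) + (2 * C * Z * R + D)) * norm (reflect (y t) - y t)" for t
      using clipped_field_lipschitz[OF R, of t "reflect (y t)" t "y t"] by simp
  qed (use d in auto)
  then show ?thesis by (metis hermitian_iff unemb_reflect)
qed

lemma unemb_has_derivative:
  assumes "(y has_vector_derivative bbm_field t (y t) k) (at t)"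
  shows "((\<lambda>t. unemb s (y t) n) has_vector_derivative field_seq t (y t) k n) (at t)"
proof -
  have "bounded_linear (\<lambda>y. unemb s y n)"
    unfolding unemb_def by (intro bounded_linear_const_mult bounded_linear_coeff)
  from bounded_linear.has_vector_derivative[OF this assms] show ?thesis
    by (simp add: unemb_bbm_field)
qed

end

section \<open>Sharp frequency cutoffs\<close>

definition lo :: "nat \<Rightarrow> (int \<Rightarrow> complex) \<Rightarrow> int \<Rightarrow> complex" where
  "lo N a = (\<lambda>n. if \<bar>n\<bar> \<le> int N then a n else 0)"

definition hi :: "nat \<Rightarrow> (int \<Rightarrow> complex) \<Rightarrow> int \<Rightarrow> complex" where
  "hi N a = (\<lambda>n. if \<bar>n\<bar> \<le> int N then 0 else a n)"

definition Hi :: "nat \<Rightarrow> ell2 \<Rightarrow> ell2" where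
  "Hi N y = Abs_ell2 (hi N (coeff y))"

lemma lo_plus_hi: "lo N a n + hi N a n = a n"
  by (simp add: lo_def hi_def)

lemma coeff_Hi: "coeff (Hi N y) = hi N (coeff y)"
  unfolding Hi_def
  by (subst Abs_ell2_inverse)
    (auto simp: hi_def intro!: sq_summable_triangle(1)[OF coeff_sq_summable[of y] coeff_sq_summable[of y]])

lemma unemb_Hi: "unemb s (Hi N y) = hi N (unemb s y)"
  by (auto simp: unemb_def coeff_Hi hi_def)

lemma bounded_linear_Hi: "bounded_linear (Hi N)"
proof (rule bounded_linear_intro[where K = 1])
  show "Hi N (x + y) = Hi N x + Hi N y" for x y
    by (rule ell2_eqI) (simp add: coeff_Hi hi_def)
  show "Hi N (r *\<^sub>R x) = r *\<^sub>R Hi N x" for r x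
    by (rule ell2_eqI) (simp add: coeff_Hi hi_def)
  show "norm (Hi N x) \<le> norm x * 1" for x
  proof -
    have "L2_set (\<lambda>n. cmod (coeff (Hi N x) n)) F \<le> norm x" if "finite F" for F
    proof -
      have "L2_set (\<lambda>n. cmod (coeff (Hi N x) n)) F \<le> L2_set (\<lambda>n. cmod (coeff x n)) F"
        by (rule L2_set_mono) (auto simp: coeff_Hi hi_def)
      with L2_set_coeff_le_norm[OF that, of x] show ?thesis by linarith
    qed
    then show ?thesis using norm_ell2_le by simp
  qed
qed

lemma hi_sobolev:
  assumes "a \<in> sobolev s"
  shows "hi N a \<in> sobolev s" "sobolev_norm s (hi N a) \<le> sobolev_norm s a"
  by (rule sobolev_dominated[OF assms, of 1, simplified], simp add: hi_def)+

lemma lo_sobolev: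
  shows "lo N a \<in> sobolev r"
    and "sobolev_norm r (lo N a) \<le> L2_set (\<lambda>n. jbracket n powr r * cmod (a n)) {- int N..int N}"
proof -
  have "L2_set (\<lambda>n. jbracket n powr r * cmod (lo N a n)) F 
     \<le> L2_set (\<lambda>n. jbracket n powr r * cmod (a n)) {- int N..int N}" if F: "finite F" for F
    unfolding L2_set_def
  proof (rule real_sqrt_le_mono)
    have "(\<Sum>n\<in>F. (jbracket n powr r * cmod (lo N a n))\<^sup>2) 
        = (\<Sum>n\<in>F \<inter> {- int N..int N}. (jbracket n powr r * cmod (a n))\<^sup>2)"
      by (rule sum.mono_neutral_cong_right) (use F in \<open>auto simp: lo_def\<close>)
    also have "\<dots> \<le> (\<Sum>n\<in>{- int N..int N}. (jbracket n powr r * cmod (a n))\<^sup>2)"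
      by (rule sum_mono2) auto
    finally show "(\<Sum>n\<in>F. (jbracket n powr r * cmod (lo N a n))\<^sup>2)
        \<le> (\<Sum>n\<in>{- int N..int N}. (jbracket n powr r * cmod (a n))\<^sup>2)" .
  qed
  then show "lo N a \<in> sobolev r"
    and "sobolev_norm r (lo N a) \<le> L2_set (\<lambda>n. jbracket n powr r * cmod (a n)) {- int N..int N}"
    using sobolevI[where a = "lo N a" and s = r 
        and B = "L2_set (\<lambda>n. jbracket n powr r * cmod (a n)) {- int N..int N}"] by blast+
qed

text \<open>The output and the second factor have frequencies at most \<open>N\<close>, so only frequencies
  up to \<open>2 * N\<close> of the first factor contribute.\<close>

lemma fprod_lo:
  assumes "\<bar>n\<bar> \<le> int N"
  shows "fprod a (lo N b) n = fprod (lo (2 * N) a) (lo N b) n"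
  unfolding fprod_def by (rule infsum_cong) (use assms in \<open>auto simp: lo_def\<close>)

text \<open>At frequencies up to \<open>N\<close> a negative Sobolev norm controls the \<open>L\<^sup>2\<close> norm, at the price of a
  small power of \<open>N\<close>.\<close>

lemma low_frequency_bound:
  assumes a: "a \<in> sobolev (- e)" and e: "0 \<le> e" "e \<le> 1" and N: "1 \<le> N"
  shows "L2_set (\<lambda>n. cmod (a n)) {- int N..int N} \<le> 2 * real N powr e * sobolev_norm (- e) a"
proof -
  have "L2_set (\<lambda>n. cmod (a n)) {- int N..int N} 
     \<le> L2_set (\<lambda>n. (2 * real N powr e) * (jbracket n powr (- e) * cmod (a n))) {- int N..int N}"
  proof (rule L2_set_mono)
    fix n assume n: "n \<in> {- int N..int N}"
    have "jbracket n \<le> 2 * real N" using jbracket_le[of n] n N by auto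
    then have "jbracket n powr e \<le> (2 * real N) powr e"
      using e by (intro powr_mono2) (auto simp: less_imp_le)
    also have "\<dots> = 2 powr e * real N powr e" by (simp add: powr_mult)
    also have "\<dots> \<le> 2 * real N powr e" using e powr_mono[of e 1 2] by (intro mult_right_mono) auto
    finally have "jbracket n powr e * (jbracket n powr (- e) * cmod (a n)) 
        \<le> (2 * real N powr e) * (jbracket n powr (- e) * cmod (a n))"
      by (intro mult_right_mono) auto
    then show "cmod (a n) \<le> (2 * real N powr e) * (jbracket n powr (- e) * cmod (a n))"
      by (simp add: mult.assoc[symmetric] powr_add[symmetric])
  qed auto
  also have "\<dots> = (2 * real N powr e) * L2_set (\<lambda>n. jbracket n powr (- e) * cmod (a n)) {- int N..int N}"
    by (rule L2_set_right_distrib[symmetric]) simp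
  also have "\<dots> \<le> (2 * real N powr e) * sobolev_norm (- e) a"
    by (intro mult_left_mono L2_set_le_sobolev_norm a) auto
  finally show ?thesis .
qed

text \<open>This is the identity that the integral of \<open>w\<^sup>2\<close> times the derivative of \<open>w\<close> vanishes. On the
  Fourier side it follows by symmetrising over the three frequencies, which sum to zero.\<close>

lemma energy_cancellation:
  assumes v: "hermitian v"
  shows "(\<Sum>n\<in>{- int N..int N}. of_int n * cnj (v n) * fprod (lo N v) (lo N v) n) = 0"
proof -
  define w where "w = lo N v"
  define I where "I = {- int N..int N}"
  have w0: "w n = 0" if "n \<notin> I" for n using that by (auto simp: w_def lo_def I_def)
  have wv: "cnj (v n) = w (- n)" if "n \<in> I" for n
    using that v by (auto simp: w_def lo_def I_def hermitian_def)
  have fp: "fprod w w n = (\<Sum>k\<in>I. w k * w (n - k))" for n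
  proof -
    have "fprod w w n = (\<Sum>\<^sub>\<infinity>k\<in>I. w k * w (n - k))"
      unfolding fprod_def by (rule infsum_cong_neutral) (auto simp: w0)
    then show ?thesis by (simp add: I_def)
  qed
  define F where "F = (\<lambda>(a, b). w a * w b * w (- a - b))"
  define P where "P = {p \<in> I \<times> I. - fst p - snd p \<in> I}"
  define S1 where "S1 = (\<Sum>p\<in>P. of_int (fst p) * F p)"
  have finP: "finite P" by (simp add: P_def I_def)
  have "(\<Sum>n\<in>I. of_int n * cnj (v n) * fprod w w n) = (\<Sum>n\<in>I. \<Sum>k\<in>I. of_int n * (w (- n) * w k * w (n - k)))"
    by (rule sum.cong) (auto simp: wv fp sum_distrib_left mult_ac)
  also have "\<dots> = (\<Sum>a\<in>I. \<Sum>k\<in>I. - of_int a * (w a * w k * w (- a - k)))"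
    by (rule sum.reindex_bij_witness[of _ uminus uminus]) (auto simp: I_def)
  also have "\<dots> = (\<Sum>p\<in>I \<times> I. - of_int (fst p) * F p)"
    by (simp add: sum.cartesian_product F_def case_prod_unfold)
  also have "\<dots> = (\<Sum>p\<in>P. - of_int (fst p) * F p)"
  proof (rule sum.mono_neutral_right)
    show "\<forall>p\<in>I \<times> I - P. - of_int (fst p) * F p = 0"
      using w0 by (fastforce simp: P_def F_def)
  qed (auto simp: P_def I_def)
  also have "\<dots> = - S1" by (simp add: S1_def sum_negf)
  finally have T: "(\<Sum>n\<in>I. of_int n * cnj (v n) * fprod w w n) = - S1" .
  have swap: "S1 = (\<Sum>p\<in>P. of_int (snd p) * F p)"
    unfolding S1_def
    by (rule sum.reindex_bij_witness[of _ prod.swap prod.swap])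
      (auto simp: P_def F_def mult_ac minus_diff_commute)
  have "S1 = (\<Sum>p\<in>P. of_int (- fst p - snd p) * F p)"
    unfolding S1_def
    by (rule sum.reindex_bij_witness[of _ "\<lambda>(a, b). (- a - b, b)" "\<lambda>(a, b). (- a - b, b)"])
      (auto simp: P_def F_def algebra_simps)
  also have "\<dots> = (\<Sum>p\<in>P. - (of_int (fst p) * F p) - of_int (snd p) * F p)"
    by (rule sum.cong) (auto simp: algebra_simps)
  also have "\<dots> = - S1 - S1"
    unfolding sum_subtractf sum_negf using swap by (simp add: S1_def)
  finally have "3 * S1 = 0" by (simp add: algebra_simps)
  then show ?thesis using T by (simp add: w_def I_def)
qed

section \<open>The global bound\<close>

lemma eventually_powr_gt:
  fixes a c :: real
  assumes "0 < a"
  shows "\<forall>\<^sub>F N in sequentially. c < real N powr a"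
proof (rule eventually_sequentiallyI)
  let ?m = "max c 1 powr (1 / a)"
  fix N assume "nat \<lceil>?m\<rceil> + 1 \<le> N"
  then have "?m < real N" by linarith
  then have "?m powr a < real N powr a" using assms by (intro powr_less_mono2) auto
  then show "c < real N powr a" using assms by (simp add: powr_powr)
qed

lemma has_derivative_cmod_sq:
  assumes "(v has_vector_derivative v') (at t)"
  shows "((\<lambda>t. (cmod (v t))\<^sup>2) has_real_derivative 2 * Re (cnj (v t) * v')) (at t)"
proof -
  have "((\<lambda>t. Re (v t)) has_real_derivative Re v') (at t)" "((\<lambda>t. Im (v t)) has_real_derivative Im v') (at t)"
    using bounded_linear.has_vector_derivative[OF bounded_linear_Re assms]
      bounded_linear.has_vector_derivative[OF bounded_linear_Im assms]
    by (simp_all add: has_real_derivative_iff_has_vector_derivative)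
  then show ?thesis
    using DERIV_add[OF DERIV_power[of "\<lambda>t. Re (v t)" "Re v'" t UNIV 2] DERIV_power[of "\<lambda>t. Im (v t)" "Im v'" t UNIV 2]]
    unfolding cmod_power2 by (simp add: algebra_simps)
qed

context bbm_data
begin

text \<open>The energy norm, that is the \<open>H\<^sup>1\<close> norm, of the part at frequencies up to \<open>N\<close>. The full \<open>H\<^sup>1\<close> norm
  is conserved by the equation for smooth data, but the remainder only has regularity below 1.\<close>

definition low_norm :: "nat \<Rightarrow> ell2 \<Rightarrow> real" where
  "low_norm N y = L2_set (\<lambda>n. jbracket n * cmod (unemb s y n)) {- int N..int N}"

definition C1 :: real where "C1 = prod_const 0 1"

lemma C1_nonneg: "0 \<le> C1" by (simp add: C1_def)

lemma low_norm_nonneg: "0 \<le> low_norm N y" by (simp add: low_norm_def)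

lemma lo_norms:
  shows "sobolev_norm s (lo N (unemb s y)) \<le> low_norm N y"
    and "sobolev_norm 1 (lo N (unemb s y)) \<le> low_norm N y"
proof -
  have le: "L2_set (\<lambda>n. jbracket n powr r * cmod (unemb s y n)) {- int N..int N} \<le> low_norm N y" if "r \<le> 1" for r
  proof -
    have "jbracket n powr r \<le> jbracket n" for n
      using powr_mono[OF that jbracket_ge_1[of n]] less_imp_le[OF jbracket_pos[of n]] by simp
    then show ?thesis unfolding low_norm_def by (intro L2_set_mono mult_right_mono) auto
  qed
  show "sobolev_norm s (lo N (unemb s y)) \<le> low_norm N y" "sobolev_norm 1 (lo N (unemb s y)) \<le> low_norm N y"
    using order.trans[OF lo_sobolev(2) le[of s]] order.trans[OF lo_sobolev(2) le[of 1]] s_bounds by auto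
qed

lemma norm_Hi: "norm (Hi N y) = sobolev_norm s (hi N (unemb s y))"
  by (metis sobolev_norm_unemb unemb_Hi)

lemma norm_split: "norm y \<le> low_norm N y + norm (Hi N y)"
proof -
  have "norm y = sobolev_norm s (\<lambda>n. lo N (unemb s y) n + hi N (unemb s y) n)"
    by (simp add: lo_plus_hi)
  also have "\<dots> \<le> sobolev_norm s (lo N (unemb s y)) + sobolev_norm s (hi N (unemb s y))"
    by (intro sobolev_add(3) lo_sobolev hi_sobolev unemb_sobolev)
  also have "\<dots> \<le> low_norm N y + norm (Hi N y)" using lo_norms(1) by (simp add: norm_Hi)
  finally show ?thesis .
qed

text \<open>By \<open>energy_derivative\<close> below, the sum on the left governs the growth of the energy of the low
  frequency part \<open>w\<close>. The product of \<open>w\<close> with itself does not contribute, by \<open>energy_cancellation\<close>.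
  Every remaining term contains the high frequency part \<open>h\<close>, or is \<open>q\<close>, or is the product of \<open>w\<close> with
  the data. For the last one the data matter only up to frequency \<open>2 * N\<close>, where their \<open>L\<^sup>2\<close> norm is at
  most \<open>A\<close>; this avoids the loss of a power of \<open>N\<close> in the only term that is quadratic in \<open>X\<close> alone.\<close>

lemma energy_flux_bound:
  assumes herm: "hermitian (unemb s y)" and \<theta>: "0 \<le> \<theta>" "\<theta> \<le> 1" and N: "1 \<le> N"
    and A: "L2_set (\<lambda>n. cmod (z n)) {- int (2 * N)..int (2 * N)} \<le> A"
  defines "X \<equiv> low_norm N y" and "Y \<equiv> norm (Hi N y)"
  shows "cmod (\<Sum>n\<in>{- int N..int N}. of_int n * cnj (unemb s y n) * inner t (unemb s (\<theta> *\<^sub>R y)) n)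
    \<le> X * (2 * real N powr e * (C * (2 * X + Y) * Y + 2 * C * Z * Y + sobolev_norm (- e) (q t)) + 2 * (C1 * A * X))"
proof -
  define v w h where "v = unemb s y" and "w = lo N v" and "h = hi N v"
  define I where "I = {- int N..int N}"
  have X0: "0 \<le> X" and Y0: "0 \<le> Y" by (auto simp: X_def Y_def low_norm_nonneg)
  have v: "v \<in> sobolev s" "v \<in> sobolev (- e)" "sobolev_norm (- e) v \<le> X + Y"
    using sobolev_s_subset[of v] norm_split[of y N] by (auto simp: v_def X_def Y_def)
  have w: "w \<in> sobolev s" "w \<in> sobolev (- e)" "sobolev_norm (- e) w \<le> X" "sobolev_norm 1 w \<le> X"
    using sobolev_s_subset[of w] lo_norms[of N y] lo_sobolev(1)[of N v] by (auto simp: w_def v_def X_def)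
  have h: "h \<in> sobolev s" "sobolev_norm s h = Y"
    using hi_sobolev(1)[of v s N] v by (auto simp: h_def Y_def norm_Hi v_def)
  have hvw: "h = (\<lambda>n. v n - w n)" by (auto simp: h_def w_def hi_def lo_def)
  define a1 where "a1 = (\<lambda>n. (of_real (\<theta>\<^sup>2) * (fprod v h n + fprod w h n) + of_real (2 * \<theta>) * fprod (zt t) h n) + q t n)"
  define a2 where "a2 = (\<lambda>n. of_real (2 * \<theta>) * fprod (zt t) w n)"
  \<comment> \<open>\<open>a1\<close> collects the terms with the high frequency part and \<open>q\<close>, and \<open>a2\<close> is the product of
    the data with the low frequency part.\<close>
  have split: "inner t (unemb s (\<theta> *\<^sub>R y)) n = of_real (\<theta>\<^sup>2) * fprod w w n + (a1 n + a2 n)" for n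
  proof -
    have e1: "unemb s (\<theta> *\<^sub>R y) = (\<lambda>n. of_real \<theta> * v n)" by (auto simp: v_def unemb_scaleR)
    have "fprod v v n - fprod w w n = fprod v h n + fprod w h n"
      unfolding hvw using fprod_diff_right[OF v(2) v(1) w(1), of n] fprod_diff_right[OF w(2) v(1) w(1), of n]
      by (simp add: fprod_commute[of w v])
    moreover have "fprod (zt t) v n = fprod (zt t) h n + fprod (zt t) w n"
      unfolding hvw using fprod_diff_right[OF zt(1) v(1) w(1), of t n] by simp
    ultimately show ?thesis
      unfolding inner_def e1 fprod_cmult a1_def a2_def
      by (simp add: power2_eq_square algebra_simps)
  qed
  have zeroI: "(\<Sum>n\<in>I. of_int n * cnj (v n) * (of_real (\<theta>\<^sup>2) * fprod w w n)) = 0"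
  proof -
    have "(\<Sum>n\<in>I. of_int n * cnj (v n) * (of_real (\<theta>\<^sup>2) * fprod w w n)) 
        = of_real (\<theta>\<^sup>2) * (\<Sum>n\<in>I. of_int n * cnj (v n) * fprod w w n)"
      by (simp add: sum_distrib_left mult_ac)
    then show ?thesis using energy_cancellation[of v N] herm by (simp add: v_def w_def I_def)
  qed
  have m1: "fprod v h \<in> sobolev (- e)" "fprod w h \<in> sobolev (- e)" "fprod (zt t) h \<in> sobolev (- e)"
    using fprod_s(2) v w h zt by blast+
  have a1: "a1 \<in> sobolev (- e)" unfolding a1_def
    by (intro sobolev_add sobolev_cmult m1 q)
  have "sobolev_norm (- e) a1 \<le> (cmod (of_real (\<theta>\<^sup>2)) * (C * (X + Y) * Y + C * X * Y) 
      + cmod (of_real (2 * \<theta>)) * (C * Z * Y)) + sobolev_norm (- e) (q t)"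
  proof -
    have "sobolev_norm (- e) (fprod v h) \<le> C * (X + Y) * Y"
      using fprod_s(3)[OF v(2) h(1)] mult_right_mono[OF mult_left_mono[OF v(3) C_nonneg] Y0] h(2) by simp
    moreover have "sobolev_norm (- e) (fprod w h) \<le> C * X * Y"
      using fprod_s(3)[OF w(2) h(1)] mult_right_mono[OF mult_left_mono[OF w(3) C_nonneg] Y0] h(2) by simp
    moreover have "sobolev_norm (- e) (fprod (zt t) h) \<le> C * Z * Y"
      using fprod_s(3)[OF zt(1) h(1), of t] mult_right_mono[OF mult_left_mono[OF zt(2)[of t] C_nonneg] Y0] h(2) by simp
    ultimately show ?thesis
      unfolding a1_def
      by (intro order.trans[OF sobolev_add(3)] order.trans[OF sobolev_cmult(2)] add_mono mult_left_mono
          sobolev_add(1) sobolev_cmult(1) m1 q order.refl norm_ge_zero)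
  qed
  also have "\<dots> \<le> (1 * (C * (X + Y) * Y + C * X * Y) + 2 * (C * Z * Y)) + sobolev_norm (- e) (q t)"
    using \<theta> X0 Y0 by (intro add_mono mult_right_mono order.refl) (auto simp: power_le_one norm_mult norm_power)
  also have "\<dots> = C * (2 * X + Y) * Y + 2 * C * Z * Y + sobolev_norm (- e) (q t)"
    by (simp add: algebra_simps)
  finally have a1n: "sobolev_norm (- e) a1 \<le> C * (2 * X + Y) * Y + 2 * C * Z * Y + sobolev_norm (- e) (q t)" .
  have a1L: "L2_set (\<lambda>n. cmod (a1 n)) I 
     \<le> 2 * real N powr e * (C * (2 * X + Y) * Y + 2 * C * Z * Y + sobolev_norm (- e) (q t))"
  proof -
    have "L2_set (\<lambda>n. cmod (a1 n)) I \<le> 2 * real N powr e * sobolev_norm (- e) a1"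
      unfolding I_def using e_pos e_le N by (intro low_frequency_bound a1) auto
    also have "\<dots> \<le> 2 * real N powr e * (C * (2 * X + Y) * Y + 2 * C * Z * Y + sobolev_norm (- e) (q t))"
      by (intro mult_left_mono a1n) auto
    finally show ?thesis .
  qed
  have a2L: "L2_set (\<lambda>n. cmod (a2 n)) I \<le> 2 * (C1 * A * X)"
  proof -
    have zl: "lo (2 * N) (zt t) \<in> sobolev (- 0)" "sobolev_norm (- 0) (lo (2 * N) (zt t)) \<le> A"
    proof -
      show "lo (2 * N) (zt t) \<in> sobolev (- 0)" by (rule lo_sobolev)
      have "cmod (zt t n) = cmod (z n)" for n
        using norm_exp_i_times[of "- (t * phi n)"] by (simp add: zt_def S_prop_def norm_mult mult.assoc)
      then have "sobolev_norm 0 (lo (2 * N) (zt t)) \<le> L2_set (\<lambda>n. cmod (z n)) {- int (2 * N)..int (2 * N)}"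
        using lo_sobolev(2)[of 0 "2 * N" "zt t"] by simp
      then show "sobolev_norm (- 0) (lo (2 * N) (zt t)) \<le> A" using A by simp
    qed
    have w1: "w \<in> sobolev 1" unfolding w_def by (rule lo_sobolev)
    have A0: "0 \<le> A" using zl(2) sobolev_norm_nonneg order.trans by blast
    note f = fprod_sobolev[of 0 1, OF _ _ zl(1) w1]
    have "L2_set (\<lambda>n. cmod (a2 n)) I \<le> L2_set (\<lambda>n. 2 * cmod (fprod (lo (2 * N) (zt t)) w n)) I"
    proof (rule L2_set_mono)
      fix n assume "n \<in> I"
      then have "fprod (zt t) w n = fprod (lo (2 * N) (zt t)) w n"
        unfolding w_def by (intro fprod_lo) (auto simp: I_def)
      then show "cmod (a2 n) \<le> 2 * cmod (fprod (lo (2 * N) (zt t)) w n)"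
        using \<theta> by (simp add: a2_def norm_mult mult_right_mono)
    qed auto
    also have "\<dots> = 2 * L2_set (\<lambda>n. cmod (fprod (lo (2 * N) (zt t)) w n)) I"
      by (rule L2_set_right_distrib[symmetric]) simp
    also have "L2_set (\<lambda>n. cmod (fprod (lo (2 * N) (zt t)) w n)) I \<le> sobolev_norm (- 0) (fprod (lo (2 * N) (zt t)) w)"
      using L2_set_le_sobolev_norm[of "fprod (lo (2 * N) (zt t)) w" "- 0" I] f by (simp add: I_def)
    also have "\<dots> \<le> C1 * sobolev_norm (- 0) (lo (2 * N) (zt t)) * sobolev_norm 1 w"
      using f(3) by (simp add: C1_def)
    also have "\<dots> \<le> C1 * A * X"
      using zl(2) w(4) C1_nonneg A0 by (intro mult_mono mult_nonneg_nonneg) auto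
    finally show ?thesis by simp
  qed
  have "cmod (\<Sum>n\<in>I. of_int n * cnj (v n) * inner t (unemb s (\<theta> *\<^sub>R y)) n)
      = cmod (\<Sum>n\<in>I. of_int n * cnj (v n) * (a1 n + a2 n))"
    unfolding split using zeroI by (simp add: distrib_left sum.distrib)
  also have "\<dots> \<le> (\<Sum>n\<in>I. \<bar>jbracket n * cmod (v n)\<bar> * \<bar>cmod (a1 n) + cmod (a2 n)\<bar>)"
  proof (rule sum_norm_le)
    fix n
    have "cmod (of_int n * cnj (v n) * (a1 n + a2 n)) = (\<bar>real_of_int n\<bar> * cmod (v n)) * cmod (a1 n + a2 n)"
      by (simp add: norm_mult)
    also have "\<dots> \<le> (jbracket n * cmod (v n)) * (cmod (a1 n) + cmod (a2 n))"
      by (intro mult_mono abs_le_jbracket norm_triangle_ineq mult_nonneg_nonneg) (auto simp: less_imp_le)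
    finally show "cmod (of_int n * cnj (v n) * (a1 n + a2 n)) 
        \<le> \<bar>jbracket n * cmod (v n)\<bar> * \<bar>cmod (a1 n) + cmod (a2 n)\<bar>"
      using less_imp_le[OF jbracket_pos[of n]] by (simp add: abs_mult)
  qed
  also have "\<dots> \<le> L2_set (\<lambda>n. jbracket n * cmod (v n)) I * L2_set (\<lambda>n. cmod (a1 n) + cmod (a2 n)) I"
    by (rule L2_set_mult_ineq)
  also have "\<dots> \<le> X * (L2_set (\<lambda>n. cmod (a1 n)) I + L2_set (\<lambda>n. cmod (a2 n)) I)"
    using X0 by (auto simp: X_def low_norm_def v_def I_def intro!: mult_left_mono L2_set_triangle_ineq)
  also have "\<dots> \<le> X * (2 * real N powr e * (C * (2 * X + Y) * Y + 2 * C * Z * Y + sobolev_norm (- e) (q t)) + 2 * (C1 * A * X))"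
    by (intro mult_left_mono add_mono a1L a2L X0)
  finally show ?thesis by (simp add: v_def I_def)
qed

lemma energy_derivative:
  assumes "(y has_vector_derivative bbm_field t (y t) k) (at t)"
  shows "((\<lambda>t. (low_norm N (y t))\<^sup>2) has_real_derivative 
    Re (- \<i> * (\<Sum>n\<in>{- int N..int N}. of_int n * cnj (unemb s (y t) n) * inner t (unemb s k) n))) (at t)"
proof -
  have sq: "(low_norm N x)\<^sup>2 = (\<Sum>n\<in>{- int N..int N}. (jbracket n)\<^sup>2 * (cmod (unemb s x n))\<^sup>2)" for x
    unfolding low_norm_def L2_set_def by (simp add: sum_nonneg power_mult_distrib)
  have "((\<lambda>t. (jbracket n)\<^sup>2 * (cmod (unemb s (y t) n))\<^sup>2) has_real_derivative
      Re (- \<i> * (of_int n * cnj (unemb s (y t) n) * inner t (unemb s k) n))) (at t)" for n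
  proof -
    have "(jbracket n)\<^sup>2 * (2 * Re (cnj (unemb s (y t) n) * field_seq t (y t) k n)) 
        = Re (- \<i> * (of_real (phi n * (jbracket n)\<^sup>2) * cnj (unemb s (y t) n) * inner t (unemb s k) n))"
      by (simp add: field_seq_def field_simps)
    also have "\<dots> = Re (- \<i> * (of_int n * cnj (unemb s (y t) n) * inner t (unemb s k) n))"
      by (simp only: phi_jbracket of_real_of_int_eq)
    finally show ?thesis
      using DERIV_cmult[OF has_derivative_cmod_sq[OF unemb_has_derivative[OF assms, of n]], of "(jbracket n)\<^sup>2"]
      by simp
  qed
  then have "((\<lambda>t. \<Sum>n\<in>{- int N..int N}. (jbracket n)\<^sup>2 * (cmod (unemb s (y t) n))\<^sup>2) has_real_derivative 
    (\<Sum>n\<in>{- int N..int N}. Re (- \<i> * (of_int n * cnj (unemb s (y t) n) * inner t (unemb s k) n)))) (at t)"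
    by (intro DERIV_sum)
  then show ?thesis unfolding sq by (simp only: sum_distrib_left Re_sum)
qed

text \<open>Above frequency \<open>N\<close> the difference between the regularity \<open>1 - e\<close> of the vector field and
  \<open>1 - 8 * e\<close>, at which it is measured, becomes a negative power of \<open>N\<close>.\<close>

lemma high_field_bound:
  assumes N: "1 \<le> N" and \<theta>: "0 \<le> \<theta>" "\<theta> \<le> 1"
  shows "norm (Hi N (bbm_field t y (\<theta> *\<^sub>R y)))
    \<le> real N powr (- (7 * e)) * (norm y + (C * (norm y)\<^sup>2 + 2 * C * Z * norm y + sobolev_norm (- e) (q t)))"
proof -
  let ?k = "unemb s (\<theta> *\<^sub>R y)"
  let ?a = "\<lambda>n. unemb s y n + 1 / 2 * inner t ?k n"
  have k: "?k \<in> sobolev s" "sobolev_norm s ?k \<le> norm y"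
    using \<theta> mult_right_mono[of \<theta> 1 "norm y"] by (auto simp: norm_scaleR)
  note k' = k sobolev_s_subset[OF k(1)]
  have i: "sobolev_norm (- e) (inner t ?k) \<le> C * (norm y)\<^sup>2 + 2 * C * Z * norm y + sobolev_norm (- e) (q t)"
  proof -
    have "sobolev_norm (- e) (fprod ?k ?k) \<le> C * norm y * norm y"
      by (rule order.trans[OF fprod_s(3)[OF k'(3) k'(1)]]) (use k'(2,4) in \<open>auto intro!: mult_mono\<close>)
    moreover have "sobolev_norm (- e) (fprod (zt t) ?k) \<le> C * Z * norm y"
      by (rule order.trans[OF fprod_s(3)[OF zt(1) k'(1)]]) (use k'(2) zt(2) in \<open>auto intro!: mult_mono\<close>)
    then have "sobolev_norm (- e) (\<lambda>n. 2 * fprod (zt t) ?k n) \<le> 2 * (C * Z * norm y)"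
      using sobolev_cmult(2)[OF fprod_s(2)[OF zt(1) k'(1)], of 2 t] by simp
    ultimately have "sobolev_norm (- e) (inner t ?k) \<le> (C * norm y * norm y + 2 * (C * Z * norm y)) + sobolev_norm (- e) (q t)"
      unfolding inner_def
      by (intro order.trans[OF sobolev_add(3)] add_mono sobolev_add(1) sobolev_cmult(1) fprod_s(2) k' zt q order.refl)
    then show ?thesis by (simp add: power2_eq_square mult_ac)
  qed
  have a: "?a \<in> sobolev (- e)" by (rule field_arg_sobolev)
  have an: "sobolev_norm (- e) ?a \<le> norm y + (C * (norm y)\<^sup>2 + 2 * C * Z * norm y + sobolev_norm (- e) (q t))"
  proof -
    have "sobolev_norm (- e) ?a \<le> sobolev_norm (- e) (unemb s y) + sobolev_norm (- e) (\<lambda>n. 1 / 2 * inner t ?k n)"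
      by (intro sobolev_add(3) sobolev_s_subset unemb_sobolev sobolev_cmult inner_sobolev)
    moreover have "sobolev_norm (- e) (unemb s y) \<le> norm y"
      using sobolev_s_subset(2)[OF unemb_sobolev[of s y]] by simp
    moreover have "sobolev_norm (- e) (\<lambda>n. 1 / 2 * inner t ?k n) \<le> 1 / 2 * sobolev_norm (- e) (inner t ?k)"
      using sobolev_cmult(2)[OF inner_sobolev[OF k(1)], of "1/2" t] by simp
    moreover have "0 \<le> sobolev_norm (- e) (inner t ?k)" by simp
    ultimately show ?thesis using i by linarith
  qed
  have "norm (Hi N (bbm_field t y (\<theta> *\<^sub>R y))) = sobolev_norm s (hi N (field_seq t y (\<theta> *\<^sub>R y)))"
    by (simp add: norm_Hi unemb_bbm_field)
  also have "\<dots> \<le> real N powr (- (7 * e)) * sobolev_norm (- e) ?a"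
  proof (rule sobolev_dominated(2)[OF a])
    fix n
    show "jbracket n powr s * cmod (hi N (field_seq t y (\<theta> *\<^sub>R y)) n) 
        \<le> real N powr (- (7 * e)) * (jbracket n powr (- e) * cmod (?a n))"
    proof (cases "\<bar>n\<bar> \<le> int N")
      case False
      have "jbracket n powr s * \<bar>phi n\<bar> \<le> jbracket n powr s * jbracket n powr (- 1)"
        using abs_phi_le[of n] less_imp_le[OF jbracket_pos[of n]]
        by (intro mult_left_mono) (auto simp: powr_minus divide_inverse)
      also have "\<dots> = jbracket n powr (- (7 * e)) * jbracket n powr (- e)"
        unfolding powr_add[symmetric] by (simp add: s_def)
      also have "\<dots> \<le> real N powr (- (7 * e)) * jbracket n powr (- e)"
        using abs_le_jbracket[of n] False N e_pos by (intro mult_right_mono powr_mono2') auto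
      finally have "jbracket n powr s * \<bar>phi n\<bar> * cmod (?a n) \<le> real N powr (- (7 * e)) * jbracket n powr (- e) * cmod (?a n)"
        by (rule mult_right_mono) simp
      then show ?thesis using False by (simp add: hi_def field_seq_def norm_mult mult.assoc)
    qed (simp add: hi_def)
  qed simp
  also have "\<dots> \<le> real N powr (- (7 * e)) * (norm y + (C * (norm y)\<^sup>2 + 2 * C * Z * norm y + sobolev_norm (- e) (q t)))"
    by (intro mult_left_mono an) auto
  finally show ?thesis .
qed

end

context bbm_data
begin

lemma q_norm_bound: 
  assumes "\<bar>t\<bar> \<le> T"
  shows "sobolev_norm (- e) (q t) \<le> sobolev_norm (- e) (q 0) + D * T"
proof -
  have "sobolev_norm (- e) (q t) = sobolev_norm (- e) (\<lambda>n. q 0 n + (q t n - q 0 n))" by simp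
  also have "\<dots> \<le> sobolev_norm (- e) (q 0) + sobolev_norm (- e) (\<lambda>n. q t n - q 0 n)"
    by (intro sobolev_add(3) sobolev_diff(1) q)
  also have "\<dots> \<le> sobolev_norm (- e) (q 0) + D * \<bar>t - 0\<bar>"
    by (intro add_left_mono q_lipschitz)
  also have "\<dots> \<le> sobolev_norm (- e) (q 0) + D * T"
    using assms D_nonneg by (intro add_left_mono mult_left_mono) auto
  finally show ?thesis .
qed

text \<open>Up to time \<open>T\<close>, and for \<open>N\<close> large depending on \<open>T\<close>, a bootstrap shows that the low frequency
  part stays below \<open>N powr (2 * e)\<close> in the energy norm, and the high frequency part below
  \<open>N powr (- 2 * e)\<close> in \<open>sobolev s\<close>. The high part starts from zero and gains \<open>N powr (- 7 * e)\<close> by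
  \<open>high_field_bound\<close>, which beats the size \<open>N powr (4 * e)\<close> of its quadratic forcing. For the low part,
  the smallness of the high part limits their interaction to a flux of energy of order
  \<open>N powr (3 * e)\<close>; the interaction with the data costs a factor \<open>exp (2 * C1 * A * T)\<close>, where \<open>A\<close> is
  sublogarithmic in \<open>N\<close>, hence at most \<open>N powr (e / 2)\<close>. The bound does not see the truncation parameter \<open>R\<close>,
  since truncation only multiplies the argument of the nonlinearity by a scalar in the unit
  interval.\<close>

lemma a_priori_bound:
  assumes T: "0 < T"
  shows "\<exists>K\<ge>0. \<forall>R y t. 0 \<le> R \<longrightarrow> clipped_solution R y \<longrightarrow> \<bar>t\<bar> \<le> T \<longrightarrow> norm (y t) \<le> K"
proof -
  define QT where "QT = sobolev_norm (- e) (q 0) + D * T"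
  have QT0: "0 \<le> QT" using D_nonneg T by (simp add: QT_def)
  define K1 where "K1 = 3 * C + 2 * C * Z + QT"
  define K2 where "K2 = 2 + 4 * C + 4 * C * Z + QT"
  have K0: "0 \<le> K1" "0 \<le> K2" using QT0 by (auto simp: K1_def K2_def)
  \<comment> \<open>\<open>K1\<close> bounds the flux through the high part and \<open>q\<close>, and \<open>K2\<close> the forcing of the high part, after
    the powers of \<open>N\<close> have been taken out. The rate \<open>\<eta>\<close> is chosen for \<open>expA\<close> below.\<close>
  define \<eta> where "\<eta> = e / (8 * (C1 * T + 1))"
  have CT: "0 \<le> C1 * T" using C1_nonneg T by simp
  then have \<eta>: "0 < \<eta>" using e_pos by (simp add: \<eta>_def)
  obtain N where N: "2 \<le> N"
    and NA: "L2_set (\<lambda>n. cmod (z n)) {- int (2 * N)..int (2 * N)} \<le> \<eta> * ln (real (2 * N))"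
    and N1: "2 * K1 * T < real N powr (e / 2)" and N2: "T * K2 < real N powr e"
  proof -
    obtain N0 where N0: "\<And>N. N \<ge> N0 \<Longrightarrow> L2_set (\<lambda>n. cmod (z n)) {- int N..int N} \<le> \<eta> * ln (real N)"
      using z_log[OF \<eta>] by (auto simp: eventually_sequentially)
    have "\<forall>\<^sub>F N in sequentially. 2 * K1 * T < real N powr (e / 2) \<and> T * K2 < real N powr e \<and> max 2 N0 \<le> N"
      using e_pos by (intro eventually_conj eventually_powr_gt eventually_ge_at_top) auto
    from eventually_happens'[OF sequentially_bot this]
    obtain N where "2 * K1 * T < real N powr (e / 2)" "T * K2 < real N powr e" "max 2 N0 \<le> N"
      by auto
    then show ?thesis using N0[of "2 * N"] by (intro that[of N]) auto
  qed
  define A where "A = \<eta> * ln (real (2 * N))"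
  define P where "P = real N powr e"
  have lnN: "0 < ln (real N)" using N by simp
  have A0: "0 \<le> A" using \<eta> N by (auto simp: A_def intro!: mult_nonneg_nonneg)
  have P1: "1 \<le> P" using N e_pos by (simp add: P_def ge_one_powr_ge_zero)
  have P0: "0 < P" using P1 by linarith
  have expA: "exp (2 * (C1 * A) * T) \<le> real N powr (e / 2)"
  proof -
    have "ln (real (2 * N)) \<le> 2 * ln (real N)"
      using N by (simp add: ln_mult)
    then have "A \<le> \<eta> * (2 * ln (real N))" unfolding A_def using \<eta> by (intro mult_left_mono) auto
    then have "2 * (C1 * T) * A \<le> 2 * (C1 * T) * (\<eta> * (2 * ln (real N)))"
      using CT by (intro mult_left_mono) auto
    also have "\<dots> = (e / 2 * ln (real N)) * (C1 * T / (C1 * T + 1))"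
    proof -
      define d where "d = 1 / (C1 * T + 1)"
      have "\<eta> = e / 8 * d" "C1 * T / (C1 * T + 1) = C1 * T * d" by (simp_all add: \<eta>_def d_def)
      then show ?thesis by simp
    qed
    also have "\<dots> \<le> (e / 2 * ln (real N)) * 1"
      using CT e_pos lnN by (intro mult_left_mono) auto
    finally have "2 * (C1 * A) * T \<le> e / 2 * ln (real N)" by (simp add: mult_ac)
    then show ?thesis using N by (simp add: powr_def)
  qed
  have half: "real N powr (e / 2) * real N powr (e / 2) = P"
    by (simp add: P_def powr_add[symmetric])
  have P7: "real N powr (- (7 * e)) = 1 / P ^ 7"
    using N by (simp add: P_def powr_power powr_minus divide_inverse mult.commute)
  show ?thesis
  proof (intro exI[of _ "P ^ 2 + 1"] conjI allI impI)
    fix R y t assume R: "(0 :: real) \<le> R" and y: "clipped_solution R y" and t: "\<bar>t\<bar> \<le> T"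
    have yd: "(y has_vector_derivative bbm_field t (y t) (clip R (y t))) (at t)" and y0: "y 0 = 0" for t
      using y by (auto simp: clipped_solution_def)
    \<comment> \<open>The estimates are insensitive to the direction of time, so negative times are reached by
      running the solution backwards.\<close>
    define \<sigma> :: real where "\<sigma> = (if 0 \<le> t then 1 else - 1)"
    have \<sigma>: "\<bar>\<sigma>\<bar> = 1" "\<sigma> * \<bar>t\<bar> = t" by (auto simp: \<sigma>_def)
    define X where "X r = low_norm N (y (\<sigma> * r))" for r
    define Y where "Y r = norm (Hi N (y (\<sigma> * r)))" for r
    define f where "f r = max ((X r)\<^sup>2 / P ^ 4) (Y r * P\<^sup>2)" for r
    have XY0: "0 \<le> X r" "0 \<le> Y r" for r by (auto simp: X_def Y_def low_norm_nonneg)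
    define flux where "flux r = (\<Sum>n\<in>{- int N..int N}. of_int n * cnj (unemb s (y r) n) * inner r (unemb s (clip R (y r))) n)" for r
    have Ed: "((\<lambda>r. (X r)\<^sup>2) has_real_derivative \<sigma> * Re (- \<i> * flux (\<sigma> * r))) (at r)" for r
    proof -
      have "((\<lambda>r. (low_norm N (y r))\<^sup>2) has_real_derivative Re (- \<i> * flux (\<sigma> * r))) (at (\<sigma> * r))"
        unfolding flux_def by (rule energy_derivative[OF yd])
      moreover have "((\<lambda>r. \<sigma> * r) has_real_derivative \<sigma>) (at r)" by (auto intro!: derivative_eq_intros)
      ultimately show ?thesis unfolding X_def using DERIV_chain2 by (fastforce simp: mult.commute)
    qed
    have Yd: "((\<lambda>r. Hi N (y (\<sigma> * r))) has_vector_derivative 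
        \<sigma> *\<^sub>R Hi N (bbm_field (\<sigma> * r) (y (\<sigma> * r)) (clip R (y (\<sigma> * r))))) (at r)" for r
    proof -
      have "((\<lambda>r. \<sigma> * r) has_vector_derivative \<sigma>) (at r)" by (auto intro!: derivative_eq_intros)
      from vector_diff_chain_at[OF this bounded_linear.has_vector_derivative[OF bounded_linear_Hi yd]]
      show ?thesis by (simp add: o_def)
    qed
    have fcont: "continuous_on {0..T} f"
    proof -
      have "continuous_on {0..T} (\<lambda>r. (X r)\<^sup>2)"
        using Ed DERIV_isCont by (blast intro: continuous_at_imp_continuous_on)
      moreover have "continuous_on {0..T} (\<lambda>r. Hi N (y (\<sigma> * r)))"
        using Yd has_vector_derivative_continuous by (blast intro: continuous_at_imp_continuous_on)
      then have "continuous_on {0..T} Y" unfolding Y_def by (rule continuous_on_norm)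
      ultimately show ?thesis unfolding f_def
        by (intro continuous_on_max continuous_on_divide continuous_on_mult continuous_on_const) (use P0 in auto)
    qed
    have X0': "X 0 = 0" and Y0': "Y 0 = 0"
      by (simp_all add: X_def Y_def y0 low_norm_def unemb_0 L2_set_def
          linear_0[OF bounded_linear.linear[OF bounded_linear_Hi]])
    have f0: "f 0 \<le> 1" by (simp add: f_def X0' Y0')
    have step: "f r < 1" if r: "r \<in> {0..T}" and hyp: "\<And>r'. r' \<in> {0..r} \<Longrightarrow> f r' \<le> 1" for r
    proof -
      have hX: "X r' \<le> P\<^sup>2" and hY: "Y r' \<le> 1 / P\<^sup>2" if "r' \<in> {0..r}" for r'
      proof -
        have "(X r')\<^sup>2 / P ^ 4 \<le> 1" "Y r' * P\<^sup>2 \<le> 1" using hyp[OF that] by (auto simp: f_def)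
        then have "(X r')\<^sup>2 \<le> (P\<^sup>2)\<^sup>2" "Y r' \<le> 1 / P\<^sup>2" using P0 by (auto simp: field_simps)
        then show "X r' \<le> P\<^sup>2" "Y r' \<le> 1 / P\<^sup>2" using P0 by (auto intro: power2_le_imp_le)
      qed
      have qr: "sobolev_norm (- e) (q (\<sigma> * r')) \<le> QT" if "r' \<in> {0..r}" for r'
        unfolding QT_def by (rule q_norm_bound) (use that r \<sigma> in \<open>auto simp: abs_mult\<close>)
      have PP: "1 \<le> P\<^sup>2" using P1 by (simp add: one_le_power)
      have Y1: "Y r' \<le> 1" if "r' \<in> {0..r}" for r'
      proof -
        have "1 / P\<^sup>2 \<le> 1" using PP P0 by (subst divide_le_eq_1_pos) auto
        then show ?thesis using hY[OF that] by linarith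
      qed
      have XYY: "(2 * X r' + Y r') * Y r' \<le> 3" if "r' \<in> {0..r}" for r'
      proof -
        have "(2 * X r' + Y r') * Y r' \<le> (3 * P\<^sup>2) * (1 / P\<^sup>2)"
          using hX[OF that] hY[OF that] Y1[OF that] PP XY0[of r'] by (intro mult_mono) auto
        then show ?thesis using P0 by simp
      qed
      have "(X r)\<^sup>2 \<le> (2 * P ^ 3 * K1) * r * exp (2 * (C1 * A) * r)"
      proof (rule gronwall_linear[OF Ed])
        fix r' assume r': "0 \<le> r'" "r' \<le> r"
        then have r'': "r' \<in> {0..r}" by auto
        obtain \<theta> where \<theta>: "0 \<le> \<theta>" "\<theta> \<le> 1" "clip R (y (\<sigma> * r')) = \<theta> *\<^sub>R y (\<sigma> * r')"
          using clip_eq_scaleR[OF R] by blast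
        have "\<sigma> * Re (- \<i> * flux (\<sigma> * r')) \<le> \<bar>\<sigma>\<bar> * \<bar>Re (- \<i> * flux (\<sigma> * r'))\<bar>"
          by (metis abs_ge_self abs_mult)
        also have "\<dots> \<le> cmod (- \<i> * flux (\<sigma> * r'))"
          using abs_Re_le_cmod[of "- \<i> * flux (\<sigma> * r')"] \<sigma> by (simp only: mult_1)
        also have "\<dots> = cmod (flux (\<sigma> * r'))" by (simp add: norm_mult)
        also have "\<dots> \<le> X r' * (2 * P * (C * (2 * X r' + Y r') * Y r' + 2 * C * Z * Y r' + sobolev_norm (- e) (q (\<sigma> * r'))) 
            + 2 * (C1 * A * X r'))"
          unfolding flux_def \<theta>(3) X_def Y_def P_def
          using N NA \<theta> by (intro energy_flux_bound clipped_solution_hermitian[OF R y]) (auto simp: A_def)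
        also have "\<dots> \<le> X r' * (2 * P * (C * 3 + 2 * C * Z * 1 + QT) + 2 * (C1 * A * X r'))"
          using XYY[OF r''] Y1[OF r''] qr[OF r''] XY0[of r'] P0 A0 C1_nonneg
          by (intro mult_left_mono add_mono) (auto simp: mult.assoc intro!: mult_left_mono)
        also have "\<dots> = X r' * (2 * P * K1) + 2 * (C1 * A) * (X r')\<^sup>2"
          by (simp add: K1_def power2_eq_square algebra_simps)
        also have "X r' * (2 * P * K1) \<le> P\<^sup>2 * (2 * P * K1)"
          using hX[OF r''] P0 K0 by (intro mult_right_mono) auto
        also have "P\<^sup>2 * (2 * P * K1) = 2 * P ^ 3 * K1" by (simp add: power2_eq_square power3_eq_cube)
        finally show "\<sigma> * Re (- \<i> * flux (\<sigma> * r')) \<le> 2 * (C1 * A) * (X r')\<^sup>2 + 2 * P ^ 3 * K1"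
          by simp
      qed (use X0' A0 C1_nonneg P0 K0 r in auto)
      also have "\<dots> \<le> (2 * P ^ 3 * K1) * T * exp (2 * (C1 * A) * T)"
        using r A0 C1_nonneg P0 K0 by (intro mult_mono) (auto intro!: mult_left_mono)
      also have "\<dots> \<le> (2 * P ^ 3 * K1) * T * real N powr (e / 2)"
        using T P0 K0 by (intro mult_left_mono expA) auto
      also have "\<dots> = (2 * K1 * T) * (P ^ 3 * real N powr (e / 2))" by simp
      also have "\<dots> < real N powr (e / 2) * (P ^ 3 * real N powr (e / 2))"
        using N1 P0 N by (intro mult_strict_right_mono) auto
      also have "\<dots> = P ^ 4" using half by (simp add: mult_ac power4_eq_xxxx power3_eq_cube)
      finally have E1: "(X r)\<^sup>2 / P ^ 4 < 1" using P0 by simp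
      have "Y r \<le> r * (K2 / P ^ 3)"
      proof (cases "r = 0")
        case False
        have "norm (Hi N (y (\<sigma> * r)) - Hi N (y (\<sigma> * 0))) \<le> r * (K2 / P ^ 3) - 0 * (K2 / P ^ 3)"
        proof (rule differentiable_bound_general)
          show "0 < r" using False r by auto
          show "continuous_on {0..r} (\<lambda>r. Hi N (y (\<sigma> * r)))"
            using Yd has_vector_derivative_continuous by (blast intro: continuous_at_imp_continuous_on)
          show "continuous_on {0..r} (\<lambda>r. r * (K2 / P ^ 3))" by (intro continuous_intros) (use P0 in auto)
          show "((\<lambda>r. Hi N (y (\<sigma> * r))) has_vector_derivative 
            \<sigma> *\<^sub>R Hi N (bbm_field (\<sigma> * r') (y (\<sigma> * r')) (clip R (y (\<sigma> * r'))))) (at r')" for r' by (rule Yd)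
          have "((\<lambda>r. r * c) has_vector_derivative c) (at r')" for c r' :: real
            by (auto intro!: derivative_eq_intros simp flip: has_real_derivative_iff_has_vector_derivative)
          then show "((\<lambda>r. r * (K2 / P ^ 3)) has_vector_derivative K2 / P ^ 3) (at r')" for r' .
          fix r' assume r': "0 < r'" "r' < r"
          then have r'': "r' \<in> {0..r}" by auto
          obtain \<theta> where \<theta>: "0 \<le> \<theta>" "\<theta> \<le> 1" "clip R (y (\<sigma> * r')) = \<theta> *\<^sub>R y (\<sigma> * r')"
            using clip_eq_scaleR[OF R] by blast
          let ?n = "norm (y (\<sigma> * r'))"
          have n: "?n \<le> 2 * P\<^sup>2"
            using norm_split[of "y (\<sigma> * r')" N] hX[OF r''] Y1[OF r''] PP by (auto simp: X_def Y_def)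
          have "norm (\<sigma> *\<^sub>R Hi N (bbm_field (\<sigma> * r') (y (\<sigma> * r')) (clip R (y (\<sigma> * r')))))
             \<le> real N powr (- (7 * e)) * (?n + (C * ?n\<^sup>2 + 2 * C * Z * ?n + sobolev_norm (- e) (q (\<sigma> * r'))))"
            unfolding \<theta>(3) norm_scaleR \<sigma>(1) mult_1 using N \<theta> by (intro high_field_bound) auto
          also have "\<dots> \<le> real N powr (- (7 * e)) * (2 * P\<^sup>2 + (C * (2 * P\<^sup>2)\<^sup>2 + 2 * C * Z * (2 * P\<^sup>2) + QT))"
            by (intro mult_left_mono add_mono power_mono n qr[OF r'']) auto
          also have "\<dots> \<le> real N powr (- (7 * e)) * (P ^ 4 * K2)"
          proof (intro mult_left_mono)
            have P24: "P\<^sup>2 \<le> P ^ 4" "1 \<le> P ^ 4" using P1 by (auto intro: power_increasing)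
            have "2 * P\<^sup>2 + (C * (2 * P\<^sup>2)\<^sup>2 + 2 * C * Z * (2 * P\<^sup>2) + QT) 
               = 2 * P\<^sup>2 + (4 * C) * P ^ 4 + (4 * C * Z) * P\<^sup>2 + QT * 1"
              by (simp add: power_mult_distrib)
            also have "\<dots> \<le> 2 * P ^ 4 + (4 * C) * P ^ 4 + (4 * C * Z) * P ^ 4 + QT * P ^ 4"
              using P24 QT0 by (intro add_mono mult_left_mono) auto
            finally show "2 * P\<^sup>2 + (C * (2 * P\<^sup>2)\<^sup>2 + 2 * C * Z * (2 * P\<^sup>2) + QT) \<le> P ^ 4 * K2"
              by (simp add: K2_def algebra_simps)
          qed auto
          also have "\<dots> = K2 / P ^ 3"
          proof -
            have "1 / P ^ 7 * (P ^ 4 * K2) = (P ^ 4 * K2) / (P ^ 4 * P ^ 3)" by (simp flip: power_add)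
            also have "\<dots> = K2 / P ^ 3" using P0 by (intro nonzero_mult_divide_mult_cancel_left) simp
            finally show ?thesis unfolding P7 .
          qed
          finally show "norm (\<sigma> *\<^sub>R Hi N (bbm_field (\<sigma> * r') (y (\<sigma> * r')) (clip R (y (\<sigma> * r'))))) \<le> K2 / P ^ 3" .
        qed
        then show ?thesis using Y0' by (simp add: Y_def)
      qed (simp add: Y0')
      also have "\<dots> \<le> T * (K2 / P ^ 3)" using r K0 P0 by (intro mult_right_mono) auto
      finally have "Y r * P\<^sup>2 \<le> T * (K2 / P ^ 3) * P\<^sup>2" by (intro mult_right_mono) auto
      also have "\<dots> = (T * K2) / P" using P0 by (simp add: power2_eq_square power3_eq_cube)
      also have "\<dots> < 1" using N2 P0 by (simp add: P_def)
      finally show ?thesis using E1 by (simp add: f_def)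
    qed
    have "f \<bar>t\<bar> < 1"
      by (rule continuity_bootstrap[OF fcont f0 step]) (use t in auto)
    then have "(X \<bar>t\<bar>)\<^sup>2 \<le> (P\<^sup>2)\<^sup>2" "Y \<bar>t\<bar> * P\<^sup>2 \<le> 1" using P0 by (auto simp: f_def field_simps)
    then have "X \<bar>t\<bar> \<le> P\<^sup>2" "Y \<bar>t\<bar> * 1 \<le> 1" 
      using P0 P1 mult_left_mono[of 1 "P\<^sup>2" "Y \<bar>t\<bar>"] XY0[of "\<bar>t\<bar>"] 
      by (auto intro: power2_le_imp_le simp: one_le_power)
    then show "norm (y t) \<le> P\<^sup>2 + 1"
      using norm_split[of "y t" N] \<sigma> by (simp add: X_def Y_def)
  qed (use P0 in auto)
qed

section \<open>Global existence and uniqueness for the remainder\<close>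

definition bbm_curve :: "(real \<Rightarrow> ell2) \<Rightarrow> bool" where
  "bbm_curve y \<longleftrightarrow> y 0 = 0 \<and> (\<forall>t. (y has_vector_derivative bbm_field t (y t) (y t)) (at t))"

lemma bounded_curves_agree:
  assumes x: "\<And>t. \<bar>t\<bar> < T \<Longrightarrow> (x has_vector_derivative bbm_field t (x t) (x t)) (at t)"
    and y: "\<And>t. \<bar>t\<bar> < T \<Longrightarrow> (y has_vector_derivative bbm_field t (y t) (y t)) (at t)"
    and xK: "\<And>t. \<bar>t\<bar> < T \<Longrightarrow> norm (x t) \<le> K" and yK: "\<And>t. \<bar>t\<bar> < T \<Longrightarrow> norm (y t) \<le> K"
    and 0: "x 0 = y 0" and t: "\<bar>t\<bar> < T"
  shows "x t = y t"
proof (rule ode_unique[OF x y _ 0 t])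
  fix t assume t: "\<bar>t\<bar> < T"
  have "norm (bbm_field t (x t) (x t) - bbm_field t (y t) (y t)) 
     \<le> norm (x t - y t) + C * (norm (x t) + norm (y t) + 2 * Z) * norm (x t - y t)"
    using bbm_field_lipschitz[of t "x t" "x t" t "y t" "y t"] by simp
  also have "\<dots> \<le> norm (x t - y t) + C * (K + K + 2 * Z) * norm (x t - y t)"
    by (intro add_mono mult_right_mono mult_left_mono xK yK t) auto
  finally show "norm (bbm_field t (x t) (x t) - bbm_field t (y t) (y t)) \<le> (1 + C * (K + K + 2 * Z)) * norm (x t - y t)"
    by (simp add: algebra_simps)
qed

lemma bbm_curve_unique:
  assumes x: "bbm_curve x" and y: "bbm_curve y"
  shows "x = y"
proof
  fix t :: real
  define T where "T = \<bar>t\<bar> + 1"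
  have bound: "\<exists>K. \<forall>t. \<bar>t\<bar> < T \<longrightarrow> norm (y t) \<le> K" if "bbm_curve y" for y
  proof -
    have "continuous_on {-T..T} y"
      using that has_vector_derivative_continuous unfolding bbm_curve_def 
      by (blast intro: continuous_at_imp_continuous_on)
    then have "bounded (y ` {-T..T})" 
      using compact_continuous_image compact_imp_bounded by blast
    then obtain K where "\<And>t. t \<in> {-T..T} \<Longrightarrow> norm (y t) \<le> K" unfolding bounded_iff by blast
    then show ?thesis by (intro exI[of _ K]) (auto simp: abs_less_iff)
  qed
  obtain K1 K2 where K: "\<And>t. \<bar>t\<bar> < T \<Longrightarrow> norm (x t) \<le> K1" "\<And>t. \<bar>t\<bar> < T \<Longrightarrow> norm (y t) \<le> K2"
    using bound[OF x] bound[OF y] by blast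
  show "x t = y t"
    by (rule bounded_curves_agree[where T = T and K = "max K1 K2"])
      (use x y in \<open>auto simp: bbm_curve_def T_def le_max_iff_disj intro: K[unfolded T_def]\<close>)
qed

text \<open>With the truncation level equal to the a priori bound for \<open>\<bar>t\<bar> \<le> n + 1\<close>, the truncation is never
  active on that interval. The solutions obtained in this way for different \<open>n\<close> agree where both
  solve the original equation, and are glued.\<close>

lemma bbm_curve_exists: "\<exists>y. bbm_curve y"
proof -
  have "\<forall>n::nat. \<exists>K\<ge>0. \<forall>R y t. 0 \<le> R \<longrightarrow> clipped_solution R y \<longrightarrow> \<bar>t\<bar> \<le> real n + 1 \<longrightarrow> norm (y t) \<le> K"
    using a_priori_bound[of "real _ + 1"] by auto
  then obtain K where K0: "\<And>n::nat. 0 \<le> K n" 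
    and K: "\<And>n R y t. 0 \<le> R \<Longrightarrow> clipped_solution R y \<Longrightarrow> \<bar>t\<bar> \<le> real n + 1 \<Longrightarrow> norm (y t) \<le> K n"
    by metis
  obtain y where y: "\<And>n. clipped_solution (K n) (y n)"
    using clipped_solution_exists[OF K0] by metis
  have y0: "y n 0 = 0" for n using y by (simp add: clipped_solution_def)
  have yd: "(y n has_vector_derivative bbm_field t (y n t) (y n t)) (at t)" if "\<bar>t\<bar> \<le> real n + 1" for n t
  proof -
    have "clip (K n) (y n t) = y n t" using K[OF K0 y that] by (simp add: clip_def)
    then show ?thesis using y[of n] by (metis clipped_solution_def)
  qed
  have agree: "y n t = y m t" if "\<bar>t\<bar> < real n + 1" "\<bar>t\<bar> < real m + 1" for n m t
  proof (rule bounded_curves_agree[where T = "min (real n + 1) (real m + 1)" and K = "max (K n) (K m)"])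
    show "norm (y n t) \<le> max (K n) (K m)" "norm (y m t) \<le> max (K n) (K m)" 
      if "\<bar>t\<bar> < min (real n + 1) (real m + 1)" for t
      using K[OF K0 y[of n], of t n] K[OF K0 y[of m], of t m] that by (auto simp: le_max_iff_disj)
  qed (use that y0 in \<open>auto intro!: yd\<close>)
  define Y where "Y t = y (nat \<lceil>\<bar>t\<bar>\<rceil>) t" for t
  have Y: "Y t = y n t" if "\<bar>t\<bar> < real n + 1" for n t
    unfolding Y_def by (rule agree) (use that in \<open>linarith+\<close>)
  have "bbm_curve Y"
    unfolding bbm_curve_def
  proof (intro conjI allI)
    show "Y 0 = 0" by (simp add: Y_def y0)
    fix t :: real
    define n where "n = nat \<lceil>\<bar>t\<bar>\<rceil>"
    have tn: "\<bar>t\<bar> < real n + 1" unfolding n_def by linarith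
    have "(Y has_vector_derivative bbm_field t (y n t) (y n t)) (at t)"
    proof (rule has_vector_derivative_transform_within_open[OF yd, where S = "{- (real n + 1)<..<real n + 1}"])
      show "y n r = Y r" if "r \<in> {- (real n + 1)<..<real n + 1}" for r
        using Y[of r n] that by (auto simp: abs_less_iff)
    qed (use tn in auto)
    then show "(Y has_vector_derivative bbm_field t (Y t) (Y t)) (at t)" using Y[OF tn] by simp
  qed
  then show ?thesis by blast
qed

section \<open>Solutions of the Duhamel formula\<close>

lemma duhamel_integrand:
  assumes v: "v \<in> C_sobolev s"
  shows "continuous_on UNIV (\<lambda>t. bbm_nonlin (S_prop t z) (q t) (v t) n)"
proof -
  define y where "y t = emb s (v t)" for t
  have y: "continuous_on UNIV y" and vy: "v t = unemb s (y t)" for t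
    using v by (auto simp: C_sobolev_iff y_def unemb_emb)
  have "continuous_on UNIV (\<lambda>t. unemb s (bbm_field t (y t) (y t)) n)" "continuous_on UNIV (\<lambda>t. unemb s (y t) n)"
    unfolding unemb_def 
    by (intro continuous_intros bounded_linear.continuous_on[OF bounded_linear_coeff] bbm_field_continuous y)+
  then have "continuous_on UNIV (\<lambda>t. 2 * (\<i> * unemb s (bbm_field t (y t) (y t)) n - of_real (phi n) * unemb s (y t) n))"
    by (intro continuous_intros)
  moreover have "2 * (\<i> * unemb s (bbm_field t (y t) (y t)) n - of_real (phi n) * unemb s (y t) n) 
      = bbm_nonlin (S_prop t z) (q t) (v t) n" for t
    unfolding bbm_nonlin_inner vy unemb_bbm_field field_seq_def by (simp add: algebra_simps)
  ultimately show ?thesis by simp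
qed

text \<open>The Duhamel formula, mode by mode, is the differential equation in \<open>ell2\<close>. In particular all
  solutions of the Duhamel formula in the class are curves to which uniqueness applies.\<close>

lemma bbm_solution_iff_curve:
  assumes v: "v \<in> C_sobolev s"
  shows "(\<lambda>n. S_prop 0 z n + v 0 n) = z \<and> bbm_solution (\<lambda>t. S_prop t z) q z (\<lambda>t n. S_prop t z n + v t n)
    \<longleftrightarrow> bbm_curve (\<lambda>t. emb s (v t))" (is "?L \<longleftrightarrow> ?R")
proof -
  define y where "y t = emb s (v t)" for t
  have y: "continuous_on UNIV y" and vs: "v t \<in> sobolev s" and vy: "v t = unemb s (y t)" for t
    using v by (auto simp: C_sobolev_iff y_def unemb_emb)
  define Nn where "Nn n t = bbm_nonlin (S_prop t z) (q t) (v t) n" for n t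
  have Ncont: "continuous_on UNIV (Nn n)" for n
    unfolding Nn_def by (rule duhamel_integrand[OF v])
  have int: "interval_lebesgue_integrable lborel 0 (ereal t) (\<lambda>r. exp (- (\<i> * of_real (t - r) * of_real p)) * Nn n r)" for t p n
    unfolding zero_ereal_def
  proof (rule interval_integrable_isCont)
    fix x
    have "continuous_on UNIV (\<lambda>r. exp (- (\<i> * of_real (t - r) * of_real p)) * Nn n r)"
      by (intro continuous_intros Ncont)
    then show "isCont (\<lambda>r. exp (- (\<i> * of_real (t - r) * of_real p)) * Nn n r) x"
      by (simp add: continuous_on_eq_continuous_at)
  qed
  have field: "- \<i> * of_real (phi n) * v t n - \<i> / 2 * Nn n t = unemb s (bbm_field t (y t) (y t)) n" for n t
    unfolding Nn_def bbm_nonlin_inner vy unemb_bbm_field field_seq_def by (simp add: algebra_simps)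
  have "?L \<longleftrightarrow> (\<forall>n. v 0 n = 0) \<and> 
      (\<forall>n t. v t n = - \<i> / 2 * (LBINT r=0..ereal t. exp (- (\<i> * of_real (t - r) * of_real (phi n))) * Nn n r))"
  proof -
    have "S_prop (t - r) (bbm_nonlin (S_prop r z) (q r) (v r)) n 
        = exp (- (\<i> * of_real (t - r) * of_real (phi n))) * Nn n r" for t r n
      by (simp add: S_prop_def Nn_def)
    moreover have "S_prop 0 z n = z n" for n by (simp add: S_prop_def)
    ultimately show ?thesis
      using int by (auto simp: bbm_solution_def Let_def fun_eq_iff)
  qed
  also have "\<dots> \<longleftrightarrow> (\<forall>n. v 0 n = 0 \<and> 
      (\<forall>t. ((\<lambda>t. v t n) has_vector_derivative unemb s (bbm_field t (y t) (y t)) n) (at t)))"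
  proof -
    have "(\<forall>t. v t n = - \<i> / 2 * (LBINT r=0..ereal t. exp (- (\<i> * of_real (t - r) * of_real (phi n))) * Nn n r))
      \<longleftrightarrow> v 0 n = 0 \<and> (\<forall>t. ((\<lambda>t. v t n) has_vector_derivative unemb s (bbm_field t (y t) (y t)) n) (at t))" for n
      using duhamel_iff_ode[OF Ncont[of n], of "\<lambda>t. v t n" "phi n"] unfolding field .
    then show ?thesis by blast
  qed
  also have "\<dots> \<longleftrightarrow> bbm_curve y"
  proof
    assume *: "\<forall>n. v 0 n = 0 \<and> 
      (\<forall>t. ((\<lambda>t. v t n) has_vector_derivative unemb s (bbm_field t (y t) (y t)) n) (at t))"
    have "y 0 = 0" unfolding y_def by (rule ell2_eqI) (simp add: coeff_emb vs *)
    moreover have "(y has_vector_derivative bbm_field t (y t) (y t)) (at t)" for t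
    proof (rule has_vector_derivative_ell2_coordinatewise[OF bbm_field_continuous[OF y]])
      fix n t
      have "((\<lambda>t. of_real (jbracket n powr s) * v t n) has_vector_derivative 
        of_real (jbracket n powr s) * unemb s (bbm_field t (y t) (y t)) n) (at t)"
        using * by (intro has_vector_derivative_mult_right) auto
      then show "((\<lambda>t. coeff (y t) n) has_vector_derivative coeff (bbm_field t (y t) (y t)) n) (at t)"
        using coeff_emb[OF unemb_sobolev, of s "bbm_field t (y t) (y t)" n] by (simp add: y_def coeff_emb vs)
    qed
    ultimately show "bbm_curve y" by (simp add: bbm_curve_def)
  next
    assume *: "bbm_curve y"
    show "\<forall>n. v 0 n = 0 \<and> 
      (\<forall>t. ((\<lambda>t. v t n) has_vector_derivative unemb s (bbm_field t (y t) (y t)) n) (at t))"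
      using * unemb_has_derivative[of y _ "y _"] unfolding vy bbm_curve_def unemb_bbm_field
      by (auto simp: unemb_0)
  qed
  finally show ?thesis unfolding y_def .
qed

theorem bbm_wellposed:
  "\<exists>!u. u \<in> affine_class (\<lambda>t. S_prop t z) s \<and> u 0 = z \<and> bbm_solution (\<lambda>t. S_prop t z) q z u"
proof -
  obtain y where y: "bbm_curve y" using bbm_curve_exists by blast
  have yc: "continuous_on UNIV y"
    using y has_vector_derivative_continuous unfolding bbm_curve_def 
    by (blast intro: continuous_at_imp_continuous_on)
  define v where "v t = unemb s (y t)" for t
  have v: "v \<in> C_sobolev s" "(\<lambda>t. emb s (v t)) = y"
    using yc by (auto simp: C_sobolev_iff v_def)
  show ?thesis
  proof (rule ex1I[of _ "\<lambda>t n. S_prop t z n + v t n"])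
    show "(\<lambda>t n. S_prop t z n + v t n) \<in> affine_class (\<lambda>t. S_prop t z) s \<and> (\<lambda>n. S_prop 0 z n + v 0 n) = z 
        \<and> bbm_solution (\<lambda>t. S_prop t z) q z (\<lambda>t n. S_prop t z n + v t n)"
      using bbm_solution_iff_curve[OF v(1)] y v by (auto simp: affine_class_def)
    fix u assume u: "u \<in> affine_class (\<lambda>t. S_prop t z) s \<and> u 0 = z \<and> bbm_solution (\<lambda>t. S_prop t z) q z u"
    then obtain w where w: "w \<in> C_sobolev s" "u = (\<lambda>t n. S_prop t z n + w t n)"
      by (auto simp: affine_class_def)
    then have "bbm_curve (\<lambda>t. emb s (w t))" using bbm_solution_iff_curve[OF w(1)] u by auto
    then have "(\<lambda>t. emb s (w t)) = y" using bbm_curve_unique y by blast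
    then have "w t = v t" for t
      using w(1) unfolding C_sobolev_iff v_def by (metis unemb_emb)
    then show "u = (\<lambda>t n. S_prop t z n + v t n)" using w by auto
  qed
qed

text \<open>The Duhamel formula integrates the limit square in time, so it only depends on its class
  modulo null sets of times.\<close>

lemma bbm_solution_cong_AE:
  assumes u: "u \<in> affine_class (\<lambda>t. S_prop t z) s"
    and meas: "\<And>n. n \<noteq> 0 \<Longrightarrow> (\<lambda>t. q' t n) \<in> borel_measurable borel"
    and eq: "AE t in lborel. \<forall>n. n \<noteq> 0 \<longrightarrow> q' t n = q t n"
  shows "bbm_solution (\<lambda>t. S_prop t z) q' z u \<longleftrightarrow> bbm_solution (\<lambda>t. S_prop t z) q z u"
proof -
  obtain v where v: "v \<in> C_sobolev s" "u = (\<lambda>t n. S_prop t z n + v t n)"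
    using u by (auto simp: affine_class_def)
  define F where "F q t n r = S_prop (t - r) (bbm_nonlin (S_prop r z) (q r) (v r)) n" for q :: "real \<Rightarrow> int \<Rightarrow> complex" and t n r
  have Fq: "F q t n r = exp (- (\<i> * of_real (t - r) * of_real (phi n))) * bbm_nonlin (S_prop r z) (q r) (v r) n" for t n r
    by (simp add: F_def S_prop_def)
  have Fdiff: "F q' t n r = F q t n r + exp (- (\<i> * of_real (t - r) * of_real (phi n))) * (of_real (phi n) * (q' r n - q r n))" for t n r
    by (simp add: F_def S_prop_def bbm_nonlin_def phi_D_def algebra_simps)
  have m: "F q t n \<in> borel_measurable borel" for t n
    unfolding Fq by (intro borel_measurable_continuous_onI continuous_intros duhamel_integrand v)
  have qm: "(\<lambda>r. q r n) \<in> borel_measurable borel" for n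
  proof (rule borel_measurable_continuous_onI)
    have "((\<lambda>r. q r n) \<longlongrightarrow> q r0 n) (at r0)" for r0
    proof (rule LIM_zero_cancel, rule Lim_null_comparison)
      show "\<forall>\<^sub>F r in at r0. norm (q r n - q r0 n) \<le> jbracket n powr e * (D * \<bar>r - r0\<bar>)"
      proof (rule always_eventually, rule allI)
        fix r
        have "jbracket n powr (- e) * cmod (q r n - q r0 n) \<le> D * \<bar>r - r0\<bar>"
          by (rule order.trans[OF sobolev_coeff_le[OF sobolev_diff(1)[OF q q]] q_lipschitz])
        then have "jbracket n powr e * (jbracket n powr (- e) * cmod (q r n - q r0 n)) \<le> jbracket n powr e * (D * \<bar>r - r0\<bar>)"
          by (intro mult_left_mono) auto
        then show "norm (q r n - q r0 n) \<le> jbracket n powr e * (D * \<bar>r - r0\<bar>)"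
          by (simp add: mult.assoc[symmetric] powr_add[symmetric])
      qed
      have "((\<lambda>r. jbracket n powr e * (D * \<bar>r - r0\<bar>)) \<longlongrightarrow> jbracket n powr e * (D * \<bar>r0 - r0\<bar>)) (at r0)"
        by (intro tendsto_intros)
      then show "((\<lambda>r. jbracket n powr e * (D * \<bar>r - r0\<bar>)) \<longlongrightarrow> 0) (at r0)" by simp
    qed
    then show "continuous_on UNIV (\<lambda>r. q r n)" by (simp add: continuous_on_def)
  qed
  have m': "F q' t n \<in> borel_measurable borel" for t n
  proof (cases "n = 0")
    case True
    then show ?thesis using m[of t 0] unfolding Fdiff[abs_def] by simp
  next
    case False
    have [measurable]: "(\<lambda>r. exp (- (\<i> * of_real (t - r) * of_real (phi n)))) \<in> borel_measurable borel"
      by (intro borel_measurable_continuous_onI continuous_intros)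
    note [measurable] = m[of t n] qm[of n] meas[OF False]
    show ?thesis unfolding Fdiff[abs_def] by measurable
  qed
  have ae: "AE r in lborel. F q' t n r = F q t n r" for t n
    using eq by eventually_elim (cases "n = 0", auto simp: Fdiff)
  have "interval_lebesgue_integrable lborel 0 (ereal t) (F q' t n) \<longleftrightarrow> interval_lebesgue_integrable lborel 0 (ereal t) (F q t n)" for t n
  proof -
    have "set_integrable lborel S (F q' t n) \<longleftrightarrow> set_integrable lborel S (F q t n)" if [measurable]: "S \<in> sets borel" for S
      unfolding set_integrable_def
    proof (rule integrable_cong_AE)
      show "AE r in lborel. indicat_real S r *\<^sub>R F q' t n r = indicat_real S r *\<^sub>R F q t n r"
        using ae[of t n] by eventually_elim simp
    qed (use m[of t n] m'[of t n] in measurable)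
    then show ?thesis unfolding interval_lebesgue_integrable_def by auto
  qed
  moreover have "(LBINT r=0..ereal t. F q' t n r) = (LBINT r=0..ereal t. F q t n r)" for t n
    using ae[of t n] by (intro interval_integral_cong_AE m m') auto
  ultimately show ?thesis
    unfolding bbm_solution_def Let_def v(2) by (simp add: F_def[abs_def])
qed

end

section \<open>Almost sure summability and limits in mean square\<close>

text \<open>By Tonelli's theorem the sum has finite expectation.\<close>

lemma AE_summable_on:
  fixes f :: "'i :: countable \<Rightarrow> 'a \<Rightarrow> real"
  assumes f: "\<And>i. integrable M (f i)" and f0: "\<And>i \<omega>. 0 \<le> f i \<omega>"
    and b: "\<And>i. (\<integral>\<omega>. f i \<omega> \<partial>M) \<le> b i" and bs: "b summable_on UNIV"
  shows "AE \<omega> in M. (\<lambda>i. f i \<omega>) summable_on UNIV"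
proof -
  have fm [measurable]: "f i \<in> borel_measurable M" for i using f by auto
  have b0: "0 \<le> b i" for i   proof -
    have "0 \<le> (\<integral>\<omega>. f i \<omega> \<partial>M)" by (rule Bochner_Integration.integral_nonneg) (rule f0)
    with b[of i] show ?thesis by linarith
  qed
  interpret C: sigma_finite_measure "count_space (UNIV :: 'i set)"
    by (rule sigma_finite_measure_count_space_countable) simp
  have "case_prod (\<lambda>\<omega> i. ennreal (f i \<omega>)) \<in> borel_measurable (M \<Otimes>\<^sub>M count_space UNIV)"
    unfolding case_prod_unfold
    by (rule measurable_compose_countable'[where f = "\<lambda>i p. ennreal (f i (fst p))" and g = snd and I = UNIV]) auto
  then have meas: "(\<lambda>\<omega>. \<integral>\<^sup>+i. ennreal (f i \<omega>) \<partial>count_space UNIV) \<in> borel_measurable M"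
    by (rule C.borel_measurable_nn_integral)
  have "(\<integral>\<^sup>+\<omega>. (\<integral>\<^sup>+i. ennreal (f i \<omega>) \<partial>count_space UNIV) \<partial>M) 
      = (\<integral>\<^sup>+i. (\<integral>\<^sup>+\<omega>. ennreal (f i \<omega>) \<partial>M) \<partial>count_space UNIV)"
    by (rule nn_integral_count_space_nn_integral) auto
  also have "\<dots> \<le> (\<integral>\<^sup>+i. ennreal (b i) \<partial>count_space UNIV)"
  proof (rule nn_integral_mono)
    fix i
    have "(\<integral>\<^sup>+\<omega>. ennreal (f i \<omega>) \<partial>M) = ennreal (\<integral>\<omega>. f i \<omega> \<partial>M)"
      by (rule nn_integral_eq_integral) (use f f0 in auto)
    then show "(\<integral>\<^sup>+\<omega>. ennreal (f i \<omega>) \<partial>M) \<le> ennreal (b i)" using b[of i] by (simp add: ennreal_leI)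
  qed
  also have "\<dots> < \<infinity>"
  proof -
    have "integrable (count_space UNIV) b"
      using bs b0 abs_summable_equivalent[of b UNIV] by (simp add: abs_summable_on_def)
    then show ?thesis using b0 by (simp add: integrable_iff_bounded)
  qed
  finally have "AE \<omega> in M. (\<integral>\<^sup>+i. ennreal (f i \<omega>) \<partial>count_space UNIV) \<noteq> \<infinity>"
    by (intro nn_integral_PInf_AE meas) auto
  then show ?thesis
  proof eventually_elim
    case (elim \<omega>)
    then have "integrable (count_space UNIV) (\<lambda>i. f i \<omega>)"
      using f0 by (simp add: integrable_iff_bounded less_top)
    then show ?case
      using f0 abs_summable_equivalent[of "\<lambda>i. f i \<omega>" UNIV] by (simp add: abs_summable_on_def)
  qed
qed

lemma cmod_diff_sq_le: "(cmod (a - b))\<^sup>2 \<le> 2 * (cmod (a - c))\<^sup>2 + 2 * (cmod (c - b))\<^sup>2"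
proof -
  have "cmod (a - b) \<le> cmod (a - c) + cmod (c - b)"
    using norm_triangle_ineq[of "a - c" "c - b"] by simp
  then have "(cmod (a - b))\<^sup>2 \<le> (cmod (a - c) + cmod (c - b))\<^sup>2"
    by (intro power_mono) auto
  also have "\<dots> \<le> 2 * (cmod (a - c))\<^sup>2 + 2 * (cmod (c - b))\<^sup>2"
    using zero_le_power2[of "cmod (a - c) - cmod (c - b)"] by (simp add: power2_eq_square algebra_simps)
  finally show ?thesis .
qed

text \<open>A Cauchy sequence in mean square with an almost surely convergent subsequence converges in mean
  square to that almost sure limit, by Fatou's lemma.\<close>

lemma L2_limit_if_AE_limit:
  fixes X :: "nat \<Rightarrow> 'a \<Rightarrow> complex"
  assumes X [measurable]: "\<And>N. X N \<in> borel_measurable M" and Y [measurable]: "Y \<in> borel_measurable M"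
    and sq: "\<And>N. integrable M (\<lambda>\<omega>. (cmod (X N \<omega>))\<^sup>2)"
    and cauchy: "\<And>K N. K \<le> N \<Longrightarrow> (\<integral>\<omega>. (cmod (X N \<omega> - X K \<omega>))\<^sup>2 \<partial>M) \<le> r K"
    and r: "r \<longlonglongrightarrow> 0" and \<rho>: "\<And>j :: nat. j \<le> \<rho> j"
    and lim: "AE \<omega> in M. (\<lambda>j. X (\<rho> j) \<omega>) \<longlonglongrightarrow> Y \<omega>"
  shows "L2_limit M X Y" and "(\<And>N. (\<integral>\<omega>. (cmod (X N \<omega>))\<^sup>2 \<partial>M) \<le> B) \<Longrightarrow> (\<integral>\<omega>. (cmod (Y \<omega>))\<^sup>2 \<partial>M) \<le> B"
proof -
  have fatou: "(\<integral>\<^sup>+\<omega>. ennreal ((cmod (Y \<omega> - Z \<omega>))\<^sup>2) \<partial>M) \<le> ennreal c"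
    if Z [measurable]: "Z \<in> borel_measurable M" 
      and c: "\<And>N. K \<le> N \<Longrightarrow> (\<integral>\<^sup>+\<omega>. ennreal ((cmod (X N \<omega> - Z \<omega>))\<^sup>2) \<partial>M) \<le> ennreal c" for Z c K
  proof -
    have "(\<integral>\<^sup>+\<omega>. ennreal ((cmod (Y \<omega> - Z \<omega>))\<^sup>2) \<partial>M) 
        = (\<integral>\<^sup>+\<omega>. liminf (\<lambda>j. ennreal ((cmod (X (\<rho> j) \<omega> - Z \<omega>))\<^sup>2)) \<partial>M)"
    proof (rule nn_integral_cong_AE)
      show "AE \<omega> in M. ennreal ((cmod (Y \<omega> - Z \<omega>))\<^sup>2) = liminf (\<lambda>j. ennreal ((cmod (X (\<rho> j) \<omega> - Z \<omega>))\<^sup>2))"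
        using lim
      proof eventually_elim
        case (elim \<omega>)
        have "(\<lambda>j. ennreal ((cmod (X (\<rho> j) \<omega> - Z \<omega>))\<^sup>2)) \<longlonglongrightarrow> ennreal ((cmod (Y \<omega> - Z \<omega>))\<^sup>2)"
          by (intro tendsto_ennrealI tendsto_intros elim)
        then show ?case by (metis lim_imp_Liminf sequentially_bot)
      qed
    qed
    also have "\<dots> \<le> liminf (\<lambda>j. \<integral>\<^sup>+\<omega>. ennreal ((cmod (X (\<rho> j) \<omega> - Z \<omega>))\<^sup>2) \<partial>M)"
      by (rule nn_integral_liminf) measurable
    also have "\<dots> \<le> liminf (\<lambda>j :: nat. ennreal c)"
    proof (rule Liminf_mono)
      show "\<forall>\<^sub>F j in sequentially. (\<integral>\<^sup>+\<omega>. ennreal ((cmod (X (\<rho> j) \<omega> - Z \<omega>))\<^sup>2) \<partial>M) \<le> ennreal c"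
        using c \<rho> by (intro eventually_sequentiallyI[of K]) (meson order.trans)
    qed
    also have "\<dots> = ennreal c" by (simp add: Liminf_const)
    finally show ?thesis .
  qed
  have sqd: "integrable M (\<lambda>\<omega>. (cmod (X N \<omega> - X K \<omega>))\<^sup>2)" for N K
  proof (rule Bochner_Integration.integrable_bound)
    show "integrable M (\<lambda>\<omega>. 2 * (cmod (X N \<omega>))\<^sup>2 + 2 * (cmod (X K \<omega>))\<^sup>2)" using sq by auto
    show "AE \<omega> in M. norm ((cmod (X N \<omega> - X K \<omega>))\<^sup>2) \<le> norm (2 * (cmod (X N \<omega>))\<^sup>2 + 2 * (cmod (X K \<omega>))\<^sup>2)"
      using cmod_diff_sq_le[of "X N _" "X K _" 0] by auto
  qed measurable
  have YX: "(\<integral>\<^sup>+\<omega>. ennreal ((cmod (Y \<omega> - X K \<omega>))\<^sup>2) \<partial>M) \<le> ennreal (r K)" for K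
  proof (rule fatou[OF X])
    fix N assume "K \<le> N"
    then show "(\<integral>\<^sup>+\<omega>. ennreal ((cmod (X N \<omega> - X K \<omega>))\<^sup>2) \<partial>M) \<le> ennreal (r K)"
      using sqd cauchy[of K N] by (subst nn_integral_eq_integral) (auto intro!: ennreal_leI)
  qed
  have YXi: "integrable M (\<lambda>\<omega>. (cmod (Y \<omega> - X K \<omega>))\<^sup>2)" for K
    using YX[of K] by (intro integrableI_bounded) (auto simp: ennreal_less_top le_less_trans)
  have Yi: "integrable M (\<lambda>\<omega>. (cmod (Y \<omega>))\<^sup>2)"
  proof (rule Bochner_Integration.integrable_bound)
    show "integrable M (\<lambda>\<omega>. 2 * (cmod (Y \<omega> - X 0 \<omega>))\<^sup>2 + 2 * (cmod (X 0 \<omega>))\<^sup>2)" using sq YXi by auto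
    show "AE \<omega> in M. norm ((cmod (Y \<omega>))\<^sup>2) \<le> norm (2 * (cmod (Y \<omega> - X 0 \<omega>))\<^sup>2 + 2 * (cmod (X 0 \<omega>))\<^sup>2)"
      using cmod_diff_sq_le[of "Y _" 0 "X 0 _"] by auto
  qed measurable
  have r0: "0 \<le> r K" for K using cauchy[of K K] by simp
  have "(\<integral>\<omega>. (cmod (X K \<omega> - Y \<omega>))\<^sup>2 \<partial>M) \<le> r K" for K
    using YX[of K] YXi[of K] r0[of K] by (subst (asm) nn_integral_eq_integral) (auto simp: norm_minus_commute)
  then have "(\<lambda>K. \<integral>\<omega>. (cmod (X K \<omega> - Y \<omega>))\<^sup>2 \<partial>M) \<longlonglongrightarrow> 0"
    by (intro tendsto_sandwich[OF _ _ tendsto_const r]) (auto intro!: always_eventually)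
  then show "L2_limit M X Y" using sq Yi Y by (simp add: L2_limit_def)
  assume B: "\<And>N. (\<integral>\<omega>. (cmod (X N \<omega>))\<^sup>2 \<partial>M) \<le> B"
  have "0 \<le> (\<integral>\<omega>. (cmod (X 0 \<omega>))\<^sup>2 \<partial>M)" by (rule Bochner_Integration.integral_nonneg) simp
  with B[of 0] have "0 \<le> B" by linarith
  have "(\<integral>\<^sup>+\<omega>. ennreal ((cmod (Y \<omega> - 0))\<^sup>2) \<partial>M) \<le> ennreal B"
  proof (rule fatou[where K = 0])
    fix N
    show "(\<integral>\<^sup>+\<omega>. ennreal ((cmod (X N \<omega> - 0))\<^sup>2) \<partial>M) \<le> ennreal B"
      using sq[of N] B[of N] by (subst nn_integral_eq_integral) (auto intro!: ennreal_leI)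
  qed simp
  then show "(\<integral>\<omega>. (cmod (Y \<omega>))\<^sup>2 \<partial>M) \<le> B"
    using Yi \<open>0 \<le> B\<close> by (subst (asm) nn_integral_eq_integral) auto
qed

lemma L2_limit_unique:
  assumes Y: "L2_limit M X Y" and Z: "L2_limit M X Z" and X: "\<And>N. X N \<in> borel_measurable M"
  shows "AE \<omega> in M. Y \<omega> = Z \<omega>"
proof -
  have [measurable]: "Y \<in> borel_measurable M" "Z \<in> borel_measurable M" "\<And>N. X N \<in> borel_measurable M"
    using Y Z X by (auto simp: L2_limit_def)
  have i: "integrable M (\<lambda>\<omega>. (cmod (U \<omega> - V \<omega>))\<^sup>2)" 
    if "integrable M (\<lambda>\<omega>. (cmod (U \<omega>))\<^sup>2)" "integrable M (\<lambda>\<omega>. (cmod (V \<omega>))\<^sup>2)"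
      "U \<in> borel_measurable M" "V \<in> borel_measurable M" for U V :: "'a \<Rightarrow> complex"
  proof (rule Bochner_Integration.integrable_bound)
    show "integrable M (\<lambda>\<omega>. 2 * (cmod (U \<omega>))\<^sup>2 + 2 * (cmod (V \<omega>))\<^sup>2)" using that by auto
    show "AE \<omega> in M. norm ((cmod (U \<omega> - V \<omega>))\<^sup>2) \<le> norm (2 * (cmod (U \<omega>))\<^sup>2 + 2 * (cmod (V \<omega>))\<^sup>2)"
      using cmod_diff_sq_le[of "U _" "V _" 0] by auto
  qed (use that in measurable)
  note sq = Y[unfolded L2_limit_def] Z[unfolded L2_limit_def]
  have XY: "integrable M (\<lambda>\<omega>. (cmod (X N \<omega> - Y \<omega>))\<^sup>2)" and XZ: "integrable M (\<lambda>\<omega>. (cmod (X N \<omega> - Z \<omega>))\<^sup>2)" for N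
    using sq by (auto intro!: i)
  have YZ: "integrable M (\<lambda>\<omega>. (cmod (Y \<omega> - Z \<omega>))\<^sup>2)" using sq by (auto intro!: i)
  let ?u = "\<lambda>N. 2 * (\<integral>\<omega>. (cmod (X N \<omega> - Y \<omega>))\<^sup>2 \<partial>M) + 2 * (\<integral>\<omega>. (cmod (X N \<omega> - Z \<omega>))\<^sup>2 \<partial>M)"
  have "(\<integral>\<omega>. (cmod (Y \<omega> - Z \<omega>))\<^sup>2 \<partial>M) \<le> ?u N" for N
  proof -
    have "(\<integral>\<omega>. (cmod (Y \<omega> - Z \<omega>))\<^sup>2 \<partial>M) \<le> (\<integral>\<omega>. 2 * (cmod (X N \<omega> - Y \<omega>))\<^sup>2 + 2 * (cmod (X N \<omega> - Z \<omega>))\<^sup>2 \<partial>M)"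
      using XY[of N] XZ[of N] YZ cmod_diff_sq_le[of "Y _" "Z _" "X N _"]
      by (intro integral_mono) (auto simp: norm_minus_commute)
    also have "\<dots> = ?u N" using XY[of N] XZ[of N] by simp
    finally show ?thesis .
  qed
  moreover have "?u \<longlonglongrightarrow> 2 * 0 + 2 * 0" using sq by (intro tendsto_intros) auto
  ultimately have "(\<integral>\<omega>. (cmod (Y \<omega> - Z \<omega>))\<^sup>2 \<partial>M) \<le> 0"
    by (intro tendsto_lowerbound[of ?u 0 sequentially]) auto
  moreover have "0 \<le> (\<integral>\<omega>. (cmod (Y \<omega> - Z \<omega>))\<^sup>2 \<partial>M)" by (rule integral_nonneg_AE) auto
  ultimately have "(\<integral>\<omega>. (cmod (Y \<omega> - Z \<omega>))\<^sup>2 \<partial>M) = 0" by linarith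
  then have "AE \<omega> in M. (cmod (Y \<omega> - Z \<omega>))\<^sup>2 = 0"
    using integral_nonneg_eq_0_iff_AE[OF YZ] by auto
  then show ?thesis by eventually_elim simp
qed

section \<open>Moments of the Gaussian coefficients\<close>

lemma four_product_le:
  fixes a b c d :: real
  assumes "0 \<le> a" "0 \<le> b" "0 \<le> c" "0 \<le> d"
  shows "a * b * (c * d) \<le> (a ^ 4 + b ^ 4 + c ^ 4 + d ^ 4) / 4"
proof -
  have sq: "x * y \<le> (x\<^sup>2 + y\<^sup>2) / 2" for x y :: real
    using zero_le_power2[of "x - y"] by (simp add: power2_eq_square algebra_simps)
  have p: "(x * y)\<^sup>2 \<le> (x ^ 4 + y ^ 4) / 2" for x y :: real
    using sq[of "x\<^sup>2" "y\<^sup>2"] by (simp add: power_mult_distrib flip: power_mult)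
  have "a * b * (c * d) \<le> ((a * b)\<^sup>2 + (c * d)\<^sup>2) / 2" by (rule sq)
  also have "\<dots> \<le> ((a ^ 4 + b ^ 4) / 2 + (c ^ 4 + d ^ 4) / 2) / 2"
    by (intro divide_right_mono add_mono p) simp
  also have "\<dots> = (a ^ 4 + b ^ 4 + c ^ 4 + d ^ 4) / 4" by (simp add: field_simps)
  finally show ?thesis .
qed

locale gaussian_data = prob_space M for M :: "'a measure" +
  fixes g :: "int \<Rightarrow> 'a \<Rightarrow> complex"
  assumes g_zero: "std_real_gaussian M (g 0)"
    and g_nonzero: "\<And>n. n \<noteq> 0 \<Longrightarrow> std_complex_gaussian M (g n)"
    and g_minus: "\<And>n \<omega>. \<omega> \<in> space M \<Longrightarrow> g (- n) \<omega> = cnj (g n \<omega>)"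
    and g_indep: "indep_vars (\<lambda>_. borel) g {0..}"
begin

lemma g_measurable [measurable]: "g n \<in> borel_measurable M"
proof -
  have pos: "g n \<in> borel_measurable M" if "0 \<le> n" for n
    using g_indep that by (auto simp: indep_vars_def)
  show ?thesis
  proof (cases "0 \<le> n")
    case False
    have [measurable]: "g (- n) \<in> borel_measurable M" by (rule pos) (use False in simp)
    have "(\<lambda>\<omega>. cnj (g (- n) \<omega>)) \<in> borel_measurable M"
      by (rule borel_measurable_continuous_on[OF _ \<open>g (- n) \<in> borel_measurable M\<close>]) (intro continuous_intros)
    moreover have "g n \<omega> = cnj (g (- n) \<omega>)" if "\<omega> \<in> space M" for \<omega>
      using g_minus[OF that, of "- n"] by simp
    ultimately show ?thesis by (simp cong: measurable_cong)
  qed (rule pos)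
qed

lemma normal_moments:
  assumes X: "distributed M lborel X (normal_density 0 \<sigma>)" and \<sigma>: "0 < \<sigma>"
  shows "integrable M (\<lambda>\<omega>. X \<omega> ^ k)"
    and "(\<integral>\<omega>. X \<omega> ^ (2 * j + 1) \<partial>M) = 0"
    and "(\<integral>\<omega>. X \<omega> ^ 2 \<partial>M) = \<sigma>\<^sup>2"
    and "(\<integral>\<omega>. X \<omega> ^ 4 \<partial>M) = 3 * \<sigma> ^ 4"
proof -
  have e: "(\<integral>\<omega>. X \<omega> ^ k \<partial>M) = (\<integral>x. normal_density 0 \<sigma> x * (x - 0) ^ k \<partial>lborel)" for k
    using distributed_integral[OF X, of "\<lambda>x. x ^ k"] by simp
  show "integrable M (\<lambda>\<omega>. X \<omega> ^ k)"
    using distributed_integrable[OF X, of "\<lambda>x. x ^ k"] integrable_normal_moment[OF \<sigma>, of 0 k] by simp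
  show "(\<integral>\<omega>. X \<omega> ^ (2 * j + 1) \<partial>M) = 0"
    unfolding e by (rule integral_normal_moment_odd[OF \<sigma>])
  show "(\<integral>\<omega>. X \<omega> ^ 2 \<partial>M) = \<sigma>\<^sup>2"
  proof -
    have "(\<integral>\<omega>. X \<omega> ^ 2 \<partial>M) = fact (2 * 1) / ((2 / \<sigma>\<^sup>2) ^ 1 * fact 1)"
      using integral_normal_moment_even[OF \<sigma>, of 0 1] unfolding e by simp
    then show ?thesis by simp
  qed
  show "(\<integral>\<omega>. X \<omega> ^ 4 \<partial>M) = 3 * \<sigma> ^ 4"
  proof -
    have "(\<integral>\<omega>. X \<omega> ^ 4 \<partial>M) = fact (2 * 2) / ((2 / \<sigma>\<^sup>2)\<^sup>2 * fact 2)"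
      using integral_normal_moment_even[OF \<sigma>, of 0 2] unfolding e by simp
    then show ?thesis by (simp add: fact_numeral power_divide flip: power_mult)
  qed
qed

lemma fourth_moment: "integrable M (\<lambda>\<omega>. cmod (g n \<omega>) ^ 4)" "(\<integral>\<omega>. cmod (g n \<omega>) ^ 4 \<partial>M) \<le> 3"
proof -
  have 4: "cmod z ^ 4 = ((Re z)\<^sup>2 + (Im z)\<^sup>2)\<^sup>2" for z
    using cmod_power2[of z] by (simp add: power4_eq_xxxx power2_eq_square mult.assoc)
  have "integrable M (\<lambda>\<omega>. cmod (g n \<omega>) ^ 4) \<and> (\<integral>\<omega>. cmod (g n \<omega>) ^ 4 \<partial>M) \<le> 3"
  proof (cases "n = 0")
    case True
    note m = normal_moments[of "\<lambda>\<omega>. Re (g 0 \<omega>)" 1]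
    have eq: "cmod (g 0 \<omega>) ^ 4 = Re (g 0 \<omega>) ^ 4" if "\<omega> \<in> space M" for \<omega>
      using g_zero that by (simp add: 4 std_real_gaussian_def flip: power_mult)
    have "integrable M (\<lambda>\<omega>. cmod (g 0 \<omega>) ^ 4) = integrable M (\<lambda>\<omega>. Re (g 0 \<omega>) ^ 4)"
      "(\<integral>\<omega>. cmod (g 0 \<omega>) ^ 4 \<partial>M) = (\<integral>\<omega>. Re (g 0 \<omega>) ^ 4 \<partial>M)"
      by (auto intro!: Bochner_Integration.integrable_cong Bochner_Integration.integral_cong simp: eq)
    then show ?thesis using m g_zero True by (simp add: std_real_gaussian_def)
  next
    case False
    note G = g_nonzero[OF False, unfolded std_complex_gaussian_def]
    have s: "0 < sqrt (1 / 2 :: real)" by simp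
    note mr = normal_moments[OF conjunct1[OF G] s] and mi = normal_moments[OF conjunct1[OF conjunct2[OF G]] s]
    let ?h = "\<lambda>\<omega>. 2 * Re (g n \<omega>) ^ 4 + 2 * Im (g n \<omega>) ^ 4"
    have h: "integrable M ?h" using mr(1) mi(1) by auto
    have le: "cmod (g n \<omega>) ^ 4 \<le> ?h \<omega>" for \<omega>
    proof -
      have "0 \<le> ((Re (g n \<omega>))\<^sup>2 - (Im (g n \<omega>))\<^sup>2)\<^sup>2" by simp
      then show ?thesis unfolding 4 by (simp add: power2_eq_square power4_eq_xxxx algebra_simps)
    qed
    have i: "integrable M (\<lambda>\<omega>. cmod (g n \<omega>) ^ 4)"
      by (rule Bochner_Integration.integrable_bound[OF h]) (use le in \<open>auto intro: order.trans[OF _ abs_ge_self]\<close>)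
    have "(\<integral>\<omega>. cmod (g n \<omega>) ^ 4 \<partial>M) \<le> (\<integral>\<omega>. ?h \<omega> \<partial>M)"
      by (rule integral_mono[OF i h le])
    also have "\<dots> = 3"
    proof -
      have "sqrt (1 / 2) ^ 4 = (1 / 4 :: real)" 
        by (simp add: power4_eq_xxxx flip: mult.assoc) 
      then show ?thesis using mr(1,4) mi(1,4) by simp
    qed
    finally show ?thesis using i by simp
  qed
  then show "integrable M (\<lambda>\<omega>. cmod (g n \<omega>) ^ 4)" "(\<integral>\<omega>. cmod (g n \<omega>) ^ 4 \<partial>M) \<le> 3" by auto
qed

lemma integrable_power_le_4:
  assumes "m \<le> 4" shows "integrable M (\<lambda>\<omega>. cmod (g n \<omega>) ^ m)"
proof (rule Bochner_Integration.integrable_bound)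
  show "integrable M (\<lambda>\<omega>. 1 + cmod (g n \<omega>) ^ 4)" using fourth_moment by auto
  have "x ^ m \<le> 1 + x ^ 4" if "0 \<le> x" for x :: real
  proof (cases "1 \<le> x")
    case True
    then have "x ^ m \<le> x ^ 4" using assms by (intro power_increasing) auto
    then show ?thesis by simp
  next
    case False
    then have "x ^ m \<le> 1" using that by (intro power_le_one) auto
    then show ?thesis using that by (simp add: add_increasing2)
  qed
  then show "AE \<omega> in M. norm (cmod (g n \<omega>) ^ m) \<le> norm (1 + cmod (g n \<omega>) ^ 4)"
    by (auto intro!: always_eventually order.trans[OF _ abs_ge_self])
qed measurable

lemma four_product:
  shows "integrable M (\<lambda>\<omega>. g a \<omega> * g b \<omega> * (g c \<omega> * g d \<omega>))"
    and "cmod (\<integral>\<omega>. g a \<omega> * g b \<omega> * (g c \<omega> * g d \<omega>) \<partial>M) \<le> 3"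
    and "integrable M (\<lambda>\<omega>. cmod (g a \<omega> * g b \<omega> * (g c \<omega> * g d \<omega>)))"
    and "(\<integral>\<omega>. cmod (g a \<omega> * g b \<omega> * (g c \<omega> * g d \<omega>)) \<partial>M) \<le> 3"
proof -
  let ?h = "\<lambda>\<omega>. (cmod (g a \<omega>) ^ 4 + cmod (g b \<omega>) ^ 4 + cmod (g c \<omega>) ^ 4 + cmod (g d \<omega>) ^ 4) / 4"
  have h: "integrable M ?h" using fourth_moment(1) by auto
  have le: "cmod (g a \<omega> * g b \<omega> * (g c \<omega> * g d \<omega>)) \<le> ?h \<omega>" for \<omega>
    unfolding norm_mult by (rule four_product_le) auto
  show i: "integrable M (\<lambda>\<omega>. g a \<omega> * g b \<omega> * (g c \<omega> * g d \<omega>))"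
    by (rule Bochner_Integration.integrable_bound[OF h]) 
      (use le in \<open>auto intro!: always_eventually intro: order.trans[OF _ abs_ge_self]\<close>)
  then show ic: "integrable M (\<lambda>\<omega>. cmod (g a \<omega> * g b \<omega> * (g c \<omega> * g d \<omega>)))" by (rule integrable_norm)
  have "(\<integral>\<omega>. cmod (g a \<omega> * g b \<omega> * (g c \<omega> * g d \<omega>)) \<partial>M) \<le> (\<integral>\<omega>. ?h \<omega> \<partial>M)"
    by (rule integral_mono[OF ic h le])
  also have "\<dots> = ((\<integral>\<omega>. cmod (g a \<omega>) ^ 4 \<partial>M) + (\<integral>\<omega>. cmod (g b \<omega>) ^ 4 \<partial>M) 
      + (\<integral>\<omega>. cmod (g c \<omega>) ^ 4 \<partial>M) + (\<integral>\<omega>. cmod (g d \<omega>) ^ 4 \<partial>M)) / 4"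
    using fourth_moment(1) by simp
  also have "\<dots> \<le> 3"
    using fourth_moment(2)[of a] fourth_moment(2)[of b] fourth_moment(2)[of c] fourth_moment(2)[of d] by simp
  finally show "(\<integral>\<omega>. cmod (g a \<omega> * g b \<omega> * (g c \<omega> * g d \<omega>)) \<partial>M) \<le> 3" .
  then show "cmod (\<integral>\<omega>. g a \<omega> * g b \<omega> * (g c \<omega> * g d \<omega>) \<partial>M) \<le> 3"
    using integral_norm_bound[of M "\<lambda>\<omega>. g a \<omega> * g b \<omega> * (g c \<omega> * g d \<omega>)"] by linarith
qed

text \<open>An instance of rotation invariance. A pure power of order 4 never arises in the pairing argument
  below, so the three cases are read off from the moments of the real and imaginary parts.\<close>

lemma power_mean_zero:
  assumes n: "n \<noteq> 0" and m: "1 \<le> m" "m \<le> 3"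
  shows "(\<integral>\<omega>. g n \<omega> ^ m \<partial>M) = 0"
proof -
  note G = g_nonzero[OF n, unfolded std_complex_gaussian_def]
  have s: "0 < sqrt (1 / 2 :: real)" by simp
  note mr = normal_moments[OF conjunct1[OF G] s] and mi = normal_moments[OF conjunct1[OF conjunct2[OF G]] s]
  have xy: "integrable M (\<lambda>\<omega>. Re (g n \<omega>) ^ i * Im (g n \<omega>) ^ j)"
    "(\<integral>\<omega>. Re (g n \<omega>) ^ i * Im (g n \<omega>) ^ j \<partial>M) = (\<integral>\<omega>. Re (g n \<omega>) ^ i \<partial>M) * (\<integral>\<omega>. Im (g n \<omega>) ^ j \<partial>M)" for i j
  proof -
    have "indep_var borel ((\<lambda>x. x ^ i) \<circ> (\<lambda>\<omega>. Re (g n \<omega>))) borel ((\<lambda>x. x ^ j) \<circ> (\<lambda>\<omega>. Im (g n \<omega>)))"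
      using G by (intro indep_var_compose[where ?M1.0 = borel and ?M2.0 = borel]) auto
    then have iv: "indep_var borel (\<lambda>\<omega>. Re (g n \<omega>) ^ i) borel (\<lambda>\<omega>. Im (g n \<omega>) ^ j)" by (simp add: o_def)
    show "integrable M (\<lambda>\<omega>. Re (g n \<omega>) ^ i * Im (g n \<omega>) ^ j)"
      by (rule indep_var_integrable[OF iv mr(1) mi(1)])
    show "(\<integral>\<omega>. Re (g n \<omega>) ^ i * Im (g n \<omega>) ^ j \<partial>M) = (\<integral>\<omega>. Re (g n \<omega>) ^ i \<partial>M) * (\<integral>\<omega>. Im (g n \<omega>) ^ j \<partial>M)"
      by (rule indep_var_lebesgue_integral[OF iv mr(1) mi(1)])
  qed
  have odd: "(\<integral>\<omega>. Re (g n \<omega>) \<partial>M) = 0" "(\<integral>\<omega>. Im (g n \<omega>) \<partial>M) = 0" 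
    "(\<integral>\<omega>. Re (g n \<omega>) ^ 3 \<partial>M) = 0" "(\<integral>\<omega>. Im (g n \<omega>) ^ 3 \<partial>M) = 0"
    using mr(2)[of 0] mi(2)[of 0] mr(2)[of 1] mi(2)[of 1] by (simp_all add: numeral_3_eq_3)
  have int: "integrable M (\<lambda>\<omega>. g n \<omega> ^ m)"
    using integrable_power_le_4[of m n] m 
    by (subst integrable_norm_iff[symmetric]) (auto simp: norm_power)
  have "Re (\<integral>\<omega>. g n \<omega> ^ m \<partial>M) = 0" "Im (\<integral>\<omega>. g n \<omega> ^ m \<partial>M) = 0"
  proof -
    have R: "Re (\<integral>\<omega>. g n \<omega> ^ m \<partial>M) = (\<integral>\<omega>. Re (g n \<omega> ^ m) \<partial>M)" 
      and I: "Im (\<integral>\<omega>. g n \<omega> ^ m \<partial>M) = (\<integral>\<omega>. Im (g n \<omega> ^ m) \<partial>M)"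
      using int by simp_all
    consider "m = 1" | "m = 2" | "m = 3" using m by linarith
    then have "(\<integral>\<omega>. Re (g n \<omega> ^ m) \<partial>M) = 0 \<and> (\<integral>\<omega>. Im (g n \<omega> ^ m) \<partial>M) = 0"
    proof cases
      case 1
      then show ?thesis using odd by simp
    next
      case 2
      have "Re (z ^ 2) = Re z ^ 2 - Im z ^ 2" "Im (z ^ 2) = 2 * (Re z ^ 1 * Im z ^ 1)" for z
        by (simp_all add: power2_eq_square)
      then show ?thesis using 2 mr(1)[of 2] mi(1)[of 2] mr(3) mi(3) xy[of 1 1] odd by simp
    next
      case 3
      have "Re (z ^ 3) = Re z ^ 3 - 3 * (Re z ^ 1 * Im z ^ 2)" "Im (z ^ 3) = 3 * (Re z ^ 2 * Im z ^ 1) - Im z ^ 3" for z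
        by (simp_all add: power2_eq_square power3_eq_cube algebra_simps)
      then show ?thesis using 3 mr(1)[of 3] mi(1)[of 3] xy[of 1 2] xy[of 2 1] odd by simp
    qed
    then show "Re (\<integral>\<omega>. g n \<omega> ^ m \<partial>M) = 0" "Im (\<integral>\<omega>. g n \<omega> ^ m \<partial>M) = 0" using R I by auto
  qed
  then show ?thesis by (simp add: complex_eq_iff)
qed

text \<open>A product of four coefficients has mean zero as soon as it contains a Gaussian \<open>g k\<close>, with
  \<open>k\<close> nonzero, that is not paired with its conjugate: its total contribution is a pure power, which is
  independent of the remaining factors.\<close>

lemma unpaired_product_mean_zero:
  fixes p :: "nat \<Rightarrow> int"
  assumes k: "k \<noteq> 0" and J: "J = {j \<in> {..<4}. \<bar>p j\<bar> = \<bar>k\<bar>}"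
    and Jk: "\<And>j. j \<in> J \<Longrightarrow> p j = k" and card: "1 \<le> card J" "card J \<le> 3"
  shows "(\<integral>\<omega>. (\<Prod>j<4. g (p j) \<omega>) \<partial>M) = 0"
proof -
  define I where "I = (\<lambda>j. \<bar>p j\<bar>) ` {..<4::nat}"
  define S where "S i = {j \<in> {..<4}. \<bar>p j\<bar> = i}" for i
  define f :: "int \<Rightarrow> complex \<Rightarrow> complex" where "f i x = (\<Prod>j\<in>S i. if 0 \<le> p j then x else cnj x)" for i x
  have f: "f i (g i \<omega>) = (\<Prod>j\<in>S i. g (p j) \<omega>)" if "\<omega> \<in> space M" for i \<omega>
    unfolding f_def
  proof (rule prod.cong[OF refl])
    fix j assume "j \<in> S i"
    then have i: "i = \<bar>p j\<bar>" by (auto simp: S_def)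
    show "(if 0 \<le> p j then g i \<omega> else cnj (g i \<omega>)) = g (p j) \<omega>"
      using g_minus[OF that, of "- p j"] i by auto
  qed
  have cS: "card (S i) \<le> 4" for i
    using card_mono[of "{..<4::nat}" "S i"] by (auto simp: S_def)
  have nf: "cmod (f i x) = cmod x ^ card (S i)" for i x
  proof -
    have "cmod (f i x) = (\<Prod>j\<in>S i. cmod x)"
      unfolding f_def prod_norm[symmetric] by (rule prod.cong) auto
    then show ?thesis by simp
  qed
  have fm [measurable]: "f i \<in> borel_measurable borel" for i
  proof -
    have "continuous_on UNIV (\<lambda>x. if 0 \<le> p j then x else cnj x)" for j
      by (cases "0 \<le> p j") (auto intro: continuous_intros)
    then have "continuous_on UNIV (f i)" unfolding f_def by (intro continuous_on_prod)
    then show ?thesis by (rule borel_measurable_continuous_onI)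
  qed
  have fi: "integrable M (\<lambda>\<omega>. f i (g i \<omega>))" for i
    using integrable_power_le_4[OF cS[of i], of i] by (subst integrable_norm_iff[symmetric]) (auto simp: nf)
  have "indep_vars (\<lambda>_. borel) g I" by (rule indep_vars_subset[OF g_indep]) (auto simp: I_def)
  then have iv: "indep_vars (\<lambda>_. borel) (\<lambda>i \<omega>. f i (g i \<omega>)) I" by (rule indep_vars_compose2) auto
  have "(\<integral>\<omega>. (\<Prod>j<4. g (p j) \<omega>) \<partial>M) = (\<integral>\<omega>. (\<Prod>i\<in>I. f i (g i \<omega>)) \<partial>M)"
  proof (rule Bochner_Integration.integral_cong[OF refl])
    fix \<omega> assume \<omega>: "\<omega> \<in> space M"
    have "(\<Prod>j<4. g (p j) \<omega>) = (\<Prod>i\<in>I. \<Prod>j\<in>S i. g (p j) \<omega>)"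
      unfolding I_def S_def by (rule prod.image_gen) simp
    then show "(\<Prod>j<4. g (p j) \<omega>) = (\<Prod>i\<in>I. f i (g i \<omega>))" by (simp add: f[OF \<omega>])
  qed
  also have "\<dots> = (\<Prod>i\<in>I. \<integral>\<omega>. f i (g i \<omega>) \<partial>M)"
    by (rule indep_vars_lebesgue_integral) (auto simp: I_def iv[unfolded I_def] fi)
  also have "\<dots> = 0"
  proof (rule prod_zero)
    show "finite I" by (simp add: I_def)
    have SJ: "S \<bar>k\<bar> = J" by (simp add: S_def J)
    have "(\<integral>\<omega>. f \<bar>k\<bar> (g \<bar>k\<bar> \<omega>) \<partial>M) = (\<integral>\<omega>. g k \<omega> ^ card J \<partial>M)"
      by (rule Bochner_Integration.integral_cong) (auto simp: f SJ Jk)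
    also have "\<dots> = 0" by (rule power_mean_zero[OF k card])
    finally have z: "(\<integral>\<omega>. f \<bar>k\<bar> (g \<bar>k\<bar> \<omega>) \<partial>M) = 0" .
    have "J \<noteq> {}" using card by auto
    then obtain j where j: "j < 4" "\<bar>p j\<bar> = \<bar>k\<bar>" by (auto simp: J)
    then have "\<bar>p j\<bar> \<in> I" unfolding I_def by (intro imageI) simp
    then have "\<bar>k\<bar> \<in> I" using j by simp
    with z show "\<exists>i\<in>I. (\<integral>\<omega>. f i (g i \<omega>) \<partial>M) = 0" by blast
  qed
  finally show ?thesis .
qed

text \<open>If \<open>k\<close> is nonzero, then \<open>- k\<close> is none of the other three frequencies, so \<open>g k\<close> is unpaired; and not
  all four frequencies can be equal to \<open>k\<close>. If \<open>k = 0\<close>, the same holds for \<open>n - k = n\<close>.\<close>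

lemma pair_orthogonal:
  assumes n: "n \<noteq> 0" and l: "l \<noteq> k" "l \<noteq> n - k"
  shows "(\<integral>\<omega>. g k \<omega> * g (n - k) \<omega> * (g (- l) \<omega> * g (l - n) \<omega>) \<partial>M) = 0"
proof -
  have main: "(\<integral>\<omega>. g k \<omega> * g (n - k) \<omega> * (g (- l) \<omega> * g (l - n) \<omega>) \<partial>M) = 0"
    if k: "k \<noteq> 0" and l: "l \<noteq> k" "l \<noteq> n - k" for k
  proof -
    define p where "p = (\<lambda>j::nat. if j = 0 then k else if j = 1 then n - k else if j = 2 then - l else l - n)"
    define J where "J = {j \<in> {..<4}. \<bar>p j\<bar> = \<bar>k\<bar>}"
    have lt4: "{..<4::nat} = {0, 1, 2, 3}" by auto
    have "(\<Prod>j<4. g (p j) \<omega>) = g k \<omega> * g (n - k) \<omega> * (g (- l) \<omega> * g (l - n) \<omega>)" for \<omega>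
      by (simp add: lt4 p_def mult.assoc)
    moreover have "(\<integral>\<omega>. (\<Prod>j<4. g (p j) \<omega>) \<partial>M) = 0"
    proof (rule unpaired_product_mean_zero[OF k J_def])
      show Jk: "p j = k" if "j \<in> J" for j
        using that n l by (auto simp: J_def lt4 p_def abs_eq_iff)
      have finJ: "finite J" and sub: "J \<subseteq> {..<4}" by (auto simp: J_def)
      have "0 \<in> J" by (simp add: J_def p_def)
      then have "J \<noteq> {}" by auto
      then show "1 \<le> card J" using finJ by (simp add: Suc_le_eq card_gt_0_iff)
      have "J \<noteq> {..<4}"
      proof
        assume "J = {..<4}"
        then have "p 1 = k" "p 2 = k" "p 3 = k" using Jk by auto
        then show False using k by (simp add: p_def)
      qed
      with sub have "J \<subset> {..<4}" by blast
      then have "card J < card {..<4::nat}" by (intro psubset_card_mono) auto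
      then show "card J \<le> 3" by simp
    qed
    ultimately show ?thesis by simp
  qed
  show ?thesis
  proof (cases "k = 0")
    case True
    then show ?thesis using main[of n] n l by (simp add: mult.commute)
  next
    case False
    then show ?thesis using main l by blast
  qed
qed

text \<open>Among the products \<open>g k * g (n - k)\<close>, with \<open>n\<close> nonzero and fixed, only those for \<open>k\<close> and
  \<open>n - k\<close>, which coincide, are correlated.\<close>

lemma second_moment_bound:
  assumes n: "n \<noteq> 0" and K: "finite K" and c: "\<And>k. cmod (c (n - k)) = cmod (c k)"
  shows "integrable M (\<lambda>\<omega>. (cmod (\<Sum>k\<in>K. c k * (g k \<omega> * g (n - k) \<omega>)))\<^sup>2)"
    and "(\<integral>\<omega>. (cmod (\<Sum>k\<in>K. c k * (g k \<omega> * g (n - k) \<omega>)))\<^sup>2 \<partial>M) \<le> 6 * (\<Sum>k\<in>K. (cmod (c k))\<^sup>2)"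
proof -
  define h where "h k l \<omega> = c k * cnj (c l) * (g k \<omega> * g (n - k) \<omega> * (g (- l) \<omega> * g (l - n) \<omega>))" for k l \<omega>
  have hi: "integrable M (h k l)" for k l
    unfolding h_def by (intro integrable_mult_right four_product)
  have eq: "(cmod (\<Sum>k\<in>K. c k * (g k \<omega> * g (n - k) \<omega>)))\<^sup>2 = Re (\<Sum>k\<in>K. \<Sum>l\<in>K. h k l \<omega>)" if \<omega>: "\<omega> \<in> space M" for \<omega>
  proof -
    let ?x = "\<Sum>k\<in>K. c k * (g k \<omega> * g (n - k) \<omega>)"
    have "complex_of_real ((cmod ?x)\<^sup>2) = ?x * cnj ?x" by (rule complex_norm_square)
    also have "\<dots> = (\<Sum>k\<in>K. \<Sum>l\<in>K. h k l \<omega>)"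
      unfolding cnj_sum sum_product h_def
      using g_minus[OF \<omega>] g_minus[OF \<omega>, of "n - _"] by (intro sum.cong) (simp_all add: mult_ac)
    finally have "Re (complex_of_real ((cmod ?x)\<^sup>2)) = Re (\<Sum>k\<in>K. \<Sum>l\<in>K. h k l \<omega>)" by (rule arg_cong)
    then show ?thesis by (simp only: Re_complex_of_real)
  qed
  have int: "integrable M (\<lambda>\<omega>. Re (\<Sum>k\<in>K. \<Sum>l\<in>K. h k l \<omega>))"
    by (intro integrable_Re Bochner_Integration.integrable_sum hi)
  show "integrable M (\<lambda>\<omega>. (cmod (\<Sum>k\<in>K. c k * (g k \<omega> * g (n - k) \<omega>)))\<^sup>2)"
    by (subst Bochner_Integration.integrable_cong[OF refl eq]) (assumption, rule int)
  have hz: "cmod (\<integral>\<omega>. h k l \<omega> \<partial>M) \<le> (if l = k \<or> l = n - k then 3 * (cmod (c k))\<^sup>2 else 0)" for k l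
  proof -
    have "(\<integral>\<omega>. h k l \<omega> \<partial>M) = c k * cnj (c l) * (\<integral>\<omega>. g k \<omega> * g (n - k) \<omega> * (g (- l) \<omega> * g (l - n) \<omega>) \<partial>M)"
      unfolding h_def by (rule integral_mult_right_zero)
    moreover have "cmod (c k) * cmod (c l) * cmod (\<integral>\<omega>. g k \<omega> * g (n - k) \<omega> * (g (- l) \<omega> * g (l - n) \<omega>) \<partial>M) \<le> 3 * (cmod (c k))\<^sup>2"
      if "l = k \<or> l = n - k"
    proof -
      have "cmod (c l) = cmod (c k)" using that c by auto
      then have "cmod (c k) * cmod (c l) * cmod (\<integral>\<omega>. g k \<omega> * g (n - k) \<omega> * (g (- l) \<omega> * g (l - n) \<omega>) \<partial>M)
          \<le> cmod (c k) * cmod (c k) * 3"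
        using four_product(2) by (simp add: mult_left_mono)
      then show ?thesis by (simp add: power2_eq_square)
    qed
    ultimately show ?thesis using pair_orthogonal[OF n, of l k] by (auto simp: norm_mult)
  qed
  have "(\<integral>\<omega>. (cmod (\<Sum>k\<in>K. c k * (g k \<omega> * g (n - k) \<omega>)))\<^sup>2 \<partial>M) = (\<integral>\<omega>. Re (\<Sum>k\<in>K. \<Sum>l\<in>K. h k l \<omega>) \<partial>M)"
    by (rule Bochner_Integration.integral_cong[OF refl eq])
  also have "\<dots> = Re (\<Sum>k\<in>K. \<Sum>l\<in>K. \<integral>\<omega>. h k l \<omega> \<partial>M)"
    using hi by simp
  also have "\<dots> \<le> cmod (\<Sum>k\<in>K. \<Sum>l\<in>K. \<integral>\<omega>. h k l \<omega> \<partial>M)" by (rule complex_Re_le_cmod)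
  also have "\<dots> \<le> (\<Sum>k\<in>K. \<Sum>l\<in>K. if l = k \<or> l = n - k then 3 * (cmod (c k))\<^sup>2 else 0)"
    by (intro sum_norm_le hz)
  also have "\<dots> \<le> (\<Sum>k\<in>K. 6 * (cmod (c k))\<^sup>2)"
  proof (rule sum_mono)
    fix k
    have "(\<Sum>l\<in>K. if l = k \<or> l = n - k then 3 * (cmod (c k))\<^sup>2 else 0) 
       = (\<Sum>l\<in>K \<inter> {k, n - k}. 3 * (cmod (c k))\<^sup>2)"
      by (rule sum.mono_neutral_cong_right) (use K in auto)
    also have "\<dots> = real (card (K \<inter> {k, n - k})) * (3 * (cmod (c k))\<^sup>2)" by simp
    also have "\<dots> \<le> 2 * (3 * (cmod (c k))\<^sup>2)"
    proof (intro mult_right_mono)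
      have "card (K \<inter> {k, n - k}) \<le> card {k, n - k}" by (intro card_mono) auto
      also have "\<dots> \<le> 2" by (simp add: card_insert_if)
      finally show "real (card (K \<inter> {k, n - k})) \<le> 2" by simp
    qed auto
    finally show "(\<Sum>l\<in>K. if l = k \<or> l = n - k then 3 * (cmod (c k))\<^sup>2 else 0) \<le> 6 * (cmod (c k))\<^sup>2" by simp
  qed
  finally show "(\<integral>\<omega>. (cmod (\<Sum>k\<in>K. c k * (g k \<omega> * g (n - k) \<omega>)))\<^sup>2 \<partial>M) \<le> 6 * (\<Sum>k\<in>K. (cmod (c k))\<^sup>2)"
    by (simp add: sum_distrib_left)
qed

end

section \<open>Data of logarithmically divergent mass\<close>

text \<open>Logarithms are dominated by powers.\<close>

lemma log_mass_sobolev: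
  assumes a: "(\<lambda>n. (cmod (a n))\<^sup>2 / (1 + ln (jbracket n)) powr (3 / 2)) summable_on UNIV" and e: "0 < e"
  shows "a \<in> sobolev (- e)"
  unfolding sobolev_iff
proof (rule summable_on_comparison_test)
  define c where "c = 4 * e / 3"
  have c: "0 < c" using e by (simp add: c_def)
  let ?K = "(1 + 1 / c) powr (3 / 2)"
  show "(\<lambda>n. ?K * ((cmod (a n))\<^sup>2 / (1 + ln (jbracket n)) powr (3 / 2))) summable_on UNIV"
    by (intro summable_on_cmult_right a)
  fix n
  have l0: "0 \<le> ln (jbracket n)" using jbracket_ge_1 by simp
  have "1 + ln (jbracket n) \<le> jbracket n powr c + jbracket n powr c / c"
    using jbracket_ge_1[of n] c by (intro add_mono ln_powr_bound) (auto intro: ge_one_powr_ge_zero)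
  also have "\<dots> = (1 + 1 / c) * jbracket n powr c" by (simp add: algebra_simps)
  finally have "(1 + ln (jbracket n)) powr (3 / 2) \<le> ((1 + 1 / c) * jbracket n powr c) powr (3 / 2)"
    using l0 by (intro powr_mono2) auto
  also have "\<dots> = ?K * jbracket n powr (2 * e)"
    using c by (simp add: powr_mult powr_powr c_def)
  finally have le: "(1 + ln (jbracket n)) powr (3 / 2) \<le> ?K * jbracket n powr (2 * e)" .
  have pos: "0 < (1 + ln (jbracket n)) powr (3 / 2)" using l0 by (simp add: add_nonneg_eq_0_iff)
  have j2: "0 < jbracket n powr (2 * e)" by simp
  have "1 / jbracket n powr (2 * e) \<le> ?K / (1 + ln (jbracket n)) powr (3 / 2)"
    using le pos j2 by (simp add: field_simps)
  then have "1 / jbracket n powr (2 * e) * (cmod (a n))\<^sup>2 \<le> ?K / (1 + ln (jbracket n)) powr (3 / 2) * (cmod (a n))\<^sup>2"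
    by (intro mult_right_mono) auto
  moreover have "(jbracket n powr - e)\<^sup>2 = 1 / jbracket n powr (2 * e)"
    by (simp add: power2_eq_square powr_add[symmetric] powr_minus_divide[symmetric])
  ultimately show "(jbracket n powr - e * cmod (a n))\<^sup>2 \<le> ?K * ((cmod (a n))\<^sup>2 / (1 + ln (jbracket n)) powr (3 / 2))"
    by (simp add: power_mult_distrib)
qed auto

text \<open>The mass up to frequency \<open>N\<close> is at most of order \<open>(ln N) powr (3 / 2)\<close>, and its square root is
  \<open>o(ln N)\<close>.\<close>

lemma log_mass_growth:
  assumes a: "(\<lambda>n. (cmod (a n))\<^sup>2 / (1 + ln (jbracket n)) powr (3 / 2)) summable_on UNIV" and \<eta>: "0 < \<eta>"
  shows "\<forall>\<^sub>F N in sequentially. L2_set (\<lambda>n. cmod (a n)) {- int N..int N} \<le> \<eta> * ln (real N)"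
proof -
  define U where "U = (\<Sum>\<^sub>\<infinity>n. (cmod (a n))\<^sup>2 / (1 + ln (jbracket n)) powr (3 / 2))"
  have pos: "0 < (1 + ln (jbracket n)) powr (3 / 2)" for n
  proof -
    have "0 \<le> ln (jbracket n)" using jbracket_ge_1 by simp
    then show ?thesis by (simp add: add_nonneg_eq_0_iff)
  qed
  have U0: "0 \<le> U" unfolding U_def by (intro infsum_nonneg) simp
  have bound: "L2_set (\<lambda>n. cmod (a n)) {- int N..int N} \<le> sqrt U * (1 + ln (2 * real N)) powr (3 / 4)" if N: "1 \<le> N" for N
  proof -
    let ?l = "1 + ln (2 * real N)"
    have l1: "0 \<le> ?l" using N by simp
    have "(\<Sum>n\<in>{- int N..int N}. (cmod (a n))\<^sup>2) 
        \<le> (\<Sum>n\<in>{- int N..int N}. ?l powr (3 / 2) * ((cmod (a n))\<^sup>2 / (1 + ln (jbracket n)) powr (3 / 2)))"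
    proof (rule sum_mono)
      fix n assume n: "n \<in> {- int N..int N}"
      have "jbracket n \<le> 2 * real N" using jbracket_le[of n] n N by auto
      then have "(1 + ln (jbracket n)) powr (3 / 2) \<le> ?l powr (3 / 2)"
        using jbracket_ge_1[of n] by (intro powr_mono2) auto
      then have "(cmod (a n))\<^sup>2 * ((1 + ln (jbracket n)) powr (3 / 2) / (1 + ln (jbracket n)) powr (3 / 2)) 
         \<le> (cmod (a n))\<^sup>2 * (?l powr (3 / 2) / (1 + ln (jbracket n)) powr (3 / 2))"
        using pos[of n] by (intro mult_left_mono divide_right_mono) auto
      then show "(cmod (a n))\<^sup>2 \<le> ?l powr (3 / 2) * ((cmod (a n))\<^sup>2 / (1 + ln (jbracket n)) powr (3 / 2))"
        using pos[of n] by (simp add: mult.commute)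
    qed
    also have "\<dots> = ?l powr (3 / 2) * (\<Sum>n\<in>{- int N..int N}. (cmod (a n))\<^sup>2 / (1 + ln (jbracket n)) powr (3 / 2))"
      by (simp add: sum_distrib_left)
    also have "\<dots> \<le> ?l powr (3 / 2) * U"
      unfolding U_def by (intro mult_left_mono finite_sum_le_infsum a) auto
    finally have "L2_set (\<lambda>n. cmod (a n)) {- int N..int N} \<le> sqrt (?l powr (3 / 2) * U)"
      unfolding L2_set_def by (rule real_sqrt_le_mono)
    also have "\<dots> = sqrt U * ?l powr (3 / 4)"
      by (simp add: real_sqrt_mult powr_half_sqrt[symmetric] powr_powr)
    finally show ?thesis .
  qed
  have "((\<lambda>N::nat. (1 + ln (2 * real N)) powr (3 / 4) / ln (real N)) \<longlongrightarrow> 0) sequentially"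
    by real_asymp
  then have "\<forall>\<^sub>F N in sequentially. (1 + ln (2 * real N)) powr (3 / 4) / ln (real N) < \<eta> / (sqrt U + 1)"
    using \<eta> U0 by (intro order_tendstoD(2)) (auto intro!: divide_pos_pos add_nonneg_pos)
  then show ?thesis
    using eventually_ge_at_top[of 2]
  proof eventually_elim
    case (elim N)
    then have ln: "0 < ln (real N)" by simp
    have "(1 + ln (2 * real N)) powr (3 / 4) \<le> \<eta> / (sqrt U + 1) * ln (real N)"
      using elim ln by (simp add: pos_divide_less_eq less_imp_le)
    then have "sqrt U * (1 + ln (2 * real N)) powr (3 / 4) \<le> sqrt U * (\<eta> / (sqrt U + 1) * ln (real N))"
      using U0 by (intro mult_left_mono) auto
    also have "\<dots> = (\<eta> * ln (real N)) * (sqrt U / (sqrt U + 1))" by simp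
    also have "\<dots> \<le> (\<eta> * ln (real N)) * 1"
    proof (rule mult_left_mono)
      have "0 \<le> sqrt U" using U0 by simp
      then have "0 < sqrt U + 1" by linarith
      then show "sqrt U / (sqrt U + 1) \<le> 1" by (subst divide_le_eq_1_pos) auto
    qed (use \<eta> ln in auto)
    finally show ?case using bound[of N] elim by simp
  qed
qed

section \<open>Frequency sums\<close>

lemma sum_jbracket_pair_le:
  assumes p: "1 < p" and F: "finite F"
  shows "(\<Sum>k\<in>F. jbracket k powr (- p) + jbracket (n - k) powr (- p)) \<le> 2 * (\<Sum>\<^sub>\<infinity>k. jbracket k powr (- p))"
proof -
  note s = summable_jbracket_powr[OF p]
  have "(\<Sum>k\<in>F. jbracket k powr (- p)) \<le> (\<Sum>\<^sub>\<infinity>k. jbracket k powr (- p))"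
    by (rule finite_sum_le_infsum[OF s F]) auto
  moreover have "(\<Sum>k\<in>F. jbracket (n - k) powr (- p)) \<le> (\<Sum>\<^sub>\<infinity>k. jbracket (n - k) powr (- p))"
    by (rule finite_sum_le_infsum[OF _ F]) (use s summable_on_int_reflect[of "\<lambda>k. jbracket k powr (- p)" n] in auto)
  ultimately show ?thesis
    using infsum_int_reflect[of "\<lambda>k. jbracket k powr (- p)" n] by (simp add: sum.distrib)
qed

text \<open>In both of the next lemmas the larger factor provides the decay in the parameter \<open>m\<close>, and what
  is left of it is replaced by the smaller factor to obtain a summable power.\<close>

lemma inverse_product_tail:
  fixes x y m :: real
  assumes "1 \<le> x" "1 \<le> y" "1 \<le> m" "m \<le> max x y"
  shows "1 / (x * y) \<le> m powr (- (1 / 2)) * (x powr (- (3 / 2)) + y powr (- (3 / 2)))"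
proof -
  have *: "1 / (x * y) \<le> m powr (- (1 / 2)) * x powr (- (3 / 2))" 
    if x: "1 \<le> x" and xy: "x \<le> y" and my: "m \<le> y" for x y :: real
  proof -
    have "y powr (- (1 / 2)) * y powr (- (1 / 2)) = y powr (- 1)" by (simp flip: powr_add)
    then have "1 / (x * y) = x powr (- 1) * (y powr (- (1 / 2)) * y powr (- (1 / 2)))"
      using x xy by (simp add: powr_minus_divide)
    also have "\<dots> \<le> x powr (- 1) * (m powr (- (1 / 2)) * x powr (- (1 / 2)))"
      using x xy my assms(3) by (intro mult_left_mono mult_mono powr_mono2') auto
    also have "\<dots> = m powr (- (1 / 2)) * (x powr (- 1) * x powr (- (1 / 2)))"
      by (simp only: mult.left_commute)
    also have "x powr (- 1) * x powr (- (1 / 2)) = x powr (- (3 / 2))"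
      by (subst powr_add[symmetric]) simp
    finally show ?thesis .
  qed
  show ?thesis
  proof (cases "x \<le> y")
    case True
    then have "1 / (x * y) \<le> m powr (- (1 / 2)) * x powr (- (3 / 2))" using * assms by auto
    also have "\<dots> \<le> m powr (- (1 / 2)) * (x powr (- (3 / 2)) + y powr (- (3 / 2)))" by (intro mult_left_mono) auto
    finally show ?thesis .
  next
    case False
    then have "1 / (y * x) \<le> m powr (- (1 / 2)) * y powr (- (3 / 2))" using *[of y x] assms by auto
    also have "\<dots> \<le> m powr (- (1 / 2)) * (x powr (- (3 / 2)) + y powr (- (3 / 2)))" by (intro mult_left_mono) auto
    finally show ?thesis by (simp add: mult.commute)
  qed
qed

lemma inverse_product_split:
  fixes x y m d :: real
  assumes "1 \<le> x" "1 \<le> y" "0 < m" "m \<le> x + y" and d: "0 < d" "d < 1"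
  shows "1 / (x * y) \<le> 2 * m powr (d - 1) * (x powr (- (1 + d)) + y powr (- (1 + d)))"
proof -
  have *: "1 / (x * y) \<le> 2 * m powr (d - 1) * x powr (- (1 + d))" 
    if x: "1 \<le> x" and xy: "x \<le> y" and my: "m \<le> x + y" for x y :: real
  proof -
    have "m powr (1 - d) \<le> (2 * y) powr (1 - d)" using assms(3) my xy d by (intro powr_mono2) auto
    also have "\<dots> = 2 powr (1 - d) * y powr (1 - d)" using x xy by (simp add: powr_mult)
    also have "\<dots> \<le> 2 * y powr (1 - d)" using d powr_mono[of "1 - d" 1 2] by (intro mult_right_mono) auto
    finally have "m powr (d - 1) * m powr (1 - d) \<le> m powr (d - 1) * (2 * y powr (1 - d))"
      by (intro mult_left_mono) auto
    then have "1 \<le> m powr (d - 1) * (2 * y powr (1 - d))" using assms(3) by (simp add: powr_add[symmetric])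
    then have "1 * (x powr (- 1) * y powr (- 1)) \<le> m powr (d - 1) * (2 * y powr (1 - d)) * (x powr (- 1) * y powr (- 1))"
      by (intro mult_right_mono) auto
    also have "\<dots> = 2 * m powr (d - 1) * (x powr (- 1) * (y powr (1 - d) * y powr (- 1)))"
      by (simp only: mult_ac)
    also have "y powr (1 - d) * y powr (- 1) = y powr (- d)"
      by (subst powr_add[symmetric]) simp
    also have "2 * m powr (d - 1) * (x powr (- 1) * y powr (- d)) \<le> 2 * m powr (d - 1) * (x powr (- 1) * x powr (- d))"
      using x xy d by (intro mult_left_mono powr_mono2') auto
    also have "x powr (- 1) * x powr (- d) = x powr (- (1 + d))"
      by (subst powr_add[symmetric]) simp
    finally show ?thesis using x xy by (simp add: powr_minus divide_inverse)
  qed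
  show ?thesis
  proof (cases "x \<le> y")
    case True
    then have "1 / (x * y) \<le> 2 * m powr (d - 1) * x powr (- (1 + d))" using * assms by auto
    also have "\<dots> \<le> 2 * m powr (d - 1) * (x powr (- (1 + d)) + y powr (- (1 + d)))" by (intro mult_left_mono) auto
    finally show ?thesis .
  next
    case False
    then have "1 / (y * x) \<le> 2 * m powr (d - 1) * y powr (- (1 + d))" using *[of y x] assms by auto
    also have "\<dots> \<le> 2 * m powr (d - 1) * (x powr (- (1 + d)) + y powr (- (1 + d)))" by (intro mult_left_mono) auto
    finally show ?thesis by (simp add: mult.commute)
  qed
qed

definition freqs :: "nat \<Rightarrow> int \<Rightarrow> int set" where
  "freqs N n = {k. \<bar>k\<bar> \<le> int N \<and> \<bar>n - k\<bar> \<le> int N}"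

lemma finite_freqs [simp]: "finite (freqs N n)"
  by (rule finite_subset[of _ "{- int N..int N}"]) (auto simp: freqs_def)

lemma freqs_mono: "K \<le> N \<Longrightarrow> freqs K n \<subseteq> freqs N n"
  by (auto simp: freqs_def)

lemma filterlim_freqs: 
  assumes \<rho>: "\<And>j :: nat. j \<le> \<rho> j"
  shows "filterlim (\<lambda>j. freqs (\<rho> j) n) (finite_subsets_at_top UNIV) sequentially"
  unfolding filterlim_finite_subsets_at_top
proof (intro allI impI)
  fix X :: "int set" assume X: "finite X \<and> X \<subseteq> UNIV"
  define N where "N = Max (insert 0 ((\<lambda>k. nat (\<bar>k\<bar> + \<bar>n - k\<bar>)) ` X))"
  have N: "nat (\<bar>k\<bar> + \<bar>n - k\<bar>) \<le> N" if "k \<in> X" for k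
    unfolding N_def using X that by (intro Max_ge) auto
  show "\<forall>\<^sub>F j in sequentially. finite (freqs (\<rho> j) n) \<and> X \<subseteq> freqs (\<rho> j) n \<and> freqs (\<rho> j) n \<subseteq> UNIV"
  proof (rule eventually_sequentiallyI[of N])
    fix j assume "N \<le> j"
    then have "N \<le> \<rho> j" using \<rho>[of j] by simp
    then have "k \<in> freqs (\<rho> j) n" if "k \<in> X" for k
      using N[OF that] by (simp add: freqs_def nat_le_iff) linarith
    then show "finite (freqs (\<rho> j) n) \<and> X \<subseteq> freqs (\<rho> j) n \<and> freqs (\<rho> j) n \<subseteq> UNIV"
      by auto
  qed
qed

definition zeta :: "real \<Rightarrow> real" where
  "zeta p = (\<Sum>\<^sub>\<infinity>k. jbracket k powr (- p))"

lemma zeta_nonneg: "0 \<le> zeta p"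
  unfolding zeta_def by (rule infsum_nonneg) simp

lemma sum_freqs_le:
  assumes d: "0 < d" "d < 1"
  shows "(\<Sum>k\<in>freqs N n. 1 / (jbracket k * jbracket (n - k))) \<le> 4 * zeta (1 + d) * jbracket n powr (d - 1)"
proof -
  have "(\<Sum>k\<in>freqs N n. 1 / (jbracket k * jbracket (n - k))) 
     \<le> (\<Sum>k\<in>freqs N n. 2 * jbracket n powr (d - 1) * (jbracket k powr (- (1 + d)) + jbracket (n - k) powr (- (1 + d))))"
  proof (intro sum_mono inverse_product_split jbracket_ge_1 jbracket_pos d)
    show "jbracket n \<le> jbracket k + jbracket (n - k)" for k using jbracket_add[of k "n - k"] by simp
  qed
  also have "\<dots> = 2 * jbracket n powr (d - 1) * (\<Sum>k\<in>freqs N n. jbracket k powr (- (1 + d)) + jbracket (n - k) powr (- (1 + d)))"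
    by (simp add: sum_distrib_left)
  also have "\<dots> \<le> 2 * jbracket n powr (d - 1) * (2 * zeta (1 + d))"
    unfolding zeta_def using d by (intro mult_left_mono sum_jbracket_pair_le) auto
  finally show ?thesis by (simp add: mult_ac)
qed

lemma sum_freqs_tail_le:
  "(\<Sum>k\<in>freqs N n - freqs K n. 1 / (jbracket k * jbracket (n - k))) \<le> 2 * zeta (3 / 2) * (1 + real K) powr (- (1 / 2))"
proof -
  have "(\<Sum>k\<in>freqs N n - freqs K n. 1 / (jbracket k * jbracket (n - k)))
     \<le> (\<Sum>k\<in>freqs N n - freqs K n. (1 + real K) powr (- (1 / 2)) * (jbracket k powr (- (3 / 2)) + jbracket (n - k) powr (- (3 / 2))))"
  proof (intro sum_mono inverse_product_tail jbracket_ge_1)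
    fix k assume "k \<in> freqs N n - freqs K n"
    then have "1 + int K \<le> \<bar>k\<bar> \<or> 1 + int K \<le> \<bar>n - k\<bar>" by (auto simp: freqs_def)
    then have "1 + real K \<le> \<bar>real_of_int k\<bar> \<or> 1 + real K \<le> \<bar>real_of_int (n - k)\<bar>"
      by linarith
    then show "1 + real K \<le> max (jbracket k) (jbracket (n - k))"
      using abs_le_jbracket[of k] abs_le_jbracket[of "n - k"] by linarith
  qed simp
  also have "\<dots> = (1 + real K) powr (- (1 / 2)) * (\<Sum>k\<in>freqs N n - freqs K n. jbracket k powr (- (3 / 2)) + jbracket (n - k) powr (- (3 / 2)))"
    by (simp add: sum_distrib_left)
  also have "\<dots> \<le> (1 + real K) powr (- (1 / 2)) * (2 * zeta (3 / 2))"
    unfolding zeta_def by (intro mult_left_mono sum_jbracket_pair_le) auto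
  finally show ?thesis by (simp add: mult_ac)
qed

text \<open>The term with frequencies \<open>k\<close> and \<open>n - k\<close> of the square of the free evolution oscillates in time
  with frequency \<open>phi k + phi (n - k)\<close>, which decays in \<open>k\<close>. Differentiation in time therefore improves
  the summability: the Lipschitz constant in time is given by sums with the following weights, which
  converge absolutely, while the square itself exists only by cancellation.\<close>

definition phase_weight :: "int \<Rightarrow> int \<Rightarrow> real" where
  "phase_weight n k = jbracket k powr (- (3 / 2)) * jbracket (n - k) powr (- (1 / 2))"

definition phase_mass :: "int \<Rightarrow> real" where
  "phase_mass n = (\<Sum>\<^sub>\<infinity>k. phase_weight n k)"

lemma phase_weight_pos: "0 < phase_weight n k"
  by (simp add: phase_weight_def)

lemma phase_weight:
  assumes e: "0 < e" "e \<le> 1 / 32"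
  shows phase_weight_summable: "phase_weight n summable_on UNIV"
    and phase_mass_sobolev: "(\<lambda>n. of_real (phase_mass n)) \<in> sobolev (- e)"
proof -
  define a b where "a = (\<lambda>k. complex_of_real (jbracket k powr (- (1 / 2))))" 
    and "b = (\<lambda>k. complex_of_real (jbracket k powr (- (3 / 2))))"
  have a: "a \<in> sobolev (- e)"
  proof -
    have "(jbracket n powr (- e) * cmod (a n))\<^sup>2 = jbracket n powr (- (1 + 2 * e))" for n
      by (simp add: a_def power2_eq_square mult_ac)
        (simp only: powr_add[symmetric] mult.assoc[symmetric], simp add: algebra_simps)
    then show ?thesis using summable_jbracket_powr[of "1 + 2 * e"] e unfolding sobolev_iff by simp
  qed
  have b: "b \<in> sobolev (3 / 4)"
    using summable_jbracket_powr[of "3 / 2"]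
    by (simp add: sobolev_iff b_def power2_eq_square powr_add[symmetric])
  note f = fprod_sobolev[of e "3/4" a b, OF _ _ a b]
  have pw: "complex_of_real (phase_weight n k) = b k * a (n - k)" for n k
    by (simp add: phase_weight_def a_def b_def)
  have "(\<lambda>k. cmod (a (n - k) * b (n - (n - k)))) summable_on UNIV" for n
    using f(1)[of n] e summable_on_int_reflect[of "\<lambda>k. cmod (a k * b (n - k))" n] by simp
  then have "(\<lambda>k. cmod (complex_of_real (phase_weight n k))) summable_on UNIV" for n
    unfolding pw by (simp add: mult.commute)
  then show s: "phase_weight n summable_on UNIV" for n
    using phase_weight_pos by (simp add: less_imp_le cong: summable_on_cong)
  have "complex_of_real (phase_mass n) = fprod b a n" for n
    unfolding phase_mass_def fprod_def pw[symmetric]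
    using has_sum_of_real[OF has_sum_infsum[OF s[of n]], where ?'a = complex] by (simp add: infsumI)
  then show "(\<lambda>n. complex_of_real (phase_mass n)) \<in> sobolev (- e)"
    using f(2) e fprod_commute[of a b] by simp
qed

section \<open>The limit square of the free evolution\<close>

definition pair_coef :: "real \<Rightarrow> int \<Rightarrow> int \<Rightarrow> complex" where
  "pair_coef t n k = exp (- (\<i> * of_real t * of_real (phi k + phi (n - k)))) 
     * of_real (jbracket k powr (- (1 / 2)) * jbracket (n - k) powr (- (1 / 2)))"

lemma cmod_pair_coef: "cmod (pair_coef t n k) = jbracket k powr (- (1 / 2)) * jbracket (n - k) powr (- (1 / 2))"
  using norm_exp_i_times[of "- (t * (phi k + phi (n - k)))"]
  by (simp add: pair_coef_def norm_mult mult.assoc abs_mult)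

lemma cmod_pair_coef_sq: "(cmod (pair_coef t n k))\<^sup>2 = 1 / (jbracket k * jbracket (n - k))"
proof -
  have "x powr (- (1 / 2)) * x powr (- (1 / 2)) = 1 / x" if "0 < x" for x :: real
    using that by (simp add: powr_minus_divide flip: powr_add)
  from this[of "jbracket k"] this[of "jbracket (n - k)"] show ?thesis
    unfolding cmod_pair_coef power2_eq_square by (simp add: mult_ac)
qed

lemma pair_coef_lipschitz:
  "cmod (pair_coef t n k - pair_coef t' n k) \<le> \<bar>t - t'\<bar> * (phase_weight n k + phase_weight n (n - k))"
proof -
  let ?p = "phi k + phi (n - k)" and ?j = "jbracket k powr (- (1 / 2)) * jbracket (n - k) powr (- (1 / 2))"
  have "cmod (exp (\<i> * of_real (- (t * ?p))) - exp (\<i> * of_real (- (t' * ?p)))) \<le> \<bar>- (t * ?p) - - (t' * ?p)\<bar>"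
    by (rule norm_cis_diff_le)
  also have "\<dots> = \<bar>t - t'\<bar> * \<bar>?p\<bar>"
    by (simp flip: abs_mult add: algebra_simps abs_minus_commute)
  also have "\<dots> \<le> \<bar>t - t'\<bar> * (jbracket k powr (- 1) + jbracket (n - k) powr (- 1))"
    using abs_phi_le[of k] abs_phi_le[of "n - k"] abs_triangle_ineq[of "phi k" "phi (n - k)"]
    by (intro mult_left_mono) (auto simp: powr_minus_divide less_imp_le)
  finally have 1: "cmod (exp (\<i> * of_real (- (t * ?p))) - exp (\<i> * of_real (- (t' * ?p)))) 
      \<le> \<bar>t - t'\<bar> * (jbracket k powr (- 1) + jbracket (n - k) powr (- 1))" .
  have "cmod (pair_coef t n k - pair_coef t' n k) 
     = cmod (exp (\<i> * of_real (- (t * ?p))) - exp (\<i> * of_real (- (t' * ?p)))) * ?j"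
    by (simp add: pair_coef_def norm_mult mult.assoc abs_mult flip: left_diff_distrib)
  also have "\<dots> \<le> \<bar>t - t'\<bar> * (jbracket k powr (- 1) + jbracket (n - k) powr (- 1)) * ?j"
    by (intro mult_right_mono 1) auto
  also have "\<dots> = \<bar>t - t'\<bar> * (phase_weight n k + phase_weight n (n - k))"
  proof -
    have "x powr (- 1) * x powr (- (1 / 2)) = x powr (- (3 / 2))" for x :: real
      by (subst powr_add[symmetric]) simp
    then have "phase_weight n k + phase_weight n (n - k) 
      = (jbracket k powr (- 1) * jbracket k powr (- (1 / 2))) * jbracket (n - k) powr (- (1 / 2))
        + (jbracket (n - k) powr (- 1) * jbracket (n - k) powr (- (1 / 2))) * jbracket k powr (- (1 / 2))"
      by (simp only: phase_weight_def diff_diff_eq2 add_diff_cancel_left')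
    also have "\<dots> = (jbracket k powr (- 1) + jbracket (n - k) powr (- 1)) * ?j"
      by (simp only: distrib_right distrib_left mult_ac)
    finally have "(jbracket k powr (- 1) + jbracket (n - k) powr (- 1)) * ?j = phase_weight n k + phase_weight n (n - k)" ..
    then show ?thesis by (simp only: mult.assoc)
  qed
  finally show ?thesis .
qed

lemma trunc_square_hermitian:
  assumes "hermitian a"
  shows "trunc_square N a (- n) = cnj (trunc_square N a n)"
  unfolding trunc_square_def cnj_sum
proof (rule sum.reindex_bij_witness[of _ uminus uminus])
  have h: "a (- m) = cnj (a m)" for m using assms by (simp add: hermitian_def)
  fix k
  have "- n - k = - (n - - k)" by simp
  then have "a (- n - k) = cnj (a (n - - k))" by (simp only: h)
  then show "cnj (a (- k) * a (n - - k)) = a k * a (- n - k)" by (simp add: h)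
qed auto

lemma weighted_cauchy_schwarz:
  fixes b x :: "int \<Rightarrow> real"
  assumes b: "b summable_on UNIV" and bx2: "(\<lambda>k. b k * (x k)\<^sup>2) summable_on UNIV" 
    and b0: "\<And>k. 0 \<le> b k" and x0: "\<And>k. 0 \<le> x k"
  shows "(\<lambda>k. b k * x k) summable_on UNIV"
    and "(\<Sum>\<^sub>\<infinity>k. b k * x k)\<^sup>2 \<le> infsum b UNIV * (\<Sum>\<^sub>\<infinity>k. b k * (x k)\<^sup>2)"
proof -
  let ?B = "infsum b UNIV" and ?V = "\<Sum>\<^sub>\<infinity>k. b k * (x k)\<^sup>2"
  have BV: "0 \<le> ?B" "0 \<le> ?V" using b0 by (auto intro!: infsum_nonneg)
  have le: "(\<Sum>k\<in>F. b k * x k) \<le> sqrt (?B * ?V)" if F: "finite F" for F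
  proof -
    have "(\<Sum>k\<in>F. b k * x k) = (\<Sum>k\<in>F. \<bar>sqrt (b k)\<bar> * \<bar>sqrt (b k) * x k\<bar>)"
      using b0 x0 by (intro sum.cong) (auto simp: abs_mult simp flip: mult.assoc)
    also have "\<dots> \<le> L2_set (\<lambda>k. sqrt (b k)) F * L2_set (\<lambda>k. sqrt (b k) * x k) F"
      by (rule L2_set_mult_ineq)
    also have "\<dots> = sqrt (\<Sum>k\<in>F. b k) * sqrt (\<Sum>k\<in>F. b k * (x k)\<^sup>2)"
      using b0 by (simp add: L2_set_def power_mult_distrib)
    also have "\<dots> \<le> sqrt ?B * sqrt ?V"
      using F b0 BV by (intro mult_mono real_sqrt_le_mono finite_sum_le_infsum b bx2) (auto intro!: sum_nonneg)
    finally show ?thesis by (simp add: real_sqrt_mult)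
  qed
  show s: "(\<lambda>k. b k * x k) summable_on UNIV"
    by (rule nonneg_bdd_above_summable_on) (use b0 x0 in \<open>auto intro!: bdd_aboveI2 le\<close>)
  have "(\<Sum>\<^sub>\<infinity>k. b k * x k) \<le> sqrt (?B * ?V)"
    by (rule infsum_le_finite_sums[OF s]) (simp add: le)
  moreover have "0 \<le> (\<Sum>\<^sub>\<infinity>k. b k * x k)" using b0 x0 by (intro infsum_nonneg) simp
  ultimately have "(\<Sum>\<^sub>\<infinity>k. b k * x k)\<^sup>2 \<le> (sqrt (?B * ?V))\<^sup>2" by (intro power_mono)
  then show "(\<Sum>\<^sub>\<infinity>k. b k * x k)\<^sup>2 \<le> ?B * ?V" using BV by simp
qed

lemma affine_class_subset:
  assumes z: "z \<in> sobolev (- r)" and r: "- r \<le> s"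
  shows "affine_class (\<lambda>t. S_prop t z) s \<subseteq> C_sobolev (- r)"
proof
  fix u assume "u \<in> affine_class (\<lambda>t. S_prop t z) s"
  then obtain v where v: "v \<in> C_sobolev s" "u = (\<lambda>t n. S_prop t z n + v t n)" by (auto simp: affine_class_def)
  have vs: "v t \<in> sobolev s" for t using v by (simp add: C_sobolev_def)
  have vr: "v t \<in> sobolev (- r)" for t using sobolev_mono(1)[OF vs r] .
  have "((\<lambda>t'. sobolev_norm (- r) (\<lambda>n. u t' n - u t n)) \<longlongrightarrow> 0) (at t)" for t
  proof (rule Lim_null_comparison)
    show "\<forall>\<^sub>F t' in at t. norm (sobolev_norm (- r) (\<lambda>n. u t' n - u t n)) 
        \<le> \<bar>t' - t\<bar> * sobolev_norm (- r) z + sobolev_norm s (\<lambda>n. v t' n - v t n)"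
    proof (intro always_eventually allI)
      fix t'
      have eq: "u t' n - u t n = (S_prop t' z n - S_prop t z n) + (v t' n - v t n)" for n by (simp add: v)
      have "sobolev_norm (- r) (\<lambda>n. u t' n - u t n) 
          \<le> sobolev_norm (- r) (\<lambda>n. S_prop t' z n - S_prop t z n) + sobolev_norm (- r) (\<lambda>n. v t' n - v t n)"
        unfolding eq by (intro sobolev_add(3) sobolev_diff(1) S_prop_sobolev z vr)
      also have "\<dots> \<le> \<bar>t' - t\<bar> * sobolev_norm (- r) z + sobolev_norm s (\<lambda>n. v t' n - v t n)"
        by (intro add_mono S_prop_sobolev(3) z sobolev_mono(2) sobolev_diff(1) vs r)
      finally show "norm (sobolev_norm (- r) (\<lambda>n. u t' n - u t n)) 
        \<le> \<bar>t' - t\<bar> * sobolev_norm (- r) z + sobolev_norm s (\<lambda>n. v t' n - v t n)" by simp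
    qed
    have "((\<lambda>t'. \<bar>t' - t\<bar> * sobolev_norm (- r) z + sobolev_norm s (\<lambda>n. v t' n - v t n)) \<longlongrightarrow> \<bar>t - t\<bar> * sobolev_norm (- r) z + 0) (at t)"
      using v by (intro tendsto_intros) (auto simp: C_sobolev_def)
    then show "((\<lambda>t'. \<bar>t' - t\<bar> * sobolev_norm (- r) z + sobolev_norm s (\<lambda>n. v t' n - v t n)) \<longlongrightarrow> 0) (at t)" by simp
  qed
  moreover have "u t \<in> sobolev (- r)" for t unfolding v by (intro sobolev_add(1) S_prop_sobolev z vr)
  ultimately show "u \<in> C_sobolev (- r)" by (simp add: C_sobolev_def)
qed

context gaussian_data
begin

definition pair :: "int \<Rightarrow> int \<Rightarrow> 'a \<Rightarrow> complex" where
  "pair n k \<omega> = g k \<omega> * g (n - k) \<omega>"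

lemma pair_measurable [measurable]: "pair n k \<in> borel_measurable M"
  unfolding pair_def[abs_def] by measurable

lemma pair_swap: "pair n (n - k) \<omega> = pair n k \<omega>"
  by (simp add: pair_def mult.commute)

definition trunc :: "nat \<Rightarrow> real \<Rightarrow> int \<Rightarrow> 'a \<Rightarrow> complex" where
  "trunc N t n \<omega> = trunc_square N (free_evol g \<omega> t) n"

lemma trunc_eq: "trunc N t n \<omega> = (\<Sum>k\<in>freqs N n. pair_coef t n k * pair n k \<omega>)"
  unfolding trunc_def trunc_square_def freqs_def[symmetric]
proof (rule sum.cong[OF refl])
  fix k
  have "exp (- (\<i> * of_real t * of_real (phi k))) * exp (- (\<i> * of_real t * of_real (phi (n - k)))) 
      = exp (- (\<i> * of_real t * of_real (phi k + phi (n - k))))"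
    unfolding exp_add[symmetric] by (simp add: algebra_simps)
  then show "free_evol g \<omega> t k * free_evol g \<omega> t (n - k) = pair_coef t n k * pair n k \<omega>"
    by (simp add: free_evol_def S_prop_def random_data_def pair_coef_def pair_def powr_minus_divide divide_simps)
qed

lemma trunc_joint_measurable: "(\<lambda>(t, \<omega>). trunc N t n \<omega>) \<in> borel_measurable (borel \<Otimes>\<^sub>M M)"
proof -
  have [measurable]: "(\<lambda>t. pair_coef t n k) \<in> borel_measurable borel" for k
    unfolding pair_coef_def by (intro borel_measurable_continuous_onI continuous_intros)
  show ?thesis unfolding trunc_eq by measurable
qed

lemma trunc_measurable [measurable]: "trunc N t n \<in> borel_measurable M"
  unfolding trunc_eq[abs_def] by measurable

lemma trunc_second_moment:
  assumes n: "n \<noteq> 0"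
  shows "integrable M (\<lambda>\<omega>. (cmod (trunc N t n \<omega>))\<^sup>2)"
    and "0 < d \<Longrightarrow> d < 1 \<Longrightarrow> (\<integral>\<omega>. (cmod (trunc N t n \<omega>))\<^sup>2 \<partial>M) \<le> 24 * zeta (1 + d) * jbracket n powr (d - 1)"
    and "K \<le> N \<Longrightarrow> (\<integral>\<omega>. (cmod (trunc N t n \<omega> - trunc K t n \<omega>))\<^sup>2 \<partial>M) \<le> 12 * zeta (3 / 2) * (1 + real K) powr (- (1 / 2))"
    and "integrable M (\<lambda>\<omega>. (cmod (trunc N t n \<omega> - trunc K t n \<omega>))\<^sup>2)"
proof -
  have sym: "cmod (pair_coef t n (n - k)) = cmod (pair_coef t n k)" for k
    by (simp add: cmod_pair_coef)
  note m = second_moment_bound[where c = "pair_coef t n", OF n _ sym, folded pair_def]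
  show "integrable M (\<lambda>\<omega>. (cmod (trunc N t n \<omega>))\<^sup>2)" for N
    unfolding trunc_eq by (rule m(1)) simp
  then show "integrable M (\<lambda>\<omega>. (cmod (trunc N t n \<omega> - trunc K t n \<omega>))\<^sup>2)"
    by (rule_tac Bochner_Integration.integrable_bound[of _ "\<lambda>\<omega>. 2 * (cmod (trunc N t n \<omega>))\<^sup>2 + 2 * (cmod (trunc K t n \<omega>))\<^sup>2"])
      (use cmod_diff_sq_le[of "trunc N t n _" "trunc K t n _" 0] in auto)
  show "(\<integral>\<omega>. (cmod (trunc N t n \<omega>))\<^sup>2 \<partial>M) \<le> 24 * zeta (1 + d) * jbracket n powr (d - 1)" if "0 < d" "d < 1"
    using m(2)[of "freqs N n"] sum_freqs_le[OF that, of n N] unfolding trunc_eq cmod_pair_coef_sq by simp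
  assume KN: "K \<le> N"
  have "trunc N t n \<omega> - trunc K t n \<omega> = (\<Sum>k\<in>freqs N n - freqs K n. pair_coef t n k * pair n k \<omega>)" for \<omega>
    unfolding trunc_eq using freqs_mono[OF KN] by (simp add: sum_diff)
  then show "(\<integral>\<omega>. (cmod (trunc N t n \<omega> - trunc K t n \<omega>))\<^sup>2 \<partial>M) \<le> 12 * zeta (3 / 2) * (1 + real K) powr (- (1 / 2))"
    using m(2)[of "freqs N n - freqs K n"] sum_freqs_tail_le[where N = N and n = n and K = K] 
    unfolding cmod_pair_coef_sq by simp
qed

text \<open>Along the sequence \<open>16 ^ j\<close> the mean square increments decay like \<open>4 ^ (- j)\<close>, fast enough
  for almost sure convergence.\<close>

lemma AE_trunc_converges:
  assumes n: "n \<noteq> 0"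
  shows "AE \<omega> in M. convergent (\<lambda>j. trunc (16 ^ j) 0 n \<omega>)"
proof -
  define c where "c = 12 * zeta (3 / 2)"
  have c0: "0 \<le> c" by (simp add: c_def zeta_nonneg)
  define \<Delta> where "\<Delta> j \<omega> = trunc (16 ^ Suc j) 0 n \<omega> - trunc (16 ^ j) 0 n \<omega>" for j \<omega>
  define f where "f j \<omega> = (1 / 2) ^ j + 2 ^ j * (cmod (\<Delta> j \<omega>))\<^sup>2" for j \<omega>
  have \<Delta>i: "integrable M (\<lambda>\<omega>. (cmod (\<Delta> j \<omega>))\<^sup>2)" for j
    unfolding \<Delta>_def by (rule trunc_second_moment(4)[OF n])
  have "AE \<omega> in M. (\<lambda>j. f j \<omega>) summable_on UNIV"
  proof (rule AE_summable_on)
    show "integrable M (f j)" for j unfolding f_def by (intro Bochner_Integration.integrable_add integrable_mult_right \<Delta>i) simp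
    show "0 \<le> f j \<omega>" for j \<omega> by (simp add: f_def)
    show "(\<integral>\<omega>. f j \<omega> \<partial>M) \<le> (1 + c) * (1 / 2) ^ j" for j
    proof -
      have "(\<integral>\<omega>. (cmod (\<Delta> j \<omega>))\<^sup>2 \<partial>M) \<le> c * (1 + real (16 ^ j)) powr (- (1 / 2))"
        unfolding \<Delta>_def c_def by (rule trunc_second_moment(3)[OF n]) (simp add: power_increasing)
      also have "(1 + real (16 ^ j)) powr (- (1 / 2)) \<le> (1 / 4) ^ j"
      proof -
        have "(1 + real (16 ^ j)) powr (- (1 / 2)) \<le> ((4 ^ j)\<^sup>2) powr (- (1 / 2))"
          by (intro powr_mono2') (auto simp: power_mult_distrib[symmetric] power2_eq_square)
        also have "\<dots> = 1 / 4 ^ j"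
        proof -
          have "((4 ^ j)\<^sup>2) powr (1 / 2) = (4 ^ j :: real)" by (subst powr_half_sqrt) simp_all
          then show ?thesis by (simp only: powr_minus_divide)
        qed
        finally show ?thesis by (simp add: power_divide)
      qed
      then have "c * (1 + real (16 ^ j)) powr (- (1 / 2)) \<le> c * (1 / 4) ^ j" using c0 by (intro mult_left_mono)
      finally have "2 ^ j * (\<integral>\<omega>. (cmod (\<Delta> j \<omega>))\<^sup>2 \<partial>M) \<le> 2 ^ j * (c * (1 / 4) ^ j)" by (intro mult_left_mono) auto
      also have "\<dots> = c * (1 / 2) ^ j" by (simp flip: power_mult_distrib)
      finally have "2 ^ j * (\<integral>\<omega>. (cmod (\<Delta> j \<omega>))\<^sup>2 \<partial>M) \<le> c * (1 / 2) ^ j" .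
      moreover have "(\<integral>\<omega>. f j \<omega> \<partial>M) = (1 / 2) ^ j + 2 ^ j * (\<integral>\<omega>. (cmod (\<Delta> j \<omega>))\<^sup>2 \<partial>M)"
        unfolding f_def using \<Delta>i[of j] by (simp add: prob_space)
      ultimately show ?thesis by (simp add: algebra_simps)
    qed
    show "(\<lambda>j. (1 + c) * (1 / 2) ^ j) summable_on UNIV"
      using c0 by (subst summable_on_UNIV_nonneg_real_iff) (auto intro!: summable_mult summable_geometric)
  qed
  then show ?thesis
  proof eventually_elim
    case (elim \<omega>)
    then have "summable (\<lambda>j. f j \<omega>)" by (subst (asm) summable_on_UNIV_nonneg_real_iff) (auto simp: f_def)
    then have "summable (\<lambda>j. \<Delta> j \<omega>)"
    proof (rule summable_comparison_test'[where N = 0])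
      fix j
      let ?x = "cmod (\<Delta> j \<omega>)"
      have "0 \<le> ((1 / 2) ^ j - ?x)\<^sup>2" by simp
      then have "2 ^ j * (2 * (1 / 2) ^ j * ?x) \<le> 2 ^ j * (((1 / 2) ^ j)\<^sup>2 + ?x\<^sup>2)"
        by (intro mult_left_mono) (auto simp: power2_eq_square algebra_simps)
      moreover have "2 ^ j * (2 * (1 / 2) ^ j * ?x) = 2 * ?x" by (simp flip: power_mult_distrib mult.assoc)
      moreover have "2 ^ j * (((1 / 2) ^ j)\<^sup>2 + ?x\<^sup>2) = f j \<omega>"
      proof -
        have "2 ^ j * ((1 / 2) ^ j)\<^sup>2 = (1 / 2 :: real) ^ j" by (simp add: power2_eq_square flip: power_mult_distrib)
        then show ?thesis by (simp add: f_def distrib_left)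
      qed
      ultimately show "norm (\<Delta> j \<omega>) \<le> f j \<omega>" using norm_ge_zero[of "\<Delta> j \<omega>"] by linarith
    qed
    then have "convergent (\<lambda>N. (\<Sum>j<N. \<Delta> j \<omega>) + trunc (16 ^ 0) 0 n \<omega>)"
      by (intro convergent_add convergent_const) (simp add: summable_iff_convergent)
    then show ?case
      unfolding \<Delta>_def using sum_lessThan_telescope[of "\<lambda>j. trunc (16 ^ j) 0 n \<omega>"] by (simp del: power_Suc)
  qed
qed

text \<open>Summability of this double sequence, an almost sure event, makes all the Lipschitz constants in
  time finite at once, and makes them the coefficients of an element of \<open>sobolev (- e)\<close>. The factor
  \<open>phase_mass n\<close> comes from the weighted Cauchy-Schwarz inequality.\<close>

definition pair_mass :: "real \<Rightarrow> 'a \<Rightarrow> int \<times> int \<Rightarrow> real" where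
  "pair_mass e \<omega> = (\<lambda>(n, k). jbracket n powr (- 2 * e) * phase_mass n * (phase_weight n k * (cmod (pair n k \<omega>))\<^sup>2))"

lemma phase_mass_pos:
  fixes e :: real
  assumes e: "0 < e" "e \<le> 1 / 32" shows "0 < phase_mass n"
proof -
  have "0 < phase_weight n 0" by (rule phase_weight_pos)
  also have "phase_weight n 0 = sum (phase_weight n) {0}" by simp
  also have "\<dots> \<le> phase_mass n"
    unfolding phase_mass_def using phase_weight_pos phase_weight_summable[OF e]
    by (intro finite_sum_le_infsum) (auto simp: less_imp_le)
  finally show ?thesis .
qed

lemma pair_sq_moment: "integrable M (\<lambda>\<omega>. (cmod (pair n k \<omega>))\<^sup>2)" "(\<integral>\<omega>. (cmod (pair n k \<omega>))\<^sup>2 \<partial>M) \<le> 3"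
proof -
  have "(cmod (pair n k \<omega>))\<^sup>2 = cmod (g k \<omega> * g (n - k) \<omega> * (g k \<omega> * g (n - k) \<omega>))" for \<omega>
    by (simp add: pair_def power2_eq_square norm_mult)
  then show "integrable M (\<lambda>\<omega>. (cmod (pair n k \<omega>))\<^sup>2)" "(\<integral>\<omega>. (cmod (pair n k \<omega>))\<^sup>2 \<partial>M) \<le> 3"
    using four_product(3,4)[of k "n - k" k "n - k"] by simp_all
qed

lemma AE_pair_mass_summable:
  assumes e: "0 < e" "e \<le> 1 / 32"
  shows "AE \<omega> in M. pair_mass e \<omega> summable_on UNIV"
proof -
  note pm = phase_mass_pos[OF e]
  define w where "w = (\<lambda>(n, k). jbracket n powr (- 2 * e) * phase_mass n * (phase_weight n k * 3))"
  have "AE \<omega> in M. (\<lambda>p. pair_mass e \<omega> p) summable_on UNIV"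
  proof (rule AE_summable_on)
    fix p :: "int \<times> int"
    obtain n k where p: "p = (n, k)" by force
    show "integrable M (\<lambda>\<omega>. pair_mass e \<omega> p)" 
      unfolding pair_mass_def p using pair_sq_moment[of n k] by simp
    show "0 \<le> pair_mass e \<omega> p" for \<omega>
      unfolding pair_mass_def p using pm[of n] phase_weight_pos[of n k] by simp
    show "(\<integral>\<omega>. pair_mass e \<omega> p \<partial>M) \<le> w p"
      unfolding pair_mass_def p w_def using pair_sq_moment(2)[of n k] pm[of n] phase_weight_pos[of n k]
      by (simp add: mult_left_mono less_imp_le)
  next
    have "w summable_on (SIGMA n:UNIV. UNIV)"
    proof (rule summable_on_SigmaI)
      fix n
      have "(phase_weight n has_sum phase_mass n) UNIV"
        unfolding phase_mass_def by (rule has_sum_infsum[OF phase_weight_summable[OF e]])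
      then have "((\<lambda>k. jbracket n powr (- 2 * e) * phase_mass n * (phase_weight n k * 3)) has_sum 
          jbracket n powr (- 2 * e) * phase_mass n * (phase_mass n * 3)) UNIV"
        by (intro has_sum_cmult_right has_sum_cmult_left)
      then show "((\<lambda>k. w (n, k)) has_sum jbracket n powr (- 2 * e) * phase_mass n * (phase_mass n * 3)) UNIV"
        by (simp add: w_def)
    next
      have eq: "jbracket n powr (- 2 * e) * phase_mass n * (phase_mass n * 3) 
          = 3 * (jbracket n powr - e * cmod (complex_of_real (phase_mass n)))\<^sup>2" for n
      proof -
        have "jbracket n powr (- 2 * e) = (jbracket n powr - e)\<^sup>2" by (simp add: power2_eq_square flip: powr_add)
        then show ?thesis using pm[of n] by (simp add: power2_eq_square)
      qed
      show "(\<lambda>n. jbracket n powr (- 2 * e) * phase_mass n * (phase_mass n * 3)) summable_on UNIV"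
        unfolding eq using phase_mass_sobolev[OF e] by (intro summable_on_cmult_right) (simp add: sobolev_iff)
      show "0 \<le> w (n, k)" for n k using pm[of n] phase_weight_pos[of n k] by (simp add: w_def)
    qed
    then show "w summable_on UNIV" by simp
  qed
  then show ?thesis by simp
qed

text \<open>The factor 2 accounts for the two summands of the phase, which contribute equally because
  \<open>k\<close> and \<open>n - k\<close> can be exchanged.\<close>

definition time_lipschitz :: "'a \<Rightarrow> int \<Rightarrow> real" where
  "time_lipschitz \<omega> n = 2 * (\<Sum>\<^sub>\<infinity>k. phase_weight n k * cmod (pair n k \<omega>))"

lemma time_lipschitz:
  assumes e: "0 < e" "e \<le> 1 / 32" and \<omega>: "pair_mass e \<omega> summable_on UNIV"
  shows "(\<lambda>k. phase_weight n k * cmod (pair n k \<omega>)) summable_on UNIV"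
    and "(\<lambda>n. of_real (time_lipschitz \<omega> n)) \<in> sobolev (- e)"
    and "0 \<le> time_lipschitz \<omega> n"
proof -
  note pm = phase_mass_pos[OF e]
  define V where "V n = (\<Sum>\<^sub>\<infinity>k. phase_weight n k * (cmod (pair n k \<omega>))\<^sup>2)" for n
  have "pair_mass e \<omega> summable_on UNIV \<times> UNIV" using \<omega> by simp
  moreover have nn: "norm (pair_mass e \<omega> p) = pair_mass e \<omega> p" for p
    using pm[of "fst p"] phase_weight_pos[of "fst p" "snd p"] by (simp add: pair_mass_def case_prod_unfold)
  ultimately have "(\<lambda>p. norm (pair_mass e \<omega> p)) summable_on Sigma UNIV (\<lambda>_. UNIV)" by (simp only: nn)
  from Infinite_Sum.abs_summable_on_Sigma_iff[THEN iffD1, OF this]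
  have sec: "\<And>n. (\<lambda>k. pair_mass e \<omega> (n, k)) summable_on UNIV" 
    and tot: "(\<lambda>n. norm (\<Sum>\<^sub>\<infinity>k. pair_mass e \<omega> (n, k))) summable_on UNIV"
    unfolding nn by auto
  have sq: "(\<lambda>k. phase_weight n k * (cmod (pair n k \<omega>))\<^sup>2) summable_on UNIV" for n
  proof -
    have "(\<lambda>k. 1 / (jbracket n powr (- 2 * e) * phase_mass n) * pair_mass e \<omega> (n, k)) summable_on UNIV"
      by (intro summable_on_cmult_right sec)
    then show ?thesis using pm[of n] by (simp add: pair_mass_def)
  qed
  note cs = weighted_cauchy_schwarz[OF phase_weight_summable[OF e] sq less_imp_le[OF phase_weight_pos] norm_ge_zero]
  show "(\<lambda>k. phase_weight n k * cmod (pair n k \<omega>)) summable_on UNIV" for n by (rule cs(1))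
  have nonneg: "0 \<le> time_lipschitz \<omega> n" for n
    unfolding time_lipschitz_def using phase_weight_pos by (simp add: infsum_nonneg less_imp_le)
  then show "0 \<le> time_lipschitz \<omega> n" .
  show "(\<lambda>n. of_real (time_lipschitz \<omega> n)) \<in> sobolev (- e)"
    unfolding sobolev_iff
  proof (rule summable_on_comparison_test)
    show "(\<lambda>n. 4 * norm (\<Sum>\<^sub>\<infinity>k. pair_mass e \<omega> (n, k))) summable_on UNIV"
      by (intro summable_on_cmult_right tot)
    fix n
    have j: "jbracket n powr (- 2 * e) = (jbracket n powr - e)\<^sup>2" by (simp add: power2_eq_square flip: powr_add)
    have "(jbracket n powr - e * cmod (of_real (time_lipschitz \<omega> n)))\<^sup>2 
        = 4 * (jbracket n powr (- 2 * e) * (\<Sum>\<^sub>\<infinity>k. phase_weight n k * cmod (pair n k \<omega>))\<^sup>2)"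
      unfolding j using nonneg[of n] by (simp add: power_mult_distrib time_lipschitz_def)
    also have "\<dots> \<le> 4 * (jbracket n powr (- 2 * e) * (phase_mass n * V n))"
      unfolding phase_mass_def V_def by (intro mult_left_mono cs(2)) auto
    also have "\<dots> = 4 * (\<Sum>\<^sub>\<infinity>k. pair_mass e \<omega> (n, k))"
      by (simp add: pair_mass_def V_def infsum_cmult_right' mult.assoc)
    also have "\<dots> \<le> 4 * norm (\<Sum>\<^sub>\<infinity>k. pair_mass e \<omega> (n, k))" by simp
    finally show "(jbracket n powr - e * cmod (of_real (time_lipschitz \<omega> n)))\<^sup>2 \<le> 4 * norm (\<Sum>\<^sub>\<infinity>k. pair_mass e \<omega> (n, k))" .
  qed auto
qed

lemma trunc_time_difference:
  assumes w: "(\<lambda>k. phase_weight n k * cmod (pair n k \<omega>)) summable_on UNIV"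
  shows "cmod (trunc N t n \<omega> - trunc N t' n \<omega>) \<le> \<bar>t - t'\<bar> * time_lipschitz \<omega> n"
    and "convergent (\<lambda>j. trunc (16 ^ j) t n \<omega> - trunc (16 ^ j) t' n \<omega>)"
proof -
  define \<tau> where "\<tau> k = (pair_coef t n k - pair_coef t' n k) * pair n k \<omega>" for k
  define u where "u k = \<bar>t - t'\<bar> * (phase_weight n k * cmod (pair n k \<omega>) + phase_weight n (n - k) * cmod (pair n (n - k) \<omega>))" for k
  have w': "(\<lambda>k. phase_weight n (n - k) * cmod (pair n (n - k) \<omega>)) summable_on UNIV"
    using w summable_on_int_reflect[of "\<lambda>k. phase_weight n k * cmod (pair n k \<omega>)" n] by simp
  have u: "u summable_on UNIV" unfolding u_def by (intro summable_on_cmult_right summable_on_add w w')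
  have usum: "infsum u UNIV = \<bar>t - t'\<bar> * time_lipschitz \<omega> n"
    unfolding u_def time_lipschitz_def
    using infsum_int_reflect[of "\<lambda>k. phase_weight n k * cmod (pair n k \<omega>)" n]
    by (simp add: infsum_cmult_right' infsum_add[OF w w'])
  have \<tau>u: "cmod (\<tau> k) \<le> u k" for k
  proof -
    have "cmod (\<tau> k) \<le> \<bar>t - t'\<bar> * (phase_weight n k + phase_weight n (n - k)) * cmod (pair n k \<omega>)"
      unfolding \<tau>_def norm_mult by (intro mult_right_mono pair_coef_lipschitz) simp
    then show ?thesis by (simp add: u_def pair_swap algebra_simps)
  qed
  have u0: "0 \<le> u k" for k using \<tau>u[of k] norm_ge_zero[of "\<tau> k"] by linarith
  have diff: "trunc N t n \<omega> - trunc N t' n \<omega> = sum \<tau> (freqs N n)" for N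
    by (simp add: trunc_eq \<tau>_def left_diff_distrib sum_subtractf)
  have "cmod (sum \<tau> (freqs N n)) \<le> sum u (freqs N n)" by (rule sum_norm_le[OF \<tau>u])
  also have "\<dots> \<le> infsum u UNIV" by (rule finite_sum_le_infsum[OF u]) (auto simp: u0)
  finally show "cmod (trunc N t n \<omega> - trunc N t' n \<omega>) \<le> \<bar>t - t'\<bar> * time_lipschitz \<omega> n"
    by (simp add: diff usum)
  have "(\<lambda>k. cmod (\<tau> k)) summable_on UNIV" by (rule summable_on_comparison_test[OF u]) (use \<tau>u in auto)
  then have "\<tau> summable_on UNIV" by (rule Infinite_Sum.abs_summable_summable)
  then have "(sum \<tau> \<longlongrightarrow> infsum \<tau> UNIV) (finite_subsets_at_top UNIV)"
    using has_sum_infsum unfolding has_sum_def by blast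
  moreover have "filterlim (\<lambda>j. freqs (16 ^ j) n) (finite_subsets_at_top UNIV) sequentially"
    by (rule filterlim_freqs) (simp add: less_imp_le power_gt_expt)
  ultimately have "(\<lambda>j. sum \<tau> (freqs (16 ^ j) n)) \<longlonglongrightarrow> infsum \<tau> UNIV"
    by (rule filterlim_compose)
  then show "convergent (\<lambda>j. trunc (16 ^ j) t n \<omega> - trunc (16 ^ j) t' n \<omega>)"
    unfolding diff by (rule convergentI)
qed

text \<open>One subsequence serves for all times and frequencies. So this version is jointly measurable, and
  it inherits the Lipschitz bound in time for almost every sample point.\<close>

definition limit_square :: "'a \<Rightarrow> real \<Rightarrow> int \<Rightarrow> complex" where
  "limit_square \<omega> t n = (if n = 0 then 0 else lim (\<lambda>j. trunc (16 ^ j) t n \<omega>))"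

lemma limit_square_measurable: "(\<lambda>(t, \<omega>). limit_square \<omega> t n) \<in> borel_measurable (borel \<Otimes>\<^sub>M M)"
proof (cases "n = 0")
  case False
  have [measurable]: "(\<lambda>p. trunc N (fst p) n (snd p)) \<in> borel_measurable (borel \<Otimes>\<^sub>M M)" for N
    using trunc_joint_measurable[of N n] by (simp add: case_prod_unfold)
  show ?thesis using False unfolding limit_square_def case_prod_unfold by measurable
qed (simp add: limit_square_def)

lemma limit_square_section_measurable [measurable]: "(\<lambda>\<omega>. limit_square \<omega> t n) \<in> borel_measurable M"
  using measurable_compose[OF measurable_Pair1'[of t borel M] limit_square_measurable[of n]] by simp

text \<open>The quantification over all times is inside the event: convergence at time zero is an almost sure
  event for each frequency, and increments in time converge absolutely.\<close>

definition good :: "'a \<Rightarrow> bool" where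
  "good \<omega> \<longleftrightarrow> (\<forall>n t. n \<noteq> 0 \<longrightarrow> (\<lambda>j. trunc (16 ^ j) t n \<omega>) \<longlonglongrightarrow> limit_square \<omega> t n)"

lemma AE_good: "AE \<omega> in M. good \<omega>"
proof -
  have "AE \<omega> in M. \<forall>n. n \<noteq> 0 \<longrightarrow> convergent (\<lambda>j. trunc (16 ^ j) 0 n \<omega>)"
    using AE_trunc_converges by (subst AE_all_countable) auto
  moreover have "AE \<omega> in M. pair_mass (1 / 32) \<omega> summable_on UNIV"
    by (rule AE_pair_mass_summable) auto
  ultimately show ?thesis
  proof eventually_elim
    case (elim \<omega>)
    show ?case unfolding good_def
    proof (intro allI impI)
      fix n :: int and t :: real assume n: "n \<noteq> 0"
      have "convergent (\<lambda>j. (trunc (16 ^ j) t n \<omega> - trunc (16 ^ j) 0 n \<omega>) + trunc (16 ^ j) 0 n \<omega>)"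
        using elim n time_lipschitz(1)[of "1/32" \<omega> n]
        by (intro convergent_add trunc_time_difference(2)) auto
      then show "(\<lambda>j. trunc (16 ^ j) t n \<omega>) \<longlonglongrightarrow> limit_square \<omega> t n"
        using n by (simp add: limit_square_def convergent_LIMSEQ_iff)
    qed
  qed
qed

lemma limit_square_L2:
  assumes n: "n \<noteq> 0"
  shows "L2_limit M (\<lambda>N \<omega>. trunc N t n \<omega>) (\<lambda>\<omega>. limit_square \<omega> t n)"
    and "0 < d \<Longrightarrow> d < 1 \<Longrightarrow> (\<integral>\<omega>. (cmod (limit_square \<omega> t n))\<^sup>2 \<partial>M) \<le> 24 * zeta (1 + d) * jbracket n powr (d - 1)"
proof -
  let ?r = "\<lambda>K. 12 * zeta (3 / 2) * (1 + real K) powr (- (1 / 2))"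
  have r: "?r \<longlonglongrightarrow> 0" by real_asymp
  have \<rho>: "j \<le> 16 ^ j" for j :: nat by (simp add: less_imp_le power_gt_expt)
  have lim: "AE \<omega> in M. (\<lambda>j. trunc (16 ^ j) t n \<omega>) \<longlonglongrightarrow> limit_square \<omega> t n"
    using AE_good by eventually_elim (use n in \<open>auto simp: good_def\<close>)
  note L = L2_limit_if_AE_limit[where X = "\<lambda>N \<omega>. trunc N t n \<omega>" and Y = "\<lambda>\<omega>. limit_square \<omega> t n" 
      and M = M and \<rho> = "\<lambda>j. 16 ^ j", OF _ _ trunc_second_moment(1)[OF n] trunc_second_moment(3)[OF n] r \<rho> lim]
  show "L2_limit M (\<lambda>N \<omega>. trunc N t n \<omega>) (\<lambda>\<omega>. limit_square \<omega> t n)" by (rule L(1)) measurable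
  show "(\<integral>\<omega>. (cmod (limit_square \<omega> t n))\<^sup>2 \<partial>M) \<le> 24 * zeta (1 + d) * jbracket n powr (d - 1)" if "0 < d" "d < 1"
    by (rule L(2)) (use trunc_second_moment(2)[OF n that] in auto)
qed

lemma square_version_limit_square: "square_version M g limit_square"
  unfolding square_version_def trunc_def[symmetric]
  using limit_square_measurable limit_square_L2(1) by blast

lemma AE_limit_square_zero_sobolev:
  assumes e: "0 < e" "e < 1"
  shows "AE \<omega> in M. limit_square \<omega> 0 \<in> sobolev (- e)"
  unfolding sobolev_iff
proof (rule AE_summable_on)
  let ?c = "24 * zeta (1 + e)"
  fix n
  have "integrable M (\<lambda>\<omega>. (cmod (limit_square \<omega> 0 n))\<^sup>2) \<and> (\<integral>\<omega>. (cmod (limit_square \<omega> 0 n))\<^sup>2 \<partial>M) \<le> ?c * jbracket n powr (e - 1)"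
  proof (cases "n = 0")
    case True
    then show ?thesis by (simp add: limit_square_def zeta_nonneg)
  next
    case False
    then show ?thesis
      using limit_square_L2(1)[OF False, of 0] limit_square_L2(2)[OF False e, of 0] by (simp add: L2_limit_def)
  qed
  then have 1: "integrable M (\<lambda>\<omega>. (cmod (limit_square \<omega> 0 n))\<^sup>2)" 
    and 2: "(\<integral>\<omega>. (cmod (limit_square \<omega> 0 n))\<^sup>2 \<partial>M) \<le> ?c * jbracket n powr (e - 1)" by auto
  show "integrable M (\<lambda>\<omega>. (jbracket n powr - e * cmod (limit_square \<omega> 0 n))\<^sup>2)"
    unfolding power_mult_distrib using 1 by simp
  have "(\<integral>\<omega>. (jbracket n powr - e * cmod (limit_square \<omega> 0 n))\<^sup>2 \<partial>M) 
      = (jbracket n powr - e)\<^sup>2 * (\<integral>\<omega>. (cmod (limit_square \<omega> 0 n))\<^sup>2 \<partial>M)"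
    unfolding power_mult_distrib by simp
  also have "\<dots> \<le> (jbracket n powr - e)\<^sup>2 * (?c * jbracket n powr (e - 1))"
    by (intro mult_left_mono 2) simp
  also have "\<dots> = ?c * (jbracket n powr - e * jbracket n powr - e * jbracket n powr (e - 1))"
    by (simp only: power2_eq_square mult_ac)
  also have "jbracket n powr - e * jbracket n powr - e * jbracket n powr (e - 1) = jbracket n powr (- (1 + e))"
    unfolding powr_add[symmetric] by (rule arg_cong) simp
  finally show "(\<integral>\<omega>. (jbracket n powr - e * cmod (limit_square \<omega> 0 n))\<^sup>2 \<partial>M) \<le> ?c * jbracket n powr (- (1 + e))" .
next
  show "(\<lambda>n. 24 * zeta (1 + e) * jbracket n powr (- (1 + e))) summable_on UNIV"
    using e by (intro summable_on_cmult_right summable_jbracket_powr) auto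
qed auto

lemma random_data_hermitian:
  assumes "\<omega> \<in> space M" shows "hermitian (random_data g \<omega>)"
  using g_minus[OF assms] by (simp add: hermitian_def random_data_def)

lemma limit_square_hermitian:
  assumes \<omega>: "\<omega> \<in> space M" "good \<omega>" shows "hermitian (limit_square \<omega> t)"
  unfolding hermitian_def
proof
  fix n
  have h: "hermitian (free_evol g \<omega> t)"
    using random_data_hermitian[OF \<omega>(1)] by (simp add: hermitian_def free_evol_def S_prop_def exp_cnj)
  show "limit_square \<omega> t (- n) = cnj (limit_square \<omega> t n)"
  proof (cases "n = 0")
    case False
    have "(\<lambda>j. trunc (16 ^ j) t (- n) \<omega>) \<longlonglongrightarrow> limit_square \<omega> t (- n)"
      using \<omega> False by (simp add: good_def)
    moreover have "(\<lambda>j. cnj (trunc (16 ^ j) t n \<omega>)) \<longlonglongrightarrow> cnj (limit_square \<omega> t n)"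
      using \<omega> False by (intro tendsto_cnj) (simp add: good_def)
    ultimately show ?thesis
      unfolding trunc_def trunc_square_hermitian[OF h] by (rule LIMSEQ_unique)
  qed (simp add: limit_square_def)
qed

lemma AE_log_mass: 
  "AE \<omega> in M. (\<lambda>n. (cmod (random_data g \<omega> n))\<^sup>2 / (1 + ln (jbracket n)) powr (3 / 2)) summable_on UNIV"
proof -
  have eq: "(cmod (random_data g \<omega> n))\<^sup>2 / (1 + ln (jbracket n)) powr (3 / 2) 
      = 1 / (jbracket n * (1 + ln (jbracket n)) powr (3 / 2)) * cmod (g n \<omega>) ^ 2" for n \<omega>
  proof -
    have "(jbracket n powr (1 / 2))\<^sup>2 = jbracket n"
      by (simp add: power2_eq_square abs_of_pos flip: powr_add)
    then show ?thesis by (simp add: random_data_def norm_divide power_divide)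
  qed
  show ?thesis unfolding eq
  proof (rule AE_summable_on)
    fix n
    have "(\<integral>\<omega>. cmod (g n \<omega>) ^ 2 \<partial>M) \<le> (\<integral>\<omega>. 1 + cmod (g n \<omega>) ^ 4 \<partial>M)"
    proof (rule integral_mono)
      show "x\<^sup>2 \<le> 1 + x ^ 4" for x :: real
        using zero_le_power2[of "x\<^sup>2 - 1"] zero_le_power2[of "x\<^sup>2"] by (simp add: power2_eq_square power4_eq_xxxx algebra_simps)
    qed (use integrable_power_le_4[of 2 n] fourth_moment(1)[of n] in auto)
    also have "\<dots> \<le> 4" using fourth_moment[of n] by (simp add: prob_space)
    finally have "(\<integral>\<omega>. cmod (g n \<omega>) ^ 2 \<partial>M) \<le> 4" .
    then have "1 / (jbracket n * (1 + ln (jbracket n)) powr (3 / 2)) * (\<integral>\<omega>. cmod (g n \<omega>) ^ 2 \<partial>M)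
       \<le> 1 / (jbracket n * (1 + ln (jbracket n)) powr (3 / 2)) * 4"
      by (rule mult_left_mono) (simp add: less_imp_le)
    then show "(\<integral>\<omega>. 1 / (jbracket n * (1 + ln (jbracket n)) powr (3 / 2)) * cmod (g n \<omega>) ^ 2 \<partial>M) 
       \<le> 4 * (1 / (jbracket n * (1 + ln (jbracket n)) powr (3 / 2)))"
      unfolding integral_mult_right_zero by (simp only: mult.commute)
    show "integrable M (\<lambda>\<omega>. 1 / (jbracket n * (1 + ln (jbracket n)) powr (3 / 2)) * cmod (g n \<omega>) ^ 2)"
      using integrable_power_le_4[of 2 n] by (intro integrable_mult_right) simp
  next
    show "(\<lambda>n. 4 * (1 / (jbracket n * (1 + ln (jbracket n)) powr (3 / 2)))) summable_on UNIV"
      by (intro summable_on_cmult_right summable_jbracket_ln)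
  qed (simp add: less_imp_le)
qed

section \<open>Almost sure well-posedness\<close>

text \<open>The interface between the two parts of the proof; once this almost sure event is fixed, the
  solution is constructed pathwise.\<close>

lemma AE_bbm_data:
  assumes e: "0 < e" "e \<le> 1 / 32"
  shows "AE \<omega> in M. \<exists>D. bbm_data e D (random_data g \<omega>) (limit_square \<omega>)"
proof -
  have "AE \<omega> in M. limit_square \<omega> 0 \<in> sobolev (- e)"
    using e by (intro AE_limit_square_zero_sobolev) auto
  from AE_space AE_good AE_pair_mass_summable[OF e] AE_log_mass this
  show ?thesis
  proof eventually_elim
    case (elim \<omega>)
    define L where "L = (\<lambda>n. complex_of_real (time_lipschitz \<omega> n))"
    note tl = time_lipschitz[OF e elim(3)]
    have lip: "cmod (limit_square \<omega> t n - limit_square \<omega> t' n) \<le> \<bar>t - t'\<bar> * cmod (L n)" for t t' n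
    proof (cases "n = 0")
      case False
      have "(\<lambda>j. cmod (trunc (16 ^ j) t n \<omega> - trunc (16 ^ j) t' n \<omega>)) \<longlonglongrightarrow> cmod (limit_square \<omega> t n - limit_square \<omega> t' n)"
        using elim(2) False by (intro tendsto_intros) (auto simp: good_def)
      then have "cmod (limit_square \<omega> t n - limit_square \<omega> t' n) \<le> \<bar>t - t'\<bar> * time_lipschitz \<omega> n"
        by (rule LIMSEQ_le_const2) (use trunc_time_difference(1)[OF tl(1)] in blast)
      then show ?thesis using tl(3)[of n] by (simp add: L_def)
    qed (simp add: limit_square_def)
    have diff: "(\<lambda>n. limit_square \<omega> t n - limit_square \<omega> t' n) \<in> sobolev (- e)"
      "sobolev_norm (- e) (\<lambda>n. limit_square \<omega> t n - limit_square \<omega> t' n) \<le> \<bar>t - t'\<bar> * sobolev_norm (- e) L" for t t'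
    proof -
      have "jbracket n powr - e * cmod (limit_square \<omega> t n - limit_square \<omega> t' n) 
          \<le> \<bar>t - t'\<bar> * (jbracket n powr - e * cmod (L n))" for n
        using mult_left_mono[OF lip[of t n t'], of "jbracket n powr - e"] by (simp add: mult_ac)
      from sobolev_dominated[OF tl(2)[folded L_def] _ this]
      show "(\<lambda>n. limit_square \<omega> t n - limit_square \<omega> t' n) \<in> sobolev (- e)"
        "sobolev_norm (- e) (\<lambda>n. limit_square \<omega> t n - limit_square \<omega> t' n) \<le> \<bar>t - t'\<bar> * sobolev_norm (- e) L"
        by simp_all
    qed
    have "bbm_data e (sobolev_norm (- e) L) (random_data g \<omega>) (limit_square \<omega>)"
    proof
      show "limit_square \<omega> t \<in> sobolev (- e)" for t
        using sobolev_add(1)[OF elim(5) diff(1)[of t 0]] by simp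
      show "hermitian (limit_square \<omega> t)" for t by (rule limit_square_hermitian[OF elim(1,2)])
      show "sobolev_norm (- e) (\<lambda>n. limit_square \<omega> t n - limit_square \<omega> t' n) \<le> sobolev_norm (- e) L * \<bar>t - t'\<bar>" for t t'
        using diff(2)[of t t'] by (simp add: mult.commute)
    qed (use e log_mass_sobolev[OF elim(4)] log_mass_growth[OF elim(4)] random_data_hermitian[OF elim(1)] in auto)
    then show ?case by blast
  qed
qed

text \<open>Any two versions agree, for almost every sample point, at almost every time: mean square limits
  are unique at each time, and Fubini's theorem exchanges the quantifiers.\<close>

lemma AE_version_eq_limit_square:
  assumes Q: "square_version M g Q"
  shows "AE \<omega> in M. AE t in lborel. \<forall>n. n \<noteq> 0 \<longrightarrow> Q \<omega> t n = limit_square \<omega> t n"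
proof -
  interpret P: pair_sigma_finite lborel M ..
  have one: "AE \<omega> in M. AE t in lborel. Q \<omega> t n = limit_square \<omega> t n" if n: "n \<noteq> 0" for n
  proof -
    have [measurable]: "(\<lambda>p. Q (snd p) (fst p) n) \<in> borel_measurable (lborel \<Otimes>\<^sub>M M)"
      "(\<lambda>p. limit_square (snd p) (fst p) n) \<in> borel_measurable (lborel \<Otimes>\<^sub>M M)"
      using Q n limit_square_measurable[of n] unfolding square_version_def
      by (auto simp: case_prod_unfold cong: measurable_cong_sets sets_pair_measure_cong)
    have "AE t in lborel. AE \<omega> in M. Q \<omega> t n = limit_square \<omega> t n"
    proof (rule AE_I2)
      fix t
      show "AE \<omega> in M. Q \<omega> t n = limit_square \<omega> t n"
        by (rule L2_limit_unique[where X = "\<lambda>N \<omega>. trunc N t n \<omega>"])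
          (use Q n limit_square_L2(1)[OF n] in \<open>auto simp: square_version_def trunc_def[symmetric]\<close>)
    qed
    moreover have "{p \<in> space (lborel \<Otimes>\<^sub>M M). Q (snd p) (fst p) n = limit_square (snd p) (fst p) n} \<in> sets (lborel \<Otimes>\<^sub>M M)"
      by measurable
    ultimately show ?thesis
      using P.AE_commute[of "\<lambda>t \<omega>. Q \<omega> t n = limit_square \<omega> t n"] by simp
  qed
  then have "AE \<omega> in M. \<forall>n. n \<noteq> 0 \<longrightarrow> (AE t in lborel. Q \<omega> t n = limit_square \<omega> t n)"
    by (subst AE_all_countable) auto
  then show ?thesis
    by eventually_elim (subst AE_all_countable, auto)
qed

text \<open>The regularity \<open>s\<close> determines the roughness parameter by \<open>s = 1 - 8 * e\<close>; the condition
  \<open>s > 3 / 4\<close> is \<open>e < 1 / 32\<close>.\<close>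

lemma AE_wellposed:
  assumes Q: "square_version M g Q" and r: "0 < r" and s: "3 / 4 < s" "s < 1"
  shows "AE \<omega> in M. affine_class (free_evol g \<omega>) s \<subseteq> C_sobolev (- r) \<and>
     (\<exists>!u. u \<in> affine_class (free_evol g \<omega>) s \<and> u 0 = random_data g \<omega> \<and>
           bbm_solution (free_evol g \<omega>) (Q \<omega>) (random_data g \<omega>) u)"
proof -
  define e where "e = (1 - s) / 8"
  have e: "0 < e" "e \<le> 1 / 32" using s by (auto simp: e_def)
  from AE_space AE_bbm_data[OF e] AE_log_mass AE_version_eq_limit_square[OF Q]
  show ?thesis
  proof eventually_elim
    case (elim \<omega>)
    then obtain D where "bbm_data e D (random_data g \<omega>) (limit_square \<omega>)" by blast
    then interpret B: bbm_data e D "random_data g \<omega>" "limit_square \<omega>" .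
    have "B.s = 1 - 8 * e" by (rule B.s_def)
    also have "\<dots> = s" by (simp add: e_def field_simps)
    finally have s_eq: "B.s = s" .
    have fe: "free_evol g \<omega> = (\<lambda>t. S_prop t (random_data g \<omega>))" by (auto simp: free_evol_def)
    have meas: "(\<lambda>t. Q \<omega> t n) \<in> borel_measurable borel" if "n \<noteq> 0" for n
    proof -
      have "(\<lambda>t. (t, \<omega>)) \<in> measurable borel (borel \<Otimes>\<^sub>M M)"
        by (rule measurable_Pair2'[OF elim(1)])
      moreover have "(\<lambda>(t, \<omega>). Q \<omega> t n) \<in> borel_measurable (borel \<Otimes>\<^sub>M M)"
        using Q that unfolding square_version_def by blast
      ultimately have "(\<lambda>t. case (t, \<omega>) of (t, \<omega>) \<Rightarrow> Q \<omega> t n) \<in> borel_measurable borel"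
        by (rule measurable_compose)
      then show ?thesis by (simp only: prod.case)
    qed
    have "affine_class (free_evol g \<omega>) s \<subseteq> C_sobolev (- r)"
      unfolding fe using r s by (intro affine_class_subset log_mass_sobolev[OF elim(3)]) auto
    moreover have "bbm_solution (free_evol g \<omega>) (Q \<omega>) (random_data g \<omega>) u 
        \<longleftrightarrow> bbm_solution (free_evol g \<omega>) (limit_square \<omega>) (random_data g \<omega>) u" 
      if "u \<in> affine_class (free_evol g \<omega>) s" for u
      using B.bbm_solution_cong_AE[OF _ meas elim(4)] that unfolding fe s_eq by blast
    then have "\<exists>!u. u \<in> affine_class (free_evol g \<omega>) s \<and> u 0 = random_data g \<omega> \<and>
           bbm_solution (free_evol g \<omega>) (Q \<omega>) (random_data g \<omega>) u"
      using B.bbm_wellposed unfolding s_eq fe[symmetric] by (metis (no_types, lifting))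
    ultimately show ?case by blast
  qed
qed

end

theorem theorem1p5:
  fixes M :: "'a measure" and g :: "int \<Rightarrow> 'a \<Rightarrow> complex"
  assumes "prob_space M"
    and "std_real_gaussian M (g 0)"
    and "\<And>n. n \<noteq> 0 \<Longrightarrow> std_complex_gaussian M (g n)"
    and "\<And>n \<omega>. \<omega> \<in> space M \<Longrightarrow> g (- n) \<omega> = cnj (g n \<omega>)"
    and "prob_space.indep_vars M (\<lambda>_. borel) g {0..}"
  shows "(\<exists>Q. square_version M g Q) \<and>
    (\<exists>\<epsilon>\<^sub>0>0. \<exists>s\<^sub>0<1. \<forall>Q \<epsilon> s. square_version M g Q \<longrightarrow> 0 < \<epsilon> \<longrightarrow> \<epsilon> < \<epsilon>\<^sub>0 \<longrightarrow> s\<^sub>0 < s \<longrightarrow> s < 1 \<longrightarrow>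
      (AE \<omega> in M.
         affine_class (free_evol g \<omega>) s \<subseteq> C_sobolev (- \<epsilon>) \<and>
         (\<exists>!u. u \<in> affine_class (free_evol g \<omega>) s \<and>
               u 0 = random_data g \<omega> \<and>
               bbm_solution (free_evol g \<omega>) (Q \<omega>) (random_data g \<omega>) u)))"
proof -
  interpret prob_space M by fact
  interpret gaussian_data M g by unfold_locales (fact assms)+
  show ?thesis
  proof (intro conjI)
    show "\<exists>Q. square_version M g Q" using square_version_limit_square by blast
    show "\<exists>\<epsilon>\<^sub>0>0. \<exists>s\<^sub>0<1. \<forall>Q \<epsilon> s. square_version M g Q \<longrightarrow> 0 < \<epsilon> \<longrightarrow> \<epsilon> < \<epsilon>\<^sub>0 \<longrightarrow> s\<^sub>0 < s \<longrightarrow> s < 1 \<longrightarrow>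
      (AE \<omega> in M.
         affine_class (free_evol g \<omega>) s \<subseteq> C_sobolev (- \<epsilon>) \<and>
         (\<exists>!u. u \<in> affine_class (free_evol g \<omega>) s \<and>
               u 0 = random_data g \<omega> \<and>
               bbm_solution (free_evol g \<omega>) (Q \<omega>) (random_data g \<omega>) u))"
      using AE_wellposed by (intro exI[of _ "1 :: real"] conjI exI[of _ "3 / 4 :: real"]) auto
  qed
qed

end
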